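(* Let $(M,\Omega,\mathbb{T},\mu)$ be a compact toric symplectic manifold, $J_+\in DGK_\Omega^{\mathbb{T}}(M)$, $\mathbb{J}_1$ the associated generalized complex structure, $\beta_1$ the associated real Poisson structure, and $J_0$ the complex structure on $\mathring M$ given in admissible coordinates associated to $J_+$ by $J_0\partial_{\mu_k}=\sum_j(\phi_s)_{kj}\partial_{\theta_j}$. Then on $\mathring M$ the bivector $$\beta:=-\tfrac14\big(J_0\beta_1+\sqrt{-1}\,\beta_1\big)$$ is a $J_0$-holomorphic Poisson structure, and $\mathbb{J}_1$ is a B-transform of the generalized complex structure $\mathbb{J}_\beta$ induced from $\beta$, i.e. there is a real 2-form $B$ on $\mathring M$ with $\mathbb{J}_1=e^{-B}\mathbb{J}_\beta e^{B}$.
   Context: Setting. $M$ is a compact connected manifold of dimension $2n$ with symplectic form $\Omega$ and an effective Hamiltonian action of the torus $\mathbb{T}=\mathbb{T}^n$ with moment map $\mu:M\to\mathfrak{t}^*$. Fix a basis $\{e_j\}$ of $\mathfrak{t}$, let $X_j$ be the fundamental vector fields and $\mu_j$ the components of $\mu$; convention $\iota_{X_j}\Omega=-d\mu_j$. $\Delta=\mu(M)$ is the moment polytope, $\mathring\Delta$ its interior, $\mathring M=\mu^{-1}(\mathring\Delta)$. Conventions. 2-forms and metrics are regarded as maps $TM\to T^*M$, $X\mapsto\iota_X(\cdot)$; bivectors as maps $T^*M\to TM$; $(J^*\alpha)(X)=\alpha(JX)$. For a real 2-form $B$, $e^B(X+\xi)=X+\xi+B(X)$ on $TM\oplus T^*M$.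 $GK_\Omega^{\mathbb T}(M)$ is the set of $\mathbb{T}$-invariant integrable complex structures $J_+$ on $M$ that are tamed by $\Omega$ (i.e. $\Omega(X,J_+X)>0$ for $X\ne0$) and for which $J_-:=-\Omega^{-1}J_+^*\Omega$ is also integrable; these parametrize $\mathbb{T}$-invariant generalized Kähler structures $(\mathbb{J}_1,\mathbb{J}_2)$ with $\mathbb{J}_2$ a B-transform of the generalized complex structure of $\Omega$. Put $g=-\frac12\Omega(J_++J_-)$ (a Riemannian metric), $\omega_\pm=gJ_\pm$. In the metric splitting, $$\mathbb{J}_1=\frac12\begin{pmatrix}-J_+-J_-&\omega_+^{-1}-\omega_-^{-1}\\-\omega_++\omega_-&J_+^*+J_-^*\end{pmatrix}$$ on $TM\oplus T^*M$, and $\beta_1=-\frac12(J_+-J_-)g^{-1}$. $DGK_\Omega^{\mathbb T}(M)$ is the subset with $J_+\mathcal D=J_-\mathcal D$ on $\mathring M$, where $\mathcal D=\mathrm{span}\{X_j\}$. Admissible coordinates. For $J_+\in DGK_\Omega^{\mathbb T}(M)$, $\{X_j,J_+X_j\}$ is a frame on $\mathring M$; the first half $\{\zeta_j\}$ of the dual coframe is closed, locally $\zeta_j=d\theta_j$, and $(\theta_j,\mu_j)$ are coordinates on $\mathring M$ with $\partial_{\theta_j}=X_j$ and $\Omega=\sum_j d\mu_j\wedge d\theta_j$, called admissible coordinates associated to $J_+$. In them $J_+\partial_{\mu_k}=\sum_j\phi_{kj}\partial_{\theta_j}$ and $J_-\partial_{\mu_k}=\sum_j\phi_{jk}\partial_{\theta_j}$,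 where $\phi$ is a matrix function of $\mu\in\mathring\Delta$ whose symmetric part $\phi_s$ is the positive-definite Hessian of a function $\tau$ on $\mathring\Delta$ and whose anti-symmetric part $\phi_a$ is constant. For a complex structure $J$ and a $J$-holomorphic Poisson bivector $\beta$, $$\mathbb{J}_\beta=\begin{pmatrix}-J&-4\,\mathrm{Im}\,\beta\\0&J^*\end{pmatrix}.$$ *)

theory Defs
  imports "HOL-Analysis.Analysis"
begin

section \<open>Smooth functions and smooth manifolds\<close>

text \<open>On an open set \<open>S\<close>: all iterated directional derivatives up to order \<open>k\<close> exist and are
  continuous.\<close>

primrec k_smooth_on :: "nat \<Rightarrow> 'a::euclidean_space set \<Rightarrow> ('a \<Rightarrow> 'b::real_normed_vector) \<Rightarrow> bool" where
  "k_smooth_on 0 S f \<longleftrightarrow> continuous_on S f"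
| "k_smooth_on (Suc k) S f \<longleftrightarrow>
     (\<forall>x\<in>S. f differentiable (at x)) \<and> (\<forall>v. k_smooth_on k S (\<lambda>x. frechet_derivative f (at x) v))"

definition smooth_on :: "'a::euclidean_space set \<Rightarrow> ('a \<Rightarrow> 'b::real_normed_vector) \<Rightarrow> bool" where
  "smooth_on S f \<longleftrightarrow> (\<forall>k. k_smooth_on k S f)"

text \<open>A manifold is a topological space (all of the type \<open>'m\<close>) with a maximal smooth atlas.
  A chart is a domain together with a coordinate map, whose values off the domain are irrelevant.\<close>

type_synonym ('m, 'k) chart = "'m set \<times> ('m \<Rightarrow> real^'k)"

abbreviation cdom :: "('m, 'k::finite) chart \<Rightarrow> 'm set" where
  "cdom c \<equiv> fst c"

abbreviation crd :: "('m, 'k::finite) chart \<Rightarrow> 'm \<Rightarrow> real^'k" where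
  "crd c \<equiv> snd c"

definition pt :: "('m, 'k::finite) chart \<Rightarrow> real^'k \<Rightarrow> 'm" where
  "pt c = inv_into (cdom c) (crd c)"

definition is_chart :: "('m::topological_space, 'k::finite) chart \<Rightarrow> bool" where
  "is_chart c \<longleftrightarrow> open (cdom c) \<and> open (crd c ` cdom c) \<and> homeomorphism (cdom c) (crd c ` cdom c) (crd c) (pt c)"

definition smooth_transition :: "('m, 'k::finite) chart \<Rightarrow> ('m, 'k) chart \<Rightarrow> bool" where
  "smooth_transition c d \<longleftrightarrow> smooth_on (crd c ` (cdom c \<inter> cdom d)) (\<lambda>x. crd d (pt c x))"

definition smooth_structure :: "('m::topological_space, 'k::finite) chart set \<Rightarrow> bool" where
  "smooth_structure A \<longleftrightarrow>
     (\<forall>c\<in>A. is_chart c) \<and> (\<Union>c\<in>A. cdom c) = UNIV \<and>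
     (\<forall>c\<in>A. \<forall>d\<in>A. smooth_transition c d) \<and>
     (\<forall>c. is_chart c \<and> (\<forall>d\<in>A. smooth_transition c d \<and> smooth_transition d c) \<longrightarrow> c \<in> A)"

text \<open>The differential of \<open>F\<close> at \<open>p\<close>, as a matrix in the charts \<open>c\<close> (around \<open>p\<close>) and \<open>d\<close>
  (around \<open>F p\<close>).\<close>

definition dmap :: "('m \<Rightarrow> 'm) \<Rightarrow> ('m, 'k::finite) chart \<Rightarrow> ('m, 'k) chart \<Rightarrow> 'm \<Rightarrow> real^'k^'k" where
  "dmap F c d p = jacobian (\<lambda>x. crd d (F (pt c x))) (at (crd c p))"

section \<open>Tensor fields\<close>

text \<open>A tensor field is given by its components in every chart, subject to the transformation law.
  All tensors needed are maps between \<open>TM\<close> and \<open>T*M\<close>, so their components form a square matrix: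
  vectors and covectors at \<open>p\<close> are column vectors with respect to the coordinate frame and coframe,
  the pairing of a covector with a vector is \<open>\<bullet>\<close>, and \<open>J*\<close> has the transposed matrix.
  A 2-form \<open>W\<close> is the matrix of \<open>X \<mapsto> \<iota>_X W\<close>, i.e. \<open>W(X,Y) = (W *v X) \<bullet> Y\<close> and the
  \<open>(i,j)\<close> matrix entry is \<open>W(\<partial>_j,\<partial>_i)\<close>; likewise \<open>\<beta>(\<xi>,\<eta>) = (\<beta> *v \<xi>) \<bullet> \<eta>\<close> for a bivector.\<close>

type_synonym ('m, 'k, 't) field = "('m, 'k) chart \<Rightarrow> 'm \<Rightarrow> 't"

definition smooth_field ::
  "('m, 'k::finite) chart set \<Rightarrow> 'm set \<Rightarrow> ('m, 'k, 't::real_normed_vector) field \<Rightarrow> bool" where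
  "smooth_field A U T \<longleftrightarrow> (\<forall>c\<in>A. smooth_on (crd c ` (cdom c \<inter> U)) (\<lambda>x. T c (pt c x)))"

definition cmat :: "real^'k^'k \<Rightarrow> complex^'k^'k" where
  "cmat P = (\<chi> i j. complex_of_real (P $ i $ j))"

definition endo_field :: "('m, 'k::finite) chart set \<Rightarrow> 'm set \<Rightarrow> ('m, 'k, real^'k^'k) field \<Rightarrow> bool" where
  "endo_field A U J \<longleftrightarrow> smooth_field A U J \<and>
     (\<forall>c\<in>A. \<forall>d\<in>A. \<forall>p \<in> cdom c \<inter> cdom d \<inter> U. J d p ** dmap id c d p = dmap id c d p ** J c p)"

definition two_form :: "('m, 'k::finite) chart set \<Rightarrow> 'm set \<Rightarrow> ('m, 'k, real^'k^'k) field \<Rightarrow> bool" where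
  "two_form A U W \<longleftrightarrow> smooth_field A U W \<and>
     (\<forall>c\<in>A. \<forall>p \<in> cdom c \<inter> U. transpose (W c p) = - W c p) \<and>
     (\<forall>c\<in>A. \<forall>d\<in>A. \<forall>p \<in> cdom c \<inter> cdom d \<inter> U.
        W c p = transpose (dmap id c d p) ** W d p ** dmap id c d p)"

definition complex_bivector :: "('m, 'k::finite) chart set \<Rightarrow> 'm set \<Rightarrow> ('m, 'k, complex^'k^'k) field \<Rightarrow> bool" where
  "complex_bivector A U b \<longleftrightarrow> smooth_field A U b \<and>
     (\<forall>c\<in>A. \<forall>p \<in> cdom c \<inter> U. transpose (b c p) = - b c p) \<and>
     (\<forall>c\<in>A. \<forall>d\<in>A. \<forall>p \<in> cdom c \<inter> cdom d \<inter> U.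
        b d p = cmat (dmap id c d p) ** b c p ** transpose (cmat (dmap id c d p)))"

text \<open>Partial derivative, at \<open>p\<close>, of the components of \<open>T\<close> in the chart \<open>c\<close>.\<close>

definition pd :: "('m, 'k::finite, 't::real_normed_vector) field \<Rightarrow> ('m, 'k) chart \<Rightarrow> 'k \<Rightarrow> 'm \<Rightarrow> 't" where
  "pd T c i p = frechet_derivative (\<lambda>x. T c (pt c x)) (at (crd c p)) (axis i 1)"

definition closed_form :: "('m, 'k::finite) chart set \<Rightarrow> 'm set \<Rightarrow> ('m, 'k, real^'k^'k) field \<Rightarrow> bool" where
  "closed_form A U W \<longleftrightarrow> (\<forall>c\<in>A. \<forall>p \<in> cdom c \<inter> U. \<forall>i j l.
     pd W c i p $ j $ l + pd W c j p $ l $ i + pd W c l p $ i $ j = 0)"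

definition symplectic_form :: "('m, 'k::finite) chart set \<Rightarrow> ('m, 'k, real^'k^'k) field \<Rightarrow> bool" where
  "symplectic_form A W \<longleftrightarrow> two_form A UNIV W \<and> closed_form A UNIV W \<and>
     (\<forall>c\<in>A. \<forall>p \<in> cdom c. invertible (W c p))"

section \<open>Complex structures and holomorphic Poisson structures\<close>

definition almost_complex :: "('m, 'k::finite) chart set \<Rightarrow> 'm set \<Rightarrow> ('m, 'k, real^'k^'k) field \<Rightarrow> bool" where
  "almost_complex A U J \<longleftrightarrow> endo_field A U J \<and> (\<forall>c\<in>A. \<forall>p \<in> cdom c \<inter> U. J c p ** J c p = - mat 1)"

definition lie_bracket :: "(real^'k \<Rightarrow> real^'k) \<Rightarrow> (real^'k \<Rightarrow> real^'k) \<Rightarrow> real^'k \<Rightarrow> real^'k" where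
  "lie_bracket X Y x = frechet_derivative Y (at x) (X x) - frechet_derivative X (at x) (Y x)"

text \<open>Integrability is vanishing of the Nijenhuis tensor.\<close>

definition complex_structure :: "('m, 'k::finite) chart set \<Rightarrow> 'm set \<Rightarrow> ('m, 'k, real^'k^'k) field \<Rightarrow> bool" where
  "complex_structure A U J \<longleftrightarrow> almost_complex A U J \<and>
     (\<forall>c\<in>A. \<forall>X Y. let W = crd c ` (cdom c \<inter> U); K = (\<lambda>x. J c (pt c x)) in
        smooth_on W X \<and> smooth_on W Y \<longrightarrow>
        (\<forall>x\<in>W. lie_bracket (\<lambda>y. K y *v X y) (\<lambda>y. K y *v Y y) x
               - K x *v lie_bracket (\<lambda>y. K y *v X y) Y x
               - K x *v lie_bracket X (\<lambda>y. K y *v Y y) x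
               - lie_bracket X Y x = 0))"

definition block :: "'a^'k^'k \<Rightarrow> 'a^'k^'k \<Rightarrow> 'a^'k^'k \<Rightarrow> 'a^'k^'k \<Rightarrow> 'a^('k+'k)^('k+'k)" where
  "block P Q R S = (\<chi> i j. case i of
       Inl a \<Rightarrow> (case j of Inl b \<Rightarrow> P $ a $ b | Inr b \<Rightarrow> Q $ a $ b)
     | Inr a \<Rightarrow> (case j of Inl b \<Rightarrow> R $ a $ b | Inr b \<Rightarrow> S $ a $ b))"

text \<open>Under the identification of \<open>\<real>\<close>-coordinates indexed by \<open>'n + 'n\<close> with complex coordinates
  \<open>z_j = x_(Inl j) + \<i> x_(Inr j)\<close>, a chart is \<open>J\<close>-holomorphic iff \<open>J\<close> is the standard complex
  structure in it (\<open>\<partial>_(Inl j) \<mapsto> \<partial>_(Inr j) \<mapsto> - \<partial>_(Inl j)\<close>).\<close>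

definition Jstd :: "real^('n::finite+'n)^('n+'n)" where
  "Jstd = block 0 (- mat 1) (mat 1) 0"

definition dz :: "'n::finite \<Rightarrow> complex^('n+'n)" where
  "dz j = axis (Inl j) 1 + axis (Inr j) \<i>"

definition holomorphic_chart ::
  "('m, 'n::finite+'n) chart set \<Rightarrow> 'm set \<Rightarrow> ('m, 'n+'n, real^('n+'n)^('n+'n)) field \<Rightarrow> ('m, 'n+'n) chart \<Rightarrow> bool" where
  "holomorphic_chart A U J c \<longleftrightarrow> c \<in> A \<and> cdom c \<subseteq> U \<and> (\<forall>p \<in> cdom c. J c p = Jstd)"

definition holomorphic_fun :: "(real^('n::finite+'n)) set \<Rightarrow> (real^('n+'n) \<Rightarrow> complex) \<Rightarrow> bool" where
  "holomorphic_fun W f \<longleftrightarrow> (\<forall>x\<in>W. f differentiable (at x) \<and>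
     (\<forall>v. frechet_derivative f (at x) (Jstd *v v) = \<i> * frechet_derivative f (at x) v))"

text \<open>A holomorphic Poisson structure: an integrable \<open>J\<close> and a bivector of type (2,0) (it maps \<open>T*M\<close> to \<open>T\<^sup>1\<^sup>,\<^sup>0M\<close>) whose
  coefficients \<open>\<beta>(dz_j,dz_k)\<close> in holomorphic coordinates are holomorphic, and with vanishing
  Schouten bracket \<open>[\<beta>,\<beta>]\<close>.\<close>

definition holomorphic_poisson ::
  "('m, 'n::finite+'n) chart set \<Rightarrow> 'm set \<Rightarrow> ('m, 'n+'n, real^('n+'n)^('n+'n)) field \<Rightarrow>
   ('m, 'n+'n, complex^('n+'n)^('n+'n)) field \<Rightarrow> bool" where
  "holomorphic_poisson A U J b \<longleftrightarrow>
     complex_structure A U J \<and> complex_bivector A U b \<and>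
     (\<forall>c\<in>A. \<forall>p \<in> cdom c \<inter> U. cmat (J c p) ** b c p = (\<chi> i j. \<i> * b c p $ i $ j)) \<and>
     (\<forall>c. holomorphic_chart A U J c \<longrightarrow>
        (\<forall>j k. holomorphic_fun (crd c ` cdom c)
                 (\<lambda>x. \<Sum>a\<in>UNIV. (b c (pt c x) *v dz j) $ a * dz k $ a))) \<and>
     (\<forall>c\<in>A. \<forall>p \<in> cdom c \<inter> U. \<forall>i j k. (\<Sum>l\<in>UNIV.
          b c p $ l $ i * pd b c l p $ j $ k
        + b c p $ l $ j * pd b c l p $ k $ i
        + b c p $ l $ k * pd b c l p $ i $ j) = 0)"

section \<open>Compact toric symplectic manifolds\<close>

text \<open>The torus is \<open>(S\<^sup>1)\<^sup>n\<close> with componentwise multiplication, its Lie algebra is \<open>\<real>\<^sup>n\<close> with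
  exponential map \<open>texp\<close>, and the dual of the Lie algebra is identified with \<open>\<real>\<^sup>n\<close> through \<open>\<bullet>\<close>.\<close>

definition torus :: "(complex^'n::finite) set" where
  "torus = {z. \<forall>i. cmod (z $ i) = 1}"

definition texp :: "real^'n::finite \<Rightarrow> complex^'n" where
  "texp t = (\<chi> i. cis (t $ i))"

definition torus_action ::
  "('m::topological_space, 'k::finite) chart set \<Rightarrow> (complex^'n::finite \<Rightarrow> 'm \<Rightarrow> 'm) \<Rightarrow> bool" where
  "torus_action A act \<longleftrightarrow>
     (\<forall>p. act 1 p = p) \<and>
     (\<forall>z\<in>torus. \<forall>w\<in>torus. \<forall>p. act (z * w) p = act z (act w p)) \<and>
     continuous_on (torus \<times> UNIV) (\<lambda>(z, p). act z p) \<and>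
     (\<forall>c\<in>A. \<forall>d\<in>A. smooth_on {(t, x). x \<in> crd c ` cdom c \<and> act (texp t) (pt c x) \<in> cdom d}
                        (\<lambda>(t, x). crd d (act (texp t) (pt c x))))"

definition effective_action :: "(complex^'n::finite \<Rightarrow> 'm \<Rightarrow> 'm) \<Rightarrow> bool" where
  "effective_action act \<longleftrightarrow> (\<forall>z\<in>torus. (\<forall>p. act z p = p) \<longrightarrow> z = 1)"

definition invariant_form ::
  "('m, 'k::finite) chart set \<Rightarrow> (complex^'n::finite \<Rightarrow> 'm \<Rightarrow> 'm) \<Rightarrow> ('m, 'k, real^'k^'k) field \<Rightarrow> bool" where
  "invariant_form A act W \<longleftrightarrow> (\<forall>z\<in>torus. \<forall>c\<in>A. \<forall>d\<in>A. \<forall>p \<in> cdom c. act z p \<in> cdom d \<longrightarrow>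
     transpose (dmap (act z) c d p) ** W d (act z p) ** dmap (act z) c d p = W c p)"

definition invariant_endo ::
  "('m, 'k::finite) chart set \<Rightarrow> (complex^'n::finite \<Rightarrow> 'm \<Rightarrow> 'm) \<Rightarrow> ('m, 'k, real^'k^'k) field \<Rightarrow> bool" where
  "invariant_endo A act J \<longleftrightarrow> (\<forall>z\<in>torus. \<forall>c\<in>A. \<forall>d\<in>A. \<forall>p \<in> cdom c. act z p \<in> cdom d \<longrightarrow>
     J d (act z p) ** dmap (act z) c d p = dmap (act z) c d p ** J c p)"

definition fund :: "(complex^'n::finite \<Rightarrow> 'm \<Rightarrow> 'm) \<Rightarrow> real^'n \<Rightarrow> ('m, 'k::finite, real^'k) field" where
  "fund act \<xi> c p = vector_derivative (\<lambda>s. crd c (act (texp (s *\<^sub>R \<xi>)) p)) (at 0)"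

definition lie_basis :: "('n::finite \<Rightarrow> real^'n) \<Rightarrow> bool" where
  "lie_basis e \<longleftrightarrow> inj e \<and> independent (range e) \<and> span (range e) = UNIV"

text \<open>Moment map: smooth, invariant, and \<open>\<iota>_X\<^sub>j \<Omega> = - d\<mu>\<^sub>j\<close> where \<open>\<mu>\<^sub>j = \<langle>\<mu>, e\<^sub>j\<rangle>\<close>.\<close>

definition moment_map ::
  "('m, 'k::finite) chart set \<Rightarrow> ('m, 'k, real^'k^'k) field \<Rightarrow> (complex^'n::finite \<Rightarrow> 'm \<Rightarrow> 'm) \<Rightarrow>
   ('n \<Rightarrow> real^'n) \<Rightarrow> ('m \<Rightarrow> real^'n) \<Rightarrow> bool" where
  "moment_map A Om act e mu \<longleftrightarrow>
     (\<forall>c\<in>A. smooth_on (crd c ` cdom c) (\<lambda>x. mu (pt c x))) \<and>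
     (\<forall>z\<in>torus. \<forall>p. mu (act z p) = mu p) \<and>
     (\<forall>c\<in>A. \<forall>p \<in> cdom c. \<forall>j v.
        (Om c p *v fund act (e j) c p) \<bullet> v
          = - frechet_derivative (\<lambda>x. mu (pt c x) \<bullet> e j) (at (crd c p)) v)"

text \<open>The coordinate index type \<open>'n + 'n\<close> makes the dimension twice that of the torus.\<close>

definition compact_toric ::
  "('m::{second_countable_topology,t2_space}, 'n::finite+'n) chart set \<Rightarrow>
   ('m, 'n+'n, real^('n+'n)^('n+'n)) field \<Rightarrow> (complex^'n \<Rightarrow> 'm \<Rightarrow> 'm) \<Rightarrow>
   ('n \<Rightarrow> real^'n) \<Rightarrow> ('m \<Rightarrow> real^'n) \<Rightarrow> bool" where
  "compact_toric A Om act e mu \<longleftrightarrow>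
     smooth_structure A \<and> compact (UNIV :: 'm set) \<and> connected (UNIV :: 'm set) \<and>
     symplectic_form A Om \<and>
     torus_action A act \<and> effective_action act \<and> invariant_form A act Om \<and>
     lie_basis e \<and> moment_map A Om act e mu"

definition interior_part :: "('m \<Rightarrow> real^'n::finite) \<Rightarrow> 'm set" where
  "interior_part mu = mu -` interior (range mu)"

section \<open>Generalized Kaehler data\<close>

text \<open>Pointwise operations, on component matrices.\<close>

definition Jminus :: "real^'k^'k \<Rightarrow> real^'k^'k \<Rightarrow> real^'k::finite^'k" where
  "Jminus Om Jp = - (matrix_inv Om ** transpose Jp ** Om)"

definition gmetric :: "real^'k^'k \<Rightarrow> real^'k^'k \<Rightarrow> real^'k::finite^'k" where
  "gmetric Om Jp = - (1/2) *\<^sub>R (Om ** (Jp + Jminus Om Jp))"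

definition omega_plus :: "real^'k^'k \<Rightarrow> real^'k^'k \<Rightarrow> real^'k::finite^'k" where
  "omega_plus Om Jp = gmetric Om Jp ** Jp"

definition omega_minus :: "real^'k^'k \<Rightarrow> real^'k^'k \<Rightarrow> real^'k::finite^'k" where
  "omega_minus Om Jp = gmetric Om Jp ** Jminus Om Jp"

text \<open>Endomorphisms of \<open>TM \<oplus> T*M\<close> are block matrices.\<close>

definition gcs1 :: "real^'k^'k \<Rightarrow> real^'k^'k \<Rightarrow> real^('k::finite+'k)^('k+'k)" where
  "gcs1 Om Jp = (1/2) *\<^sub>R block
     (- Jp - Jminus Om Jp)
     (matrix_inv (omega_plus Om Jp) - matrix_inv (omega_minus Om Jp))
     (- omega_plus Om Jp + omega_minus Om Jp)
     (transpose Jp + transpose (Jminus Om Jp))"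

definition beta1 :: "real^'k^'k \<Rightarrow> real^'k^'k \<Rightarrow> real^'k::finite^'k" where
  "beta1 Om Jp = - (1/2) *\<^sub>R ((Jp - Jminus Om Jp) ** matrix_inv (gmetric Om Jp))"

definition gcs_poisson :: "real^'k^'k \<Rightarrow> complex^'k^'k \<Rightarrow> real^('k::finite+'k)^('k+'k)" where
  "gcs_poisson J b = block (- J) (- 4 *\<^sub>R (\<chi> i j. Im (b $ i $ j))) 0 (transpose J)"

definition exp_form :: "real^'k^'k \<Rightarrow> real^('k::finite+'k)^('k+'k)" where
  "exp_form B = block (mat 1) 0 B (mat 1)"

definition GK ::
  "('m, 'k::finite) chart set \<Rightarrow> ('m, 'k, real^'k^'k) field \<Rightarrow> (complex^'n::finite \<Rightarrow> 'm \<Rightarrow> 'm) \<Rightarrow>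
   ('m, 'k, real^'k^'k) field set" where
  "GK A Om act = {Jp.
     complex_structure A UNIV Jp \<and> invariant_endo A act Jp \<and>
     (\<forall>c\<in>A. \<forall>p \<in> cdom c. \<forall>v. v \<noteq> 0 \<longrightarrow> (Om c p *v v) \<bullet> (Jp c p *v v) > 0) \<and>
     complex_structure A UNIV (\<lambda>c p. Jminus (Om c p) (Jp c p))}"

definition orbit_distribution ::
  "(complex^'n::finite \<Rightarrow> 'm \<Rightarrow> 'm) \<Rightarrow> ('n \<Rightarrow> real^'n) \<Rightarrow> ('m, 'k::finite, (real^'k) set) field" where
  "orbit_distribution act e c p = span (range (\<lambda>j. fund act (e j) c p))"

definition DGK ::
  "('m, 'k::finite) chart set \<Rightarrow> ('m, 'k, real^'k^'k) field \<Rightarrow> (complex^'n::finite \<Rightarrow> 'm \<Rightarrow> 'm) \<Rightarrow>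
   ('n \<Rightarrow> real^'n) \<Rightarrow> ('m \<Rightarrow> real^'n) \<Rightarrow> ('m, 'k, real^'k^'k) field set" where
  "DGK A Om act e mu = {Jp \<in> GK A Om act.
     \<forall>c\<in>A. \<forall>p \<in> cdom c \<inter> interior_part mu.
       (\<lambda>v. Jp c p *v v) ` orbit_distribution act e c p
         = (\<lambda>v. Jminus (Om c p) (Jp c p) *v v) ` orbit_distribution act e c p}"

section \<open>Admissible coordinates\<close>

text \<open>The coordinate \<open>Inl j\<close> is \<open>\<theta>\<^sub>j\<close> and \<open>Inr j\<close> is \<open>\<mu>\<^sub>j\<close>. The last two conditions say that
  \<open>d\<theta>\<^sub>j\<close> is the first half of the coframe dual to \<open>{X\<^sub>k, J\<^sub>+ X\<^sub>k}\<close> (a frame, because the orbits are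
  isotropic and \<open>J\<^sub>+\<close> is tamed).\<close>

definition admissible_chart ::
  "('m, 'n::finite+'n) chart set \<Rightarrow> (complex^'n \<Rightarrow> 'm \<Rightarrow> 'm) \<Rightarrow> ('n \<Rightarrow> real^'n) \<Rightarrow> ('m \<Rightarrow> real^'n) \<Rightarrow>
   ('m, 'n+'n, real^('n+'n)^('n+'n)) field \<Rightarrow> ('m, 'n+'n) chart \<Rightarrow> bool" where
  "admissible_chart A act e mu Jp c \<longleftrightarrow> c \<in> A \<and> cdom c \<subseteq> interior_part mu \<and>
     (\<forall>p \<in> cdom c. \<forall>j. crd c p $ Inr j = mu p \<bullet> e j) \<and>
     (\<forall>p \<in> cdom c. \<forall>j k. fund act (e k) c p $ Inl j = (if j = k then 1 else 0)) \<and>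
     (\<forall>p \<in> cdom c. \<forall>j k. (Jp c p *v fund act (e k) c p) $ Inl j = 0)"

text \<open>In an admissible chart, \<open>J\<^sub>+ \<partial>_\<mu>\<^sub>k = \<Sum>\<^sub>j \<phi>\<^sub>k\<^sub>j \<partial>_\<theta>\<^sub>j\<close>.\<close>

definition phi :: "real^('n::finite+'n)^('n+'n) \<Rightarrow> real^'n^'n" where
  "phi K = (\<chi> k j. (K *v axis (Inr k) 1) $ Inl j)"

definition phi_s :: "real^('n::finite+'n)^('n+'n) \<Rightarrow> real^'n^'n" where
  "phi_s K = (1/2) *\<^sub>R (phi K + transpose (phi K))"

text \<open>\<open>J0\<close> is given on \<open>interior_part mu\<close> by \<open>J0 \<partial>_\<mu>\<^sub>k = \<Sum>\<^sub>j (\<phi>\<^sub>s)\<^sub>k\<^sub>j \<partial>_\<theta>\<^sub>j\<close> in admissible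
  coordinates around each point; its values on \<open>\<partial>_\<theta>\<^sub>j\<close> are then forced by \<open>J0\<^sup>2 = -1\<close>.\<close>

definition given_by_phi_s ::
  "('m, 'n::finite+'n) chart set \<Rightarrow> (complex^'n \<Rightarrow> 'm \<Rightarrow> 'm) \<Rightarrow> ('n \<Rightarrow> real^'n) \<Rightarrow> ('m \<Rightarrow> real^'n) \<Rightarrow>
   ('m, 'n+'n, real^('n+'n)^('n+'n)) field \<Rightarrow> ('m, 'n+'n, real^('n+'n)^('n+'n)) field \<Rightarrow> bool" where
  "given_by_phi_s A act e mu Jp J0 \<longleftrightarrow>
     (\<forall>p \<in> interior_part mu. \<exists>c. admissible_chart A act e mu Jp c \<and> p \<in> cdom c \<and>
        (\<forall>q \<in> cdom c. \<forall>k. J0 c q *v axis (Inr k) 1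
           = (\<Sum>j\<in>UNIV. phi_s (Jp c q) $ k $ j *\<^sub>R axis (Inl j) 1)))"

definition beta_of :: "real^'k^'k \<Rightarrow> real^'k^'k \<Rightarrow> complex^'k::finite^'k" where
  "beta_of J b1 = (\<chi> i j. - (1/4) * (complex_of_real ((J ** b1) $ i $ j) + \<i> * complex_of_real (b1 $ i $ j)))"

end

theory Submission
  imports Defs
begin

text \<open>
  In an admissible chart, in the blocks given by \<open>\<theta>\<close> and \<open>\<mu>\<close>, \<open>\<Omega> = [0, 1; -1, 0]\<close>, \<open>J\<^sub>+ = [0, P; Q, 0]\<close>
  with \<open>PQ = -1\<close> and \<open>J\<^sub>- = [0, P\<^sup>T; Q\<^sup>T, 0]\<close>. Put \<open>S = (P + P\<^sup>T)/2\<close>, \<open>A = (P - P\<^sup>T)/2\<close> and let \<open>V\<close> be the matrix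
  with columns \<open>X\<^sub>j\<close>. Then \<open>J\<^sub>0 = [0, S; -S\<^sup>-\<^sup>1, 0]\<close>, and with \<open>Z = V - \<i> J\<^sub>0 V\<close> one finds \<open>\<beta> = (1/4) Z A Z\<^sup>T\<close>,
  while \<open>B = - a A a\<^sup>T\<close> for \<open>a = J\<^sub>+\<^sup>* \<Omega> V\<close> satisfies the gauge identity. These formulas use no coordinates
  except through \<open>A\<close>.

  Along the orbits \<open>P\<close> is constant, so the integrability of \<open>J\<^sub>+\<close> and of \<open>J\<^sub>-\<close> says that \<open>\<partial>\<^sub>k P\<^sub>i\<^sub>j\<close> is invariant under
  \<open>k \<leftrightarrow> j\<close> and under \<open>k \<leftrightarrow> i\<close>, hence totally symmetric. So \<open>A\<close> is locally constant and the frame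
  \<open>X\<^sub>j, J\<^sub>0 X\<^sub>j\<close> commutes. In any chart a commuting frame of this form gives the integrability of \<open>J\<^sub>0\<close>, the
  holomorphy of the coefficients of \<open>Z\<close>, and, since the fields \<open>Z\<^sub>j\<close> commute, \<open>[\<beta>, \<beta>] = 0\<close>.
\<close>

section \<open>Calculus of smooth functions\<close>

text \<open>The conclusion concerns every chart of the atlas, while the normal form is available
  only in admissible charts, and the bivector contains the inverse metric. Writing everything
  through \<open>X_j\<close>, \<open>Omega\<close>, \<open>J_+\<close> and \<open>J_0\<close>
  removes both obstacles: these objects transform by transition matrices, and since the one
  remaining ingredient \<open>A\<close> is locally constant, no inverse matrix ever has to be
  differentiated. The column \<open>Z_j\<close> is twice the (1,0) part of \<open>X_j\<close>. So
  \<beta> has locally constant coefficients in commuting holomorphic fields, which is the common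
  source of all its properties. As \<open>P\<close> is the transpose of \<phi>, \<open>A\<close> is
  minus the antisymmetric part of \<phi>. The columns of \<open>a\<close> are the forms
  \<open>- J_+^* d mu_j\<close>, which are combinations of the \<open>d theta_i\<close> alone. Hence
  \<open>B\<close> has only a \<theta>\<theta> part, and because \<open>beta_1\<close> has no such
  part, the quadratic term \<open>B beta_1 B\<close> of the gauge identity vanishes.\<close>

lemma k_smooth_on_cong:
  assumes "open S" "\<And>x. x \<in> S \<Longrightarrow> f x = g x" "k_smooth_on k S f"
  shows "k_smooth_on k S g"
  using assms(2,3)
proof (induction k arbitrary: f g)
  case 0
  then show ?case by (metis continuous_on_cong k_smooth_on.simps(1))
next
  case (Suc k)
  have fr: "frechet_derivative f (at x) = frechet_derivative g (at x)" if "x \<in> S" for x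
    using frechet_derivative_transform_within_open[OF _ assms(1) that] Suc.prems that by auto
  have "g differentiable (at x)" if "x \<in> S" for x
  proof -
    have "(f has_derivative frechet_derivative f (at x)) (at x)"
      using Suc.prems that by (simp add: frechet_derivative_works)
    then have "(g has_derivative frechet_derivative f (at x)) (at x)"
      by (rule has_derivative_transform_within_open[OF _ assms(1) that]) (use Suc.prems in auto)
    then show ?thesis by (auto simp: differentiable_def)
  qed
  moreover have "k_smooth_on k S (\<lambda>x. frechet_derivative g (at x) v)" for v
    by (rule Suc.IH[of "\<lambda>x. frechet_derivative f (at x) v"]) (use Suc.prems fr in auto)
  ultimately show ?case by simp
qed

lemma k_smooth_on_subset: "k_smooth_on k S f \<Longrightarrow> T \<subseteq> S \<Longrightarrow> k_smooth_on k T f"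
  by (induction k arbitrary: f) (auto intro: continuous_on_subset)

lemma k_smooth_on_SucD: "k_smooth_on (Suc k) S f \<Longrightarrow> k_smooth_on k S f"
proof (induction k arbitrary: f)
  case 0
  then have "isCont f x" if "x \<in> S" for x
    using that by (simp add: differentiable_imp_continuous_within)
  then show ?case by (simp add: continuous_at_imp_continuous_on)
qed auto

lemma k_smooth_on_const: "k_smooth_on k S (\<lambda>x. c)"
  by (induction k arbitrary: c) auto

lemma k_smooth_on_add:
  assumes "open S" "k_smooth_on k S f" "k_smooth_on k S g"
  shows "k_smooth_on k S (\<lambda>x. f x + g x)"
  using assms(2,3)
proof (induction k arbitrary: f g)
  case 0
  then show ?case by (auto intro: continuous_on_add)
next
  case (Suc k)
  have *: "((\<lambda>x. f x + g x) has_derivative (\<lambda>v. frechet_derivative f (at x) v + frechet_derivative g (at x) v)) (at x)"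
    if "x \<in> S" for x
    by (rule has_derivative_add) (use Suc.prems that in \<open>auto simp: frechet_derivative_works\<close>)
  have fr: "frechet_derivative (\<lambda>x. f x + g x) (at x) v
      = frechet_derivative f (at x) v + frechet_derivative g (at x) v" if "x \<in> S" for x v
    by (simp add: frechet_derivative_at[OF *[OF that], symmetric])
  have "k_smooth_on k S (\<lambda>x. frechet_derivative f (at x) v + frechet_derivative g (at x) v)" for v
    using Suc by simp
  then have "k_smooth_on k S (\<lambda>x. frechet_derivative (\<lambda>x. f x + g x) (at x) v)" for v
    by (rule k_smooth_on_cong[OF assms(1), rotated]) (simp add: fr)
  moreover have "(\<lambda>x. f x + g x) differentiable (at x)" if "x \<in> S" for x
    using *[OF that] by (rule Derivative.differentiableI)
  ultimately show ?case by simp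
qed

text \<open>Stated for an arbitrary bounded bilinear map so that it serves matrix products as well
  as scalar multiples. The product rule keeps an undifferentiated factor in each term, so the
  induction also needs the factors themselves to be smooth of the lower order.\<close>

lemma (in bounded_bilinear) k_smooth_on_prod:
  assumes "open S" "k_smooth_on k S f" "k_smooth_on k S g"
  shows "k_smooth_on k S (\<lambda>x. prod (f x) (g x))"
  using assms(2,3)
proof (induction k arbitrary: f g)
  case 0
  then show ?case by (auto intro: continuous_on)
next
  case (Suc k)
  have *: "((\<lambda>x. prod (f x) (g x)) has_derivative
      (\<lambda>v. prod (f x) (frechet_derivative g (at x) v) + prod (frechet_derivative f (at x) v) (g x))) (at x)"
    if "x \<in> S" for x
    by (rule FDERIV) (use Suc.prems that in \<open>auto simp: frechet_derivative_works\<close>)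
  have fr: "frechet_derivative (\<lambda>x. prod (f x) (g x)) (at x) v
      = prod (f x) (frechet_derivative g (at x) v) + prod (frechet_derivative f (at x) v) (g x)"
    if "x \<in> S" for x v
    by (simp add: frechet_derivative_at[OF *[OF that], symmetric])
  have "k_smooth_on k S (\<lambda>x. prod (f x) (frechet_derivative g (at x) v) + prod (frechet_derivative f (at x) v) (g x))" for v
    using Suc k_smooth_on_SucD[OF Suc.prems(1)] k_smooth_on_SucD[OF Suc.prems(2)]
    by (intro k_smooth_on_add assms Suc.IH) auto
  then have "k_smooth_on k S (\<lambda>x. frechet_derivative (\<lambda>x. prod (f x) (g x)) (at x) v)" for v
    by (rule k_smooth_on_cong[OF assms(1), rotated]) (simp add: fr)
  moreover have "(\<lambda>x. prod (f x) (g x)) differentiable (at x)" if "x \<in> S" for x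
    using *[OF that] by (rule Derivative.differentiableI)
  ultimately show ?case by simp
qed

lemma smooth_on_const: "smooth_on S (\<lambda>x. c)"
  by (simp add: smooth_on_def k_smooth_on_const)

lemma smooth_on_add: "open S \<Longrightarrow> smooth_on S f \<Longrightarrow> smooth_on S g \<Longrightarrow> smooth_on S (\<lambda>x. f x + g x)"
  by (simp add: smooth_on_def k_smooth_on_add)

lemma (in bounded_bilinear) smooth_on_prod:
  "open S \<Longrightarrow> smooth_on S f \<Longrightarrow> smooth_on S g \<Longrightarrow> smooth_on S (\<lambda>x. prod (f x) (g x))"
  by (simp add: smooth_on_def k_smooth_on_prod)

lemma (in bounded_linear) smooth_on_comp:
  assumes "open S" "smooth_on S g"
  shows "smooth_on S (\<lambda>x. f (g x))"
proof -
  \<comment> \<open>A linear map is seen as the bilinear map \<open>c *\<^sub>R f y\<close> with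
    \<open>c\<close> the constant function 1, which reduces the claim to the product rule.\<close>
  interpret b: bounded_bilinear "\<lambda>(c::real) y. c *\<^sub>R f y"
    by (rule bounded_bilinear.comp[OF bounded_bilinear_scaleR bounded_linear_ident bounded_linear_axioms])
  show ?thesis using b.smooth_on_prod[OF assms(1) smooth_on_const[of S 1] assms(2)] by simp
qed

lemma smooth_on_sum:
  assumes "open S" "\<And>i. i \<in> I \<Longrightarrow> smooth_on S (f i)"
  shows "smooth_on S (\<lambda>x. \<Sum>i\<in>I. f i x)"
  using assms(2)
  by (induction I rule: infinite_finite_induct) (auto simp: smooth_on_const smooth_on_add assms(1))

lemma smooth_on_differentiable: "smooth_on S f \<Longrightarrow> x \<in> S \<Longrightarrow> f differentiable (at x)"
  unfolding smooth_on_def by (metis k_smooth_on.simps(2))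

lemma smooth_on_subset: "smooth_on S f \<Longrightarrow> T \<subseteq> S \<Longrightarrow> smooth_on T f"
  unfolding smooth_on_def by (meson k_smooth_on_subset)

lemma smooth_on_frechet: "smooth_on S f \<Longrightarrow> smooth_on S (\<lambda>x. frechet_derivative f (at x) v)"
  unfolding smooth_on_def by (metis k_smooth_on.simps(2))

lemma k_smooth_on_local:
  assumes "\<And>x. x \<in> S \<Longrightarrow> \<exists>T. x \<in> T \<and> open T \<and> T \<subseteq> S \<and> k_smooth_on k T f"
  shows "k_smooth_on k S f"
  using assms
proof (induction k arbitrary: f)
  case 0
  have "isCont f x" if "x \<in> S" for x
    using 0[OF that] by (auto simp: continuous_on_eq_continuous_at)
  then show ?case by (simp add: continuous_at_imp_continuous_on)
next
  case (Suc k)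
  show ?case
    unfolding k_smooth_on.simps
  proof (intro conjI ballI allI)
    show "f differentiable (at x)" if "x \<in> S" for x
      using Suc.prems[OF that] by auto
    show "k_smooth_on k S (\<lambda>x. frechet_derivative f (at x) v)" for v
      by (rule Suc.IH) (metis Suc.prems k_smooth_on.simps(2))
  qed
qed

text \<open>Permits a different formula \<open>g\<close> near each point. It is applied where a
  locally constant matrix may be replaced by its constant value.\<close>

lemma smooth_on_local:
  assumes "\<And>x. x \<in> S \<Longrightarrow> \<exists>T g. x \<in> T \<and> open T \<and> T \<subseteq> S \<and> smooth_on T g \<and> (\<forall>y\<in>T. g y = f y)"
  shows "smooth_on S f"
  unfolding smooth_on_def
proof (intro allI k_smooth_on_local)
  fix k x assume "x \<in> S"
  from assms[OF this] obtain T g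
    where T: "x \<in> T" "open T" "T \<subseteq> S" and g: "smooth_on T g" "\<forall>y\<in>T. g y = f y"
    by blast
  have "k_smooth_on k T f"
  proof (rule k_smooth_on_cong[OF T(2)])
    show "k_smooth_on k T g" using g(1) by (simp add: smooth_on_def)
    show "g y = f y" if "y \<in> T" for y using g(2) that by blast
  qed
  with T show "\<exists>T. x \<in> T \<and> open T \<and> T \<subseteq> S \<and> k_smooth_on k T f"
    by (intro exI[of _ T] conjI)
qed

text \<open>Freezes the torus parameter in the flow; fundamental fields are derivatives of the flow
  in the torus direction at parameter 0.\<close>

lemma smooth_on_slice:
  fixes G :: "'a::euclidean_space \<times> 'b::euclidean_space \<Rightarrow> 'c::real_normed_vector"
  assumes "open S" "smooth_on S G"
  shows "smooth_on {x. (a, x) \<in> S} (\<lambda>x. G (a, x))"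
proof -
  have "{x. (a, x) \<in> S} = Pair a -` S" by auto
  then have op: "open {x. (a, x) \<in> S}"
    using assms(1) by (simp add: open_vimage continuous_on_Pair)
  have "k_smooth_on k {x. (a, x) \<in> S} (\<lambda>x. G (a, x))" if "k_smooth_on k S G" for k
    using that
  proof (induction k arbitrary: G)
    case 0
    then show ?case
      unfolding k_smooth_on.simps
      by (rule continuous_on_compose2[of S G]) (auto intro: continuous_on_Pair continuous_on_const continuous_on_id)
  next
    case (Suc k)
    have *: "((\<lambda>x. G (a, x)) has_derivative (\<lambda>v. frechet_derivative G (at (a, x)) (0, v))) (at x)"
      if "(a, x) \<in> S" for x
    proof -
      have "(G has_derivative frechet_derivative G (at (a, x))) (at (a, x))"
        using Suc.prems that by (simp add: frechet_derivative_works)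
      moreover have "((\<lambda>x. (a, x)) has_derivative (\<lambda>v. (0, v))) (at x)"
        by (intro has_derivative_Pair has_derivative_const has_derivative_ident)
      ultimately show ?thesis
        using has_derivative_compose[of "\<lambda>x. (a, x)" "\<lambda>v. (0, v)" x UNIV G] by auto
    qed
    have fr: "frechet_derivative (\<lambda>x. G (a, x)) (at x) v = frechet_derivative G (at (a, x)) (0, v)"
      if "(a, x) \<in> S" for x v
      by (simp add: frechet_derivative_at[OF *[OF that], symmetric])
    have "k_smooth_on k {x. (a, x) \<in> S} (\<lambda>x. frechet_derivative G (at (a, x)) (0, v))" for v
      using Suc by auto
    then have "k_smooth_on k {x. (a, x) \<in> S} (\<lambda>x. frechet_derivative (\<lambda>x. G (a, x)) (at x) v)" for v
      by (rule k_smooth_on_cong[OF op, rotated]) (simp add: fr)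
    moreover have "(\<lambda>x. G (a, x)) differentiable (at x)" if "(a, x) \<in> S" for x
    using *[OF that] by (rule Derivative.differentiableI)
  ultimately show ?case by simp
  qed
  then show ?thesis using assms by (simp add: smooth_on_def)
qed

section \<open>Lie brackets\<close>

lemma mixed_derivatives_commute_real:
  fixes f :: "'a::real_normed_vector \<Rightarrow> real"
  assumes S: "open S" "x \<in> S"
    and f: "\<And>y. y \<in> S \<Longrightarrow> (f has_derivative f' y) (at y)"
    and G: "\<And>y. y \<in> S \<Longrightarrow> ((\<lambda>y. f' y v) has_derivative G y) (at y)"
    and H: "\<And>y. y \<in> S \<Longrightarrow> ((\<lambda>y. f' y w) has_derivative H y) (at y)"
    and cont: "continuous_on S (\<lambda>y. G y w)" "continuous_on S (\<lambda>y. H y v)"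
  shows "G x w = H x v"
proof -
  text \<open>Both mixed derivatives are limits of the same second difference of \<open>f\<close>.\<close>
  have aux: "\<exists>a b. 0 < a \<and> a < t \<and> 0 < b \<and> b < t \<and>
      f (x + t *\<^sub>R v + t *\<^sub>R w) - f (x + t *\<^sub>R v) - f (x + t *\<^sub>R w) + f x = t * t * G (x + a *\<^sub>R v + b *\<^sub>R w) w"
    if f: "\<And>y. y \<in> S \<Longrightarrow> (f has_derivative f' y) (at y)"
      and G: "\<And>y. y \<in> S \<Longrightarrow> ((\<lambda>y. f' y v) has_derivative G y) (at y)"
      and t: "t > 0" and mem: "\<And>a b. 0 \<le> a \<Longrightarrow> a \<le> t \<Longrightarrow> 0 \<le> b \<Longrightarrow> b \<le> t \<Longrightarrow> x + a *\<^sub>R v + b *\<^sub>R w \<in> S"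
    for v w t f' and G :: "'a \<Rightarrow> 'a \<Rightarrow> real"
  proof -
    \<comment> \<open>The increment of \<open>f\<close> along \<open>t *\<^sub>R w\<close>, as a
      function of the position along \<open>v\<close>; the second difference is
      \<open>k t - k 0\<close>, and two applications of the mean value theorem produce the
      intermediate point.\<close>
    define k where "k s = f (x + s *\<^sub>R v + t *\<^sub>R w) - f (x + s *\<^sub>R v + 0 *\<^sub>R w)" for s
    have d: "((\<lambda>s. f (x + s *\<^sub>R v + b *\<^sub>R w)) has_derivative (\<lambda>h. h * f' (x + s *\<^sub>R v + b *\<^sub>R w) v)) (at s)"
      if "x + s *\<^sub>R v + b *\<^sub>R w \<in> S" for s b
    proof -
      have l: "linear (f' (x + s *\<^sub>R v + b *\<^sub>R w))" using f[OF that] by (rule has_derivative_linear)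
      have "((\<lambda>s. x + s *\<^sub>R v + b *\<^sub>R w) has_derivative (\<lambda>h. h *\<^sub>R v)) (at s)"
        by (auto intro!: derivative_eq_intros)
      from has_derivative_compose[OF this f[OF that]] show ?thesis
        using linear_scale[OF l] by simp
    qed
    have d2: "((\<lambda>s. f' (x + a *\<^sub>R v + s *\<^sub>R w) v) has_derivative (\<lambda>h. h * G (x + a *\<^sub>R v + s *\<^sub>R w) w)) (at s)"
      if "x + a *\<^sub>R v + s *\<^sub>R w \<in> S" for s a
    proof -
      have l: "linear (G (x + a *\<^sub>R v + s *\<^sub>R w))" using G[OF that] by (rule has_derivative_linear)
      have "((\<lambda>s. x + a *\<^sub>R v + s *\<^sub>R w) has_derivative (\<lambda>h. h *\<^sub>R w)) (at s)"
        by (auto intro!: derivative_eq_intros)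
      from has_derivative_compose[OF this G[OF that]] show ?thesis
        using linear_scale[OF l] by simp
    qed
    obtain a where a: "0 < a" "a < t"
      "k t - k 0 = (t - 0) * (f' (x + a *\<^sub>R v + t *\<^sub>R w) v - f' (x + a *\<^sub>R v + 0 *\<^sub>R w) v)"
    proof (rule mvt[of 0 t k "\<lambda>a h. h * (f' (x + a *\<^sub>R v + t *\<^sub>R w) v - f' (x + a *\<^sub>R v + 0 *\<^sub>R w) v)"])
      have kd: "(k has_derivative (\<lambda>h. h * (f' (x + a *\<^sub>R v + t *\<^sub>R w) v - f' (x + a *\<^sub>R v + 0 *\<^sub>R w) v))) (at a)"
        if "0 \<le> a" "a \<le> t" for a
        unfolding k_def right_diff_distrib
        by (intro has_derivative_diff d mem) (use that t in auto)
      then show "(k has_derivative (\<lambda>h. h * (f' (x + a *\<^sub>R v + t *\<^sub>R w) v - f' (x + a *\<^sub>R v + 0 *\<^sub>R w) v))) (at a)"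
        if "0 < a" "a < t" for a using that by simp
      show "continuous_on {0..t} k"
        by (intro continuous_at_imp_continuous_on ballI has_derivative_continuous[OF kd]) auto
    qed (use t in auto)
    obtain b where b: "0 < b" "b < t"
      "f' (x + a *\<^sub>R v + t *\<^sub>R w) v - f' (x + a *\<^sub>R v + 0 *\<^sub>R w) v = (t - 0) * G (x + a *\<^sub>R v + b *\<^sub>R w) w"
    proof (rule mvt[of 0 t "\<lambda>s. f' (x + a *\<^sub>R v + s *\<^sub>R w) v" "\<lambda>b h. h * G (x + a *\<^sub>R v + b *\<^sub>R w) w"])
      show "((\<lambda>s. f' (x + a *\<^sub>R v + s *\<^sub>R w) v) has_derivative (\<lambda>h. h * G (x + a *\<^sub>R v + b *\<^sub>R w) w)) (at b)"
        if "0 < b" "b < t" for b by (intro d2 mem) (use that a in auto)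
      show "continuous_on {0..t} (\<lambda>s. f' (x + a *\<^sub>R v + s *\<^sub>R w) v)"
        by (intro continuous_at_imp_continuous_on ballI has_derivative_continuous[OF d2] mem) (use a in auto)
    qed (use t in auto)
    show ?thesis
      by (rule exI[of _ a], rule exI[of _ b]) (use a b in \<open>simp add: k_def\<close>)
  qed
  show ?thesis
  proof (rule ccontr)
    assume "G x w \<noteq> H x v"
    define e where "e = \<bar>G x w - H x v\<bar> / 2"
    have e: "e > 0" using \<open>G x w \<noteq> H x v\<close> by (simp add: e_def)
    have near: "\<forall>\<^sub>F y in nhds x. dist (g y) (g x) < e" if "continuous_on S g" for g :: "'a \<Rightarrow> real"
    proof -
      have "(g \<longlongrightarrow> g x) (nhds x)"
        using that S by (simp add: continuous_on_eq_continuous_at continuous_at tendsto_at_iff_tendsto_nhds)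
      then show ?thesis using e by (rule tendstoD)
    qed
    have "\<forall>\<^sub>F y in nhds x. y \<in> S \<and> dist (G y w) (G x w) < e \<and> dist (H y v) (H x v) < e"
      using near[OF cont(1)] near[OF cont(2)] eventually_nhds_in_open[OF S] by (intro eventually_conj)
    then obtain d where d: "d > 0" "\<And>y. dist y x < d \<Longrightarrow> y \<in> S \<and> dist (G y w) (G x w) < e \<and> dist (H y v) (H x v) < e"
      by (auto simp: eventually_nhds_metric)
    define t where "t = d / (norm v + norm w + 1)"
    have pos: "norm v + norm w + 1 > 0" by (simp add: add_nonneg_pos)
    have t: "t > 0" using d pos by (simp add: t_def)
    have near: "dist (x + a *\<^sub>R v + b *\<^sub>R w) x < d" if "0 \<le> a" "a \<le> t" "0 \<le> b" "b \<le> t" for a b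
    proof -
      have "dist (x + a *\<^sub>R v + b *\<^sub>R w) x \<le> norm (a *\<^sub>R v) + norm (b *\<^sub>R w)"
        using norm_triangle_ineq[of "a *\<^sub>R v" "b *\<^sub>R w"] by (simp add: dist_norm add.assoc del: norm_scaleR)
      also have "\<dots> \<le> t * norm v + t * norm w"
        using that by (intro add_mono) (auto simp: mult_right_mono)
      also have "\<dots> < t * (norm v + norm w + 1)" using t by (simp add: algebra_simps)
      finally show ?thesis using pos by (simp add: t_def)
    qed
    obtain a b where ab: "0 < a" "a < t" "0 < b" "b < t"
      "f (x + t *\<^sub>R v + t *\<^sub>R w) - f (x + t *\<^sub>R v) - f (x + t *\<^sub>R w) + f x = t * t * G (x + a *\<^sub>R v + b *\<^sub>R w) w"
      using aux[OF f G t] d(2)[OF near] by blast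
    have near': "x + a *\<^sub>R w + b *\<^sub>R v = x + b *\<^sub>R v + a *\<^sub>R w" for a b by simp
    \<comment> \<open>The second difference does not change when \<open>v\<close> and
      \<open>w\<close> are exchanged, so the same argument applies with \<open>H\<close> in place of
      \<open>G\<close>.\<close>
    obtain a' b' where ab': "0 < a'" "a' < t" "0 < b'" "b' < t"
      "f (x + t *\<^sub>R w + t *\<^sub>R v) - f (x + t *\<^sub>R w) - f (x + t *\<^sub>R v) + f x = t * t * H (x + a' *\<^sub>R w + b' *\<^sub>R v) v"
      using aux[OF f H t, of v, unfolded near'] d(2)[OF near] unfolding near' by blast
    have "G (x + a *\<^sub>R v + b *\<^sub>R w) w = H (x + b' *\<^sub>R v + a' *\<^sub>R w) v"
    proof -
      have "t * t * G (x + a *\<^sub>R v + b *\<^sub>R w) w = t * t * H (x + b' *\<^sub>R v + a' *\<^sub>R w) v"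
        using ab(5) ab'(5) unfolding near'[of t t] near'[of a' b'] by linarith
      then show ?thesis using t by simp
    qed
    moreover have "dist (G (x + a *\<^sub>R v + b *\<^sub>R w) w) (G x w) < e" "dist (H (x + b' *\<^sub>R v + a' *\<^sub>R w) v) (H x v) < e"
      using d(2)[OF near, of a b] d(2)[OF near, of b' a'] ab ab' by simp_all
    ultimately have "dist (G x w) (H x v) < 2 * e"
      using dist_triangle2[of "G x w" "H x v"] by (smt (verit) dist_commute)
    then show False by (simp add: e_def dist_real_def)
  qed
qed

text \<open>The mean value theorem in the form used above is real-valued, hence the passage to
  components along \<open>Basis\<close>.\<close>

lemma mixed_derivatives_commute:
  fixes f :: "'a::euclidean_space \<Rightarrow> 'b::euclidean_space"
  assumes S: "open S" "x \<in> S" and f: "smooth_on S f"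
  shows "frechet_derivative (\<lambda>y. frechet_derivative f (at y) v) (at x) w
       = frechet_derivative (\<lambda>y. frechet_derivative f (at y) w) (at x) v"
proof (rule euclidean_eqI)
  fix b :: 'b assume "b \<in> Basis"
  have D: "((\<lambda>y. g y \<bullet> b) has_derivative (\<lambda>h. frechet_derivative g (at y) h \<bullet> b)) (at y)"
    if "smooth_on S g" "y \<in> S" for g :: "'a \<Rightarrow> 'b" and y
    by (intro has_derivative_inner_left) (use smooth_on_differentiable[OF that] in \<open>simp add: frechet_derivative_works\<close>)
  have C: "continuous_on S (\<lambda>y. g y \<bullet> b)" if "smooth_on S g" for g :: "'a \<Rightarrow> 'b"
  proof -
    have "k_smooth_on 0 S g" using that by (simp add: smooth_on_def)
    then show ?thesis by (auto intro: continuous_on_inner)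
  qed
  note sm = smooth_on_frechet[OF f] smooth_on_frechet[OF smooth_on_frechet[OF f]]
  show "frechet_derivative (\<lambda>y. frechet_derivative f (at y) v) (at x) w \<bullet> b
       = frechet_derivative (\<lambda>y. frechet_derivative f (at y) w) (at x) v \<bullet> b"
    by (rule mixed_derivatives_commute_real[OF S D[OF f] D[OF sm(1)] D[OF sm(1)] C[OF sm(2)] C[OF sm(2)]])
qed

text \<open>Differentiating \<open>X'\<close> and \<open>Y'\<close> along \<phi> produces second
  derivatives of \<phi>, and these cancel in the bracket by symmetry. Only \<phi>-relatedness of the
  fields is used, so no inverse of \<phi> has to be differentiated.\<close>

lemma lie_bracket_pushforward:
  fixes \<phi> :: "real^'k::finite \<Rightarrow> real^'k"
  assumes S: "open S" "x \<in> S" and \<phi>: "smooth_on S \<phi>"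
    and diff: "X differentiable (at x)" "Y differentiable (at x)"
      "X' differentiable (at (\<phi> x))" "Y' differentiable (at (\<phi> x))"
    and X': "\<And>y. y \<in> S \<Longrightarrow> X' (\<phi> y) = frechet_derivative \<phi> (at y) (X y)"
    and Y': "\<And>y. y \<in> S \<Longrightarrow> Y' (\<phi> y) = frechet_derivative \<phi> (at y) (Y y)"
  shows "frechet_derivative \<phi> (at x) (lie_bracket X Y x) = lie_bracket X' Y' (\<phi> x)"
proof -
  let ?D = "frechet_derivative \<phi> (at x)"
  let ?H = "\<lambda>u v. frechet_derivative (\<lambda>y. frechet_derivative \<phi> (at y) u) (at x) v"
  have \<phi>d: "(\<phi> has_derivative frechet_derivative \<phi> (at y)) (at y)" if "y \<in> S" for y
    using smooth_on_differentiable[OF \<phi> that] by (simp add: frechet_derivative_works)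
  have Dlin: "linear (frechet_derivative \<phi> (at y))" if "y \<in> S" for y
    using \<phi>d[OF that] by (rule has_derivative_linear)
  have expand: "frechet_derivative \<phi> (at y) u = (\<Sum>i\<in>UNIV. u $ i *\<^sub>R frechet_derivative \<phi> (at y) (axis i 1))"
    if "y \<in> S" for y u
  proof -
    have "u = (\<Sum>i\<in>UNIV. u $ i *\<^sub>R axis i 1)"
      by (simp add: vec_eq_iff axis_def if_distrib cong: if_cong)
    then show ?thesis
      using linear_sum[OF Dlin[OF that], of "\<lambda>i. u $ i *\<^sub>R axis i 1" UNIV] linear_scale[OF Dlin[OF that]]
      by simp
  qed
  have gd: "((\<lambda>y. frechet_derivative \<phi> (at y) u) has_derivative ?H u) (at x)" for u
    using smooth_on_differentiable[OF smooth_on_frechet[OF \<phi>] S(2)] by (simp add: frechet_derivative_works)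
  \<comment> \<open>The second derivative is formed with a constant vector \<open>u\<close>; its
    linearity in \<open>u\<close> allows the value \<open>Z x\<close> of a varying field to be
    inserted below.\<close>
  have Hlin: "?H u v = (\<Sum>i\<in>UNIV. u $ i *\<^sub>R ?H (axis i 1) v)" for u v
  proof -
    have "((\<lambda>y. \<Sum>i\<in>UNIV. u $ i *\<^sub>R frechet_derivative \<phi> (at y) (axis i 1)) has_derivative
        (\<lambda>v. \<Sum>i\<in>UNIV. u $ i *\<^sub>R ?H (axis i 1) v)) (at x)"
      by (intro has_derivative_sum has_derivative_scaleR_right gd)
    then have "((\<lambda>y. frechet_derivative \<phi> (at y) u) has_derivative
        (\<lambda>v. \<Sum>i\<in>UNIV. u $ i *\<^sub>R ?H (axis i 1) v)) (at x)"
      by (rule has_derivative_transform_within_open[OF _ S]) (simp add: expand[symmetric])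
    from fun_cong[OF frechet_derivative_at[OF this]] show ?thesis by simp
  qed
  \<comment> \<open>The composite of \<open>Z'\<close> with \<phi> is differentiated twice over: by
    the product rule on its expression through \<open>Z\<close>, and by the chain rule. Uniqueness
    of derivatives compares the results.\<close>
  have main: "frechet_derivative Z' (at (\<phi> x)) (?D w) = ?H (Z x) w + ?D (frechet_derivative Z (at x) w)"
    if Z: "Z differentiable (at x)" "Z' differentiable (at (\<phi> x))"
      and Z': "\<And>y. y \<in> S \<Longrightarrow> Z' (\<phi> y) = frechet_derivative \<phi> (at y) (Z y)" for Z Z' w
  proof -
    have "(Z has_derivative frechet_derivative Z (at x)) (at x)"
      using Z by (simp add: frechet_derivative_works)
    then have "((\<lambda>y. Z y $ i) has_derivative (\<lambda>w. frechet_derivative Z (at x) w $ i)) (at x)" for i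
      by (rule bounded_linear.has_derivative[OF bounded_linear_vec_nth])
    then have "((\<lambda>y. \<Sum>i\<in>UNIV. Z y $ i *\<^sub>R frechet_derivative \<phi> (at y) (axis i 1)) has_derivative
        (\<lambda>w. \<Sum>i\<in>UNIV. Z x $ i *\<^sub>R ?H (axis i 1) w + frechet_derivative Z (at x) w $ i *\<^sub>R ?D (axis i 1))) (at x)"
      by (intro has_derivative_sum has_derivative_scaleR gd)
    then have 1: "((\<lambda>y. Z' (\<phi> y)) has_derivative
        (\<lambda>w. \<Sum>i\<in>UNIV. Z x $ i *\<^sub>R ?H (axis i 1) w + frechet_derivative Z (at x) w $ i *\<^sub>R ?D (axis i 1))) (at x)"
      by (rule has_derivative_transform_within_open[OF _ S]) (simp add: Z' expand[symmetric])
    have 2: "((\<lambda>y. Z' (\<phi> y)) has_derivative (\<lambda>w. frechet_derivative Z' (at (\<phi> x)) (?D w))) (at x)"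
      by (rule has_derivative_compose[OF \<phi>d[OF S(2)]]) (use Z in \<open>simp add: frechet_derivative_works\<close>)
    show ?thesis
      using fun_cong[OF has_derivative_unique[OF 1 2], of w]
      unfolding Hlin[of "Z x" w] expand[OF S(2), of "frechet_derivative Z (at x) w"]
      by (simp add: sum.distrib)
  qed
  have "frechet_derivative X' (at (\<phi> x)) (?D (Y x)) = ?H (X x) (Y x) + ?D (frechet_derivative X (at x) (Y x))"
    "frechet_derivative Y' (at (\<phi> x)) (?D (X x)) = ?H (Y x) (X x) + ?D (frechet_derivative Y (at x) (X x))"
    by (rule main; use diff X' Y' in blast)+
  then show ?thesis
    using mixed_derivatives_commute[OF S \<phi>, of "X x" "Y x"]
    by (simp add: lie_bracket_def X' Y' S linear_diff[OF Dlin[OF S(2)]])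
qed

section \<open>Matrix algebra\<close>

lemma bounded_bilinear_matrix_matrix_mult:
  "bounded_bilinear ((**) :: real^'m::finite^'n::finite \<Rightarrow> real^'k::finite^'m \<Rightarrow> real^'k^'n)"
  unfolding bilinear_conv_bounded_bilinear[symmetric] bilinear_def
  by (auto intro!: linearI simp: matrix_matrix_mult_def vec_eq_iff algebra_simps sum.distrib sum_distrib_left)

lemma bounded_bilinear_matrix_vector_mult:
  "bounded_bilinear ((*v) :: real^'m::finite^'n::finite \<Rightarrow> real^'m \<Rightarrow> real^'n)"
  unfolding bilinear_conv_bounded_bilinear[symmetric] bilinear_def
  by (auto intro!: linearI simp: matrix_vector_mult_def vec_eq_iff algebra_simps sum.distrib sum_distrib_left)

lemma bounded_linear_transpose: "bounded_linear (transpose :: real^'m::finite^'n::finite \<Rightarrow> real^'n^'m)"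
  unfolding linear_conv_bounded_linear[symmetric]
  by (auto intro!: linearI simp: transpose_def vec_eq_iff)

interpretation matmul: bounded_bilinear "(**) :: real^'m::finite^'n::finite \<Rightarrow> real^'k::finite^'m \<Rightarrow> real^'k^'n"
  by (rule bounded_bilinear_matrix_matrix_mult)

interpretation matvec: bounded_bilinear "(*v) :: real^'m::finite^'n::finite \<Rightarrow> real^'m \<Rightarrow> real^'n"
  by (rule bounded_bilinear_matrix_vector_mult)

lemmas linear_transpose_simps = linear_add[OF bounded_linear.linear[OF bounded_linear_transpose]]
  linear_diff[OF bounded_linear.linear[OF bounded_linear_transpose]]
  linear_neg[OF bounded_linear.linear[OF bounded_linear_transpose]]
  linear_0[OF bounded_linear.linear[OF bounded_linear_transpose]] transpose_scalar

lemmas matrix_distribs = matmul.add_left matmul.add_right matmul.diff_left matmul.diff_right matmul.minus_left matmul.minus_right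
  matmul.scaleR_left matmul.scaleR_right matmul.zero_left matmul.zero_right
  linear_transpose_simps matrix_transpose_mul transpose_transpose transpose_mat
  matrix_mul_lid matrix_mul_rid

lemma matrix_inv_eqI:
  fixes A B :: "real^'n^'n"
  assumes "A ** B = mat 1"
  shows "matrix_inv A = B"
proof -
  have BA: "B ** A = mat 1" using assms by (simp add: matrix_left_right_inverse)
  have "A ** matrix_inv A = mat 1 \<and> matrix_inv A ** A = mat 1"
    unfolding matrix_inv_def by (rule someI[of _ B]) (use assms BA in blast)
  then show ?thesis by (metis BA matrix_mul_assoc matrix_mul_lid matrix_mul_rid)
qed

lemma matrix_inverse_variants:
  fixes A B :: "real^'n::finite^'n"
  assumes "A ** B = mat 1"
  shows "A ** B = mat 1" "B ** A = mat 1" "transpose A ** transpose B = mat 1" "transpose B ** transpose A = mat 1"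
proof -
  show BA: "B ** A = mat 1" using assms by (simp add: matrix_left_right_inverse)
  show "transpose A ** transpose B = mat 1" "transpose B ** transpose A = mat 1"
    using arg_cong[OF assms, of transpose] arg_cong[OF BA, of transpose] by (simp_all add: matrix_transpose_mul)
qed (rule assms)

text \<open>Once products are associated to the right, these act as rewrite rules that remove
  adjacent inverse pairs, up to sign in the second case.\<close>

lemma matrix_cancel:
  fixes A B :: "real^'n::finite^'n" and X :: "real^'m::finite^'n"
  shows "A ** B = mat 1 \<Longrightarrow> A ** (B ** X) = X" "A ** B = - mat 1 \<Longrightarrow> A ** (B ** X) = - X"
  by (simp_all add: matrix_mul_assoc matrix_distribs)

section \<open>Block matrices\<close>

lemma sum_UNIV_sum: "(\<Sum>x\<in>UNIV. f x) = (\<Sum>a\<in>UNIV. f (Inl a)) + (\<Sum>b\<in>UNIV. f (Inr b))"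
  for f :: "'n::finite + 'm::finite \<Rightarrow> 'a::comm_monoid_add"
  using sum.Plus[of "UNIV :: 'n set" "UNIV :: 'm set" f] by (simp add: UNIV_Plus_UNIV)

lemma all_sum_iff: "(\<forall>x. P x) \<longleftrightarrow> (\<forall>a. P (Inl a)) \<and> (\<forall>b. P (Inr b))"
  by (metis sum.exhaust)

definition stack :: "real^'m^'k \<Rightarrow> real^'m^'k \<Rightarrow> real^'m^('k::finite+'k)" where
  "stack M N = (\<chi> i. case i of Inl a \<Rightarrow> M $ a | Inr a \<Rightarrow> N $ a)"

lemma block_nth [simp]:
  "block P Q R S $ Inl a $ Inl b = P $ a $ b" "block P Q R S $ Inl a $ Inr b = Q $ a $ b"
  "block P Q R S $ Inr a $ Inl b = R $ a $ b" "block P Q R S $ Inr a $ Inr b = S $ a $ b"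
  by (simp_all add: block_def)

lemma stack_nth [simp]: "stack M N $ Inl a = M $ a" "stack M N $ Inr a = N $ a"
  by (simp_all add: stack_def)

lemma block_cases: obtains P Q R S where "M = block P Q R S"
proof
  show "M = block (\<chi> a b. M $ Inl a $ Inl b) (\<chi> a b. M $ Inl a $ Inr b)
    (\<chi> a b. M $ Inr a $ Inl b) (\<chi> a b. M $ Inr a $ Inr b)"
    by (simp add: vec_eq_iff all_sum_iff)
qed

lemma block_eq_iff: "block P Q R S = block P' Q' R' S' \<longleftrightarrow> P = P' \<and> Q = Q' \<and> R = R' \<and> S = S'"
  by (auto simp add: vec_eq_iff all_sum_iff)

lemma block_algebra:
  fixes P Q R S :: "real^'k::finite^'k" and M N :: "real^'m::finite^'k"
  shows block_mult: "block P Q R S ** block P' Q' R' S' =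
      block (P ** P' + Q ** R') (P ** Q' + Q ** S') (R ** P' + S ** R') (R ** Q' + S ** S')"
    and block_stack: "block P Q R S ** stack M N = stack (P ** M + Q ** N) (R ** M + S ** N)"
    and stack_mult: "stack M N ** Z = stack (M ** (Z :: real^'m^'m)) (N ** Z)"
    and stack_stack: "stack M N ** transpose (stack M' N') =
      block (M ** transpose M') (M ** transpose N') (N ** transpose M') (N ** transpose N')"
    and transpose_stack: "transpose (stack M N) ** stack M'' N'' = transpose M ** M'' + transpose N ** N''"
    and transpose_block: "transpose (block P Q R S) = block (transpose P) (transpose R) (transpose Q) (transpose S)"
    and block_add: "block P Q R S + block P' Q' R' S' = block (P + P') (Q + Q') (R + R') (S + S')"
    and block_diff: "block P Q R S - block P' Q' R' S' = block (P - P') (Q - Q') (R - R') (S - S')"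
    and block_minus: "- block P Q R S = block (- P) (- Q) (- R) (- S)"
    and block_scaleR: "c *\<^sub>R block P Q R S = block (c *\<^sub>R P) (c *\<^sub>R Q) (c *\<^sub>R R) (c *\<^sub>R S)"
    and block_one: "mat 1 = block (mat 1 :: real^'k^'k) 0 0 (mat 1)"
    and block_zero: "0 = block (0 :: real^'k^'k) 0 0 0"
    and stack_minus: "- stack M N = stack (- M) (- N)"
  by (simp_all add: vec_eq_iff all_sum_iff matrix_matrix_mult_def transpose_def sum_UNIV_sum mat_def)

section \<open>Pointwise normal form of the generalized Kaehler data\<close>

text \<open>For skew \<open>A\<close> this is the sum of the bivectors
  \<open>A_ab X_a \<and> W_b\<close>, with \<open>X_a\<close> and \<open>W_b\<close> the columns of
  \<open>V\<close> and \<open>W\<close>.\<close>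

definition frame_bivector :: "real^'n::finite^'k::finite \<Rightarrow> real^'n^'n \<Rightarrow> real^'n^'k \<Rightarrow> real^'k^'k" where
  "frame_bivector V A W = V ** A ** transpose W + W ** A ** transpose V"

text \<open>The linear algebra at one point of an admissible chart: \<open>P\<close> and
  \<open>Q\<close> are the off-diagonal blocks of \<open>J_+\<close>. The inverse \<open>Si\<close>
  comes from taming, in \<open>tamed_normal_form\<close>.\<close>

locale generalized_kahler_blocks =
  fixes P Q S Si A :: "real^'n::finite^'n"
  assumes PQ: "P ** Q = - mat 1"
    and S_eq: "S = (1/2) *\<^sub>R (P + transpose P)" and A_eq: "A = (1/2) *\<^sub>R (P - transpose P)"
    and SSi: "S ** Si = mat 1"
begin

abbreviation "O1 \<equiv> block 0 (mat 1) (- mat 1 :: real^'n^'n) 0"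
abbreviation "K1 \<equiv> block 0 P Q 0"
abbreviation "K0 \<equiv> block 0 S (- Si) 0"

lemma QP: "Q ** P = - mat 1"
proof -
  have "P ** (- Q) = mat 1" using PQ by (simp add: matrix_distribs)
  then have "(- Q) ** P = mat 1" by (simp add: matrix_left_right_inverse)
  then show ?thesis by (simp add: matrix_distribs) (metis add.inverse_inverse)
qed

lemma SiS: "Si ** S = mat 1"
  using SSi by (simp add: matrix_left_right_inverse)

lemma transposes:
  "transpose P = P - 2 *\<^sub>R A" "transpose S = S" "transpose A = - A" "transpose Si = Si"
  "transpose Q ** transpose P = - mat 1" "transpose P ** transpose Q = - mat 1" "P = S + A"
proof -
  show "transpose P = P - 2 *\<^sub>R A" by (simp add: A_eq)
  show S: "transpose S = S" by (simp add: S_eq matrix_distribs add.commute)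
  show "transpose A = - A" by (simp add: A_eq matrix_distribs algebra_simps)
  have "transpose (S ** Si) = mat 1" by (simp add: SSi)
  then have "transpose Si ** S = mat 1" by (simp add: matrix_transpose_mul S)
  then show "transpose Si = Si" by (metis SSi matrix_mul_assoc matrix_mul_lid matrix_mul_rid)
  show "transpose Q ** transpose P = - mat 1" "transpose P ** transpose Q = - mat 1"
    using arg_cong[OF PQ, of transpose] arg_cong[OF QP, of transpose] by (simp_all add: matrix_distribs)
  show "P = S + A" by (simp add: S_eq A_eq vec_eq_iff field_simps)
qed

text \<open>With \<open>P = S + A\<close> both sides equal \<open>A + A Si A\<close>.\<close>

lemma A_Si_P: "A ** Si ** P = P ** Si ** A"
  unfolding transposes(7) by (simp add: matrix_distribs matrix_mul_assoc[symmetric] matrix_cancel SSi SiS)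

lemma matrix_inv_O1: "matrix_inv O1 = block 0 (- mat 1) (mat 1) 0"
  by (rule matrix_inv_eqI) (simp add: block_algebra matrix_distribs)

lemma Jminus_eq: "Jminus O1 K1 = block 0 (transpose P) (transpose Q) 0"
  by (simp add: Jminus_def matrix_inv_O1 block_algebra matrix_distribs)

lemma halves: "P + transpose P = 2 *\<^sub>R S" "P - transpose P = 2 *\<^sub>R A"
  by (simp_all add: S_eq A_eq)

text \<open>Since \<open>Q\<close> is minus the inverse of \<open>P\<close>, multiplying
  \<open>P\<close> and its transpose by \<open>Q\<close> on one side and by the transpose of
  \<open>Q\<close> on the other turns them into minus the transpose of \<open>Q\<close> and minus
  \<open>Q\<close>, in one order or the other. This carries the symmetric and skew parts of
  \<open>P\<close> to those of \<open>Q\<close>.\<close>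

lemma Q_sym: "Q + transpose Q = - 2 *\<^sub>R (Q ** S ** transpose Q)" "Q + transpose Q = - 2 *\<^sub>R (transpose Q ** S ** Q)"
  and Q_skew: "Q - transpose Q = 2 *\<^sub>R (transpose Q ** A ** Q)"
  by (simp_all add: S_eq A_eq matrix_distribs matrix_mul_assoc[symmetric] matrix_cancel PQ QP transposes(5,6)
      del: transposes(1))

lemma gmetric_eq: "gmetric O1 K1 = block (Q ** S ** transpose Q) 0 0 S"
proof -
  have "gmetric O1 K1 = block (- (1/2) *\<^sub>R (Q + transpose Q)) 0 0 ((1/2) *\<^sub>R (P + transpose P))"
    by (simp add: gmetric_def Jminus_eq block_algebra matrix_distribs block_eq_iff algebra_simps)
  then show ?thesis by (simp add: Q_sym(1) halves)
qed

text \<open>The inverse of the metric in \<open>gmetric_eq\<close>: \<open>Q\<close> is inverted by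
  \<open>- P\<close>, and the two signs cancel.\<close>

definition "ginv = block (transpose P ** Si ** P) 0 0 Si"

lemma gmetric_inv: "gmetric O1 K1 ** ginv = mat 1"
  by (simp add: gmetric_eq ginv_def block_algebra matrix_distribs matrix_mul_assoc[symmetric]
      matrix_cancel transposes(5) SSi QP)

lemma Q_A_Si_P: "Q ** A ** Si ** P = - (Si ** A)"
proof -
  have "Q ** (A ** Si ** P) = Q ** (P ** (Si ** A))" by (simp add: A_Si_P matrix_mul_assoc)
  then show ?thesis by (simp add: matrix_cancel QP matrix_mul_assoc[symmetric])
qed

text \<open>The upper right block is immediate. For the lower left one,
  \<open>transpose P = P - 2 A\<close> makes \<open>(Q - transpose Q) ** transpose P\<close>
  collapse to \<open>- 2 Q A\<close>, and \<open>Q_A_Si_P\<close> finishes.\<close>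

lemma beta1_eq: "beta1 O1 K1 = block 0 (- (A ** Si)) (- (Si ** A)) 0"
proof -
  have "(Q - transpose Q) ** transpose P = Q ** (P - 2 *\<^sub>R A) + mat 1"
    by (simp add: matrix_distribs transposes(5) flip: transposes(1))
  also have "\<dots> = - 2 *\<^sub>R (Q ** A)"
    by (simp add: matrix_distribs QP)
  finally have 1: "(Q - transpose Q) ** transpose P = - 2 *\<^sub>R (Q ** A)" .
  have "(Q - transpose Q) ** (transpose P ** Si ** P) = - 2 *\<^sub>R (Q ** A ** Si ** P)"
    using arg_cong[OF 1, of "\<lambda>X. X ** (Si ** P)"] by (simp add: matrix_mul_assoc matmul.minus_left matmul.scaleR_left)
  then have 2: "(Q - transpose Q) ** (transpose P ** Si ** P) = 2 *\<^sub>R (Si ** A)"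
    by (simp add: Q_A_Si_P)
  have "beta1 O1 K1 = - (1/2) *\<^sub>R (block 0 (P - transpose P) (Q - transpose Q) 0 ** ginv)"
    by (simp add: beta1_def matrix_inv_eqI[OF gmetric_inv] Jminus_eq block_algebra)
  also have "\<dots> = - (1/2) *\<^sub>R block 0 (2 *\<^sub>R A ** Si) (2 *\<^sub>R (Si ** A)) 0"
    by (simp only: ginv_def block_mult halves 2 matmul.zero_left matmul.zero_right add_0_left add_0_right)
  finally show ?thesis by (simp add: block_algebra matrix_distribs)
qed

text \<open>The diagonal blocks of the gauge identity prescribe \<open>\<beta>\<^sub>1 B\<close>. This determines the
  \<open>\<theta>\<theta>\<close> part of \<open>B\<close> when \<open>A\<close> is invertible, and the lower left block then allows the rest to vanish.\<close>

definition "B1 = block (- (transpose Q ** A ** Q)) 0 0 0"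

lemma beta1_B1: "beta1 O1 K1 ** B1 = K0 - (1/2) *\<^sub>R (K1 + Jminus O1 K1)"
proof -
  \<comment> \<open>Splitting \<open>P\<close> and its transpose into \<open>S + A\<close> and
    \<open>S - A\<close> expresses \<open>A Q\<close> and \<open>A\<close> times the transpose of
    \<open>Q\<close> without \<open>A\<close>, so the product becomes an expression in
    \<open>Q\<close>, \<open>S\<close> and \<open>Si\<close> that \<open>Q_sym\<close>
    evaluates.\<close>
  have AQ: "A ** Q = - mat 1 - S ** Q"
    using arg_cong[OF transposes(7), of "\<lambda>X. X ** Q"] by (simp add: matrix_distribs PQ algebra_simps)
  have "transpose P = S - A"
    by (simp add: S_eq A_eq vec_eq_iff field_simps)
  then have "A ** transpose Q = S ** transpose Q + mat 1"
    using arg_cong[of "transpose P" "S - A" "\<lambda>X. X ** transpose Q"]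
    by (simp add: matrix_distribs transposes(6) algebra_simps)
  then have "Si ** A ** transpose Q = transpose Q + Si"
    by (simp add: matrix_mul_assoc[symmetric] matrix_distribs matrix_cancel SiS)
  then have "Si ** A ** transpose Q ** (A ** Q) = - transpose Q - Si - transpose Q ** S ** Q - Q"
    by (simp add: AQ matrix_distribs matrix_mul_assoc matrix_cancel SiS)
  also have "\<dots> = - Si - (1/2) *\<^sub>R (Q + transpose Q)"
  proof -
    have "transpose Q ** S ** Q = - (1/2) *\<^sub>R (Q + transpose Q)" by (simp add: Q_sym(2))
    then show ?thesis by (simp add: vec_eq_iff field_simps)
  qed
  finally have "Si ** A ** (transpose Q ** A ** Q) = - Si - (1/2) *\<^sub>R (Q + transpose Q)"
    by (simp add: matrix_mul_assoc)
  then show ?thesis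
    by (simp add: beta1_eq B1_def Jminus_eq block_algebra matrix_distribs block_eq_iff halves)
qed

text \<open>The left side is the lower left block of \<open>J_beta\<close> conjugated by the gauge
  transformation, the right side that of the first generalized complex structure. The middle term is
  zero, because \<open>beta1\<close> maps the \<theta> covectors to \<mu> directions and
  \<open>B1\<close> annihilates these.\<close>

lemma B1_K0: "B1 ** K0 - B1 ** beta1 O1 K1 ** B1 + transpose K0 ** B1
    = (1/2) *\<^sub>R (omega_minus O1 K1 - omega_plus O1 K1)"
proof -
  have "(Q - transpose Q) ** S = - (Q + transpose Q) ** A"
    by (simp add: S_eq A_eq matrix_distribs PQ QP transposes(5,6) algebra_simps)
  then have 1: "transpose Q ** A ** Q ** S = Q ** S ** transpose Q ** A"
    unfolding Q_skew Q_sym by (simp add: matrix_distribs)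
  have "S ** (Q - transpose Q) = 2 *\<^sub>R (S ** (transpose Q ** A ** Q))"
    unfolding Q_skew by (simp add: matrix_distribs)
  then have 2: "S ** transpose Q - S ** Q = - 2 *\<^sub>R (S ** (transpose Q ** A ** Q))"
    by (simp add: matrix_distribs algebra_simps)
  have 3: "Q ** S ** transpose Q ** transpose P - Q ** S ** transpose Q ** P = - 2 *\<^sub>R (Q ** S ** transpose Q ** A)"
    unfolding transposes(1) by (simp add: matrix_distribs)
  show ?thesis
    using 1 2 3
    by (simp add: B1_def transposes(2,4) omega_minus_def omega_plus_def beta1_eq gmetric_eq Jminus_eq block_algebra matrix_distribs
      block_eq_iff)
qed

text \<open>This and the next two identities replace blocks by expressions in the frame
  \<open>stack (mat 1) 0\<close> of the orbit directions. In that form they survive a change of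
  chart.\<close>

lemma beta1_frame:
  "beta1 O1 K1 = frame_bivector (stack (mat 1) 0) A (K0 ** stack (mat 1) 0)"
  by (simp add: beta1_eq frame_bivector_def block_algebra matrix_distribs transposes(4))

lemma B1_frame:
  "B1 = - ((transpose K1 ** O1 ** stack (mat 1) 0) ** A ** transpose (transpose K1 ** O1 ** stack (mat 1) 0))"
  by (simp add: B1_def block_algebra matrix_distribs)

lemma Q_frame: "- transpose (O1 ** stack (mat 1) 0) ** K1 ** stack (mat 1) 0 = Q"
  by (simp add: block_algebra matrix_distribs matrix_mul_assoc[symmetric])

end

section \<open>Change of basis and the gauge identity\<close>

lemma Jminus_conj:
  fixes D :: "real^'k::finite^'k"
  assumes D: "D ** D' = mat 1" "Om ** Oi = mat 1"
  shows "Jminus (transpose D ** Om ** D) (D' ** K ** D) = D' ** Jminus Om K ** D"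
proof -
  note inv = matrix_inverse_variants[OF D(1)] matrix_inverse_variants[OF D(2)]
  have i: "matrix_inv (transpose D ** Om ** D) = D' ** Oi ** transpose D'" "matrix_inv Om = Oi"
    by (rule matrix_inv_eqI; simp add: matrix_mul_assoc[symmetric] matrix_cancel inv D(2))+
  show ?thesis
    by (simp add: Jminus_def i) (simp add: matrix_distribs matrix_mul_assoc[symmetric] matrix_cancel inv)
qed

lemma gmetric_conj:
  fixes D :: "real^'k::finite^'k"
  assumes D: "D ** D' = mat 1" "Om ** Oi = mat 1"
  shows "gmetric (transpose D ** Om ** D) (D' ** K ** D) = transpose D ** gmetric Om K ** D"
  by (simp add: gmetric_def Jminus_conj[OF D]) (simp add: matrix_distribs matrix_mul_assoc[symmetric] matrix_cancel D)

text \<open>An explicit inverse \<open>gi\<close> of the metric is needed to evaluate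
  \<open>matrix_inv\<close> on both sides.\<close>

lemma beta1_conj:
  fixes D :: "real^'k::finite^'k"
  assumes D: "D ** D' = mat 1" "Om ** Oi = mat 1" and g: "gmetric Om K ** gi = mat 1"
  shows "beta1 (transpose D ** Om ** D) (D' ** K ** D) = D' ** beta1 Om K ** transpose D'"
proof -
  note inv = matrix_inverse_variants[OF D(1)] matrix_inverse_variants[OF D(2)]
  have i: "matrix_inv (transpose D ** gmetric Om K ** D) = D' ** gi ** transpose D'" "matrix_inv (gmetric Om K) = gi"
    by (rule matrix_inv_eqI; simp add: matrix_mul_assoc[symmetric] matrix_cancel inv g)+
  show ?thesis
    by (simp add: beta1_def gmetric_conj[OF D] Jminus_conj[OF D] i)
      (simp add: matrix_distribs matrix_mul_assoc[symmetric] matrix_cancel inv)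
qed

text \<open>The gauge identity block by block. The upper left block is hypothesis \<open>1\<close>
  and the lower right one is its transpose; the lower left block is hypothesis \<open>2\<close>. The
  upper right block is automatic: the inverses of the two forms are \<open>- K ** gi\<close> and
  \<open>- Jminus Om K ** gi\<close>, and half their difference is \<open>beta1\<close>.\<close>

lemma gcs1_eq_exp_conj:
  fixes Om K J0 B gi :: "real^'k::finite^'k"
  assumes g: "gmetric Om K ** gi = mat 1" and K: "K ** K = - mat 1" "Jminus Om K ** Jminus Om K = - mat 1"
    and B: "transpose B = - B" and b: "transpose (beta1 Om K) = - beta1 Om K"
    and 1: "beta1 Om K ** B = J0 - (1/2) *\<^sub>R (K + Jminus Om K)"
    and 2: "B ** J0 - B ** beta1 Om K ** B + transpose J0 ** B = (1/2) *\<^sub>R (omega_minus Om K - omega_plus Om K)"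
    and beta: "\<And>i j. Im (beta $ i $ j) = - (1/4) * beta1 Om K $ i $ j"
  shows "gcs1 Om K = exp_form (- B) ** gcs_poisson J0 beta ** exp_form B"
proof -
  have om: "matrix_inv (omega_plus Om K) = - K ** gi" "matrix_inv (omega_minus Om K) = - Jminus Om K ** gi"
    unfolding omega_plus_def omega_minus_def
    by (rule matrix_inv_eqI; simp add: matrix_distribs matrix_mul_assoc[symmetric] matrix_cancel K g)+
  have r: "(1/2) *\<^sub>R (matrix_inv (omega_plus Om K) - matrix_inv (omega_minus Om K)) = beta1 Om K"
    by (simp add: om beta1_def matrix_inv_eqI[OF g] matrix_distribs)
      (simp add: vec_eq_iff field_simps)
  have im: "- 4 *\<^sub>R (\<chi> i j. Im (beta $ i $ j)) = beta1 Om K"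
    by (simp add: vec_eq_iff beta)
  have t: "transpose J0 - B ** beta1 Om K = (1/2) *\<^sub>R (transpose K + transpose (Jminus Om K))"
    using arg_cong[OF 1, of transpose] by (simp add: matrix_distribs B b algebra_simps)
  show ?thesis
    using 1 2 t r unfolding gcs1_def exp_form_def gcs_poisson_def im
    by (simp add: block_algebra matrix_distribs block_eq_iff algebra_simps)
qed

section \<open>The identities transported by a transition matrix \<open>D\<close> with inverse
  \<open>D'\<close>\<close>

context generalized_kahler_blocks
begin

lemma A_from_Q: "(1/2) *\<^sub>R (transpose (matrix_inv Q) - matrix_inv Q) = A"
proof -
  have "matrix_inv Q = - P" by (rule matrix_inv_eqI) (simp add: matrix_distribs QP)
  then show ?thesis by (simp add: A_eq matrix_distribs)
qed

context
  fixes D D' Om J J0 :: "real^('n+'n)^('n+'n)" and V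
  assumes D: "D ** D' = mat 1"
    and Om: "Om = transpose D ** O1 ** D" and J: "J = D' ** K1 ** D" and J0: "J0 = D' ** K0 ** D"
    and V: "V = D' ** stack (mat 1) 0"
begin

lemmas D_inv = matrix_inverse_variants[OF D]

lemma O1_inv: "O1 ** block 0 (- mat 1) (mat 1) 0 = mat 1"
  by (simp add: block_algebra matrix_distribs)

lemma Q_eq: "- transpose (Om ** V) ** J ** V = Q"
proof -
  have "- transpose (Om ** V) ** J ** V = - transpose (O1 ** stack (mat 1) 0) ** K1 ** stack (mat 1) 0"
    unfolding Om J V by (simp only: matrix_distribs matrix_mul_assoc[symmetric]) (simp add: matrix_cancel D_inv)
  then show ?thesis by (simp only: Q_frame)
qed

lemma beta1_bracket: "beta1 Om J = frame_bivector V A (J0 ** V)"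
proof -
  have "beta1 Om J = D' ** beta1 O1 K1 ** transpose D'"
    unfolding Om J by (rule beta1_conj[OF D O1_inv gmetric_inv])
  also have "\<dots> = frame_bivector V A (J0 ** V)"
    unfolding beta1_frame frame_bivector_def V J0
    by (simp only: matrix_distribs matrix_mul_assoc[symmetric]) (simp add: matrix_cancel D_inv)
  finally show ?thesis .
qed

lemma gcs1_eq:
  fixes B
  defines "B \<equiv> - ((transpose J ** Om ** V) ** A ** transpose (transpose J ** Om ** V))"
  assumes beta: "\<And>i j. Im (beta $ i $ j) = - (1/4) * beta1 Om J $ i $ j"
  shows "gcs1 Om J = exp_form (- B) ** gcs_poisson J0 beta ** exp_form B"
proof (rule gcs1_eq_exp_conj[where gi = "D' ** ginv ** transpose D'"])
  have Jm: "Jminus Om J = D' ** Jminus O1 K1 ** D"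
    unfolding Om J by (rule Jminus_conj[OF D O1_inv])
  have g: "gmetric Om J = transpose D ** gmetric O1 K1 ** D"
    unfolding Om J by (rule gmetric_conj[OF D O1_inv])
  have b: "beta1 Om J = D' ** beta1 O1 K1 ** transpose D'"
    unfolding Om J by (rule beta1_conj[OF D O1_inv gmetric_inv])
  have B: "B = transpose D ** B1 ** D"
    unfolding B_def B1_frame Om J V
    by (simp only: matrix_distribs matrix_mul_assoc[symmetric]) (simp add: matrix_cancel D_inv)
  show "gmetric Om J ** (D' ** ginv ** transpose D') = mat 1"
    unfolding g using gmetric_inv
    by (simp add: matrix_mul_assoc[symmetric] matrix_cancel D_inv)
  show "J ** J = - mat 1"
    unfolding J
    by (simp add: matrix_mul_assoc[symmetric] matrix_cancel D_inv matrix_cancel(2)[of K1 K1] block_algebra PQ QP matrix_distribs)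
  have "Jminus O1 K1 ** Jminus O1 K1 = - mat 1"
    by (simp add: Jminus_eq block_algebra transposes(5,6))
  then show "Jminus Om J ** Jminus Om J = - mat 1"
    unfolding Jm by (simp add: matrix_mul_assoc[symmetric] matrix_cancel D_inv matrix_distribs)
  show "transpose B = - B"
    unfolding B_def by (simp add: matrix_distribs transposes(3) matrix_mul_assoc)
  show "transpose (beta1 Om J) = - beta1 Om J"
    unfolding beta1_bracket frame_bivector_def by (simp add: matrix_distribs transposes(3) matrix_mul_assoc)
  have "beta1 Om J ** B = D' ** (beta1 O1 K1 ** B1) ** D"
    unfolding b B by (simp add: matrix_mul_assoc[symmetric] matrix_cancel D_inv)
  then show "beta1 Om J ** B = J0 - (1/2) *\<^sub>R (J + Jminus Om J)"
    unfolding beta1_B1 Jm unfolding J J0 by (simp add: matrix_distribs)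
  have "B ** J0 - B ** beta1 Om J ** B + transpose J0 ** B
      = transpose D ** (B1 ** K0 - B1 ** beta1 O1 K1 ** B1 + transpose K0 ** B1) ** D"
    unfolding b B J0 by (simp only: matrix_distribs matrix_mul_assoc[symmetric]) (simp add: matrix_cancel D_inv)
  then show "B ** J0 - B ** beta1 Om J ** B + transpose J0 ** B = (1/2) *\<^sub>R (omega_minus Om J - omega_plus Om J)"
    unfolding B1_K0 omega_minus_def omega_plus_def g Jm
    unfolding J by (simp add: matrix_distribs) (simp add: matrix_mul_assoc[symmetric] matrix_cancel D_inv)
  show "Im (beta $ i $ j) = - (1/4) * beta1 Om J $ i $ j" for i j by (rule beta)
qed

end

end

lemma matrix_vector_axis: "(M *v axis j 1) $ i = (M::real^'m::finite^'n) $ i $ j"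
  by (simp add: matrix_vector_mul_component inner_axis)

section \<open>The normal form at a point of an admissible chart\<close>

lemma phi_block: "phi (block P Q R S) = transpose Q"
  by (simp add: phi_def transpose_def vec_eq_iff matrix_vector_axis)

text \<open>The moment map fixes the columns of \<open>Om\<close> in the orbit directions, and
  skewness then leaves only its \<mu>\<mu> block \<open>O22\<close> open. For \<open>J\<close>, the
  \<theta>\<theta> block vanishes by admissibility and the \<mu>\<mu> block because \<open>J\<close>
  squares to -1. The condition that \<open>J_+\<close> and \<open>J_-\<close> have the same image of
  the orbit directions kills \<open>O22\<close>, and taming makes the symmetric part of
  \<open>P\<close> invertible.\<close>

lemma tamed_normal_form:
  fixes Om J :: "real^('n::finite+'n)^('n+'n)"
  assumes OmV: "\<And>j. Om *v axis (Inl j) 1 = - axis (Inr j) 1"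
    and skew: "transpose Om = - Om" and inv: "invertible Om"
    and J2: "J ** J = - mat 1"
    and JV: "\<And>j k. (J *v axis (Inl k) 1) $ Inl j = 0"
    and tamed: "\<And>v. v \<noteq> 0 \<Longrightarrow> (Om *v v) \<bullet> (J *v v) > 0"
    and J_Jminus: "(\<lambda>v. J *v v) ` span (range (\<lambda>j. axis (Inl j) 1)) = (\<lambda>v. Jminus Om J *v v) ` span (range (\<lambda>j. axis (Inl j) 1))"
  obtains P Q Si where "Om = block 0 (mat 1) (- mat 1) 0" "J = block 0 P Q 0"
    "generalized_kahler_blocks P Q ((1/2) *\<^sub>R (P + transpose P)) Si ((1/2) *\<^sub>R (P - transpose P))"
proof -
  obtain J11 P Q J22 where Jb: "J = block J11 P Q J22" by (rule block_cases)
  obtain O11 O12 O21 O22 where Ob: "Om = block O11 O12 O21 O22" by (rule block_cases)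
  have J11: "J11 = 0" using JV by (auto simp: Jb matrix_vector_axis vec_eq_iff)
  have PQ: "P ** Q = - mat 1" and "P ** J22 = 0"
    using J2 by (simp_all add: Jb J11 block_algebra block_eq_iff)
  have QP: "Q ** P = - mat 1"
    using matrix_inverse_variants(2)[of P "- Q"] PQ by (simp add: matrix_distribs) (metis add.inverse_inverse)
  have "Q ** (P ** J22) = 0" using \<open>P ** J22 = 0\<close> by simp
  then have J22: "J22 = 0" using QP by (simp add: matrix_cancel)
  have col: "Om $ i $ Inl j = (- axis (Inr j) 1) $ i" for i j
    using arg_cong[OF OmV[of j], of "\<lambda>v. v $ i"] by (simp only: matrix_vector_axis)
  have O11: "O11 = 0" using col[of "Inl _"] by (simp add: Ob vec_eq_iff axis_def)
  have O21: "O21 = - mat 1" using col[of "Inr _"] by (auto simp add: Ob vec_eq_iff axis_def mat_def)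
  have O12: "O12 = mat 1"
    using skew by (simp add: Ob block_algebra block_eq_iff O21 linear_transpose_simps)
  \<comment> \<open>Comparing blocks in \<open>Om ** Jminus Om J = - (transpose J ** Om)\<close>
    gives \<open>O22 ** transpose Q = M11\<close>. The common image hypothesis yields
    \<open>M11 = 0\<close>, since \<open>J\<close> sends orbit directions to \<mu> directions; and
    \<open>transpose Q\<close> is invertible.\<close>
  have O22: "O22 = 0"
  proof -
    let ?V = "stack (mat 1) 0 :: real^'n^('n+'n)"
    have "Om ** Jminus Om J = - (transpose J ** Om)"
    proof -
      obtain Oi where "Om ** Oi = mat 1" using inv by (auto simp: invertible_def)
      then show ?thesis by (simp add: Jminus_def matrix_inv_eqI matrix_distribs matrix_mul_assoc)
    qed
    moreover obtain M11 M12 M21 M22 where Mb: "Jminus Om J = block M11 M12 M21 M22" by (rule block_cases)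
    ultimately have "O22 ** M21 = M11" "M21 = transpose Q"
      by (auto simp: Ob Jb O11 O12 O21 J11 J22 block_algebra block_eq_iff matrix_distribs)
    moreover have "M11 = 0"
    proof -
      have "(Jminus Om J *v axis (Inl k) 1) $ Inl j = 0" for j k
      proof -
        have "(\<lambda>v. Jminus Om J *v v) (axis (Inl k) 1) \<in> (\<lambda>v. J *v v) ` span (range (\<lambda>j. axis (Inl j) 1))"
          unfolding J_Jminus by (intro imageI span_base) simp
        then obtain v where v: "Jminus Om J *v axis (Inl k) 1 = J *v v" "v \<in> span (range (\<lambda>j. axis (Inl j) 1))"
          by blast
        have "(J *v v) $ Inl j = 0" using v(2)
          by (induction rule: span_induct_alt) (auto simp: matvec.add_right matvec.scaleR_right JV)
        then show ?thesis by (simp add: v)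
      qed
      then show ?thesis by (auto simp: Mb matrix_vector_axis vec_eq_iff)
    qed
    ultimately have "O22 ** transpose Q = 0" by (simp add: matmul.zero_right)
    then have "O22 ** transpose Q ** transpose P = 0" by (simp add: matmul.zero_left)
    moreover have "transpose Q ** transpose P = - mat 1" using arg_cong[OF PQ, of transpose] by (simp add: matrix_distribs)
    ultimately show ?thesis by (simp add: matrix_mul_assoc[symmetric] matrix_distribs)
  qed
  \<comment> \<open>Taming is evaluated on a vector \<open>w\<close> with \<mu> components
    \<open>v\<close> only; both \<open>Om *v w\<close> and \<open>J *v w\<close> then lie in the
    \<theta> block, with entries \<open>v\<close> and \<open>P *v v\<close>.\<close>
  have pos: "v \<bullet> (P *v v) > 0" if "v \<noteq> 0" for v
  proof -
    define w :: "real^('n+'n)" where "w = (\<chi> i. case i of Inl a \<Rightarrow> 0 | Inr a \<Rightarrow> v $ a)"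
    have "w \<noteq> 0" using that by (auto simp: w_def vec_eq_iff all_sum_iff)
    moreover have "(Om *v w) \<bullet> (J *v w) = v \<bullet> (P *v v)"
      by (simp add: Ob Jb O11 O12 O21 O22 J11 J22 inner_vec_def sum_UNIV_sum matrix_vector_mult_def w_def mat_def
          if_distrib if_distribR cong: if_cong)
    ultimately show ?thesis using tamed by metis
  qed
  let ?S = "(1/2) *\<^sub>R (P + transpose P)"
  have "v = 0" if "?S *v v = 0" for v
  proof (rule ccontr)
    assume "v \<noteq> 0"
    have "v \<bullet> (transpose P *v v) = v \<bullet> (P *v v)"
      by (metis dot_lmul_matrix inner_commute transpose_matrix_vector)
    then have "v \<bullet> (?S *v v) = v \<bullet> (P *v v)"
      by (simp add: matvec.scaleR_left matvec.add_left inner_add_right del: transpose_matrix_vector)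
    then show False using pos[OF \<open>v \<noteq> 0\<close>] that by simp
  qed
  then obtain Si where "Si ** ?S = mat 1"
    using matrix_left_invertible_ker by metis
  then have "?S ** Si = mat 1" by (simp add: matrix_left_right_inverse)
  with PQ have "generalized_kahler_blocks P Q ?S Si ((1/2) *\<^sub>R (P - transpose P))"
    by unfold_locales auto
  then show ?thesis using that[of P Q Si] by (simp add: Ob Jb O11 O12 O21 O22 J11 J22)
qed

text \<open>Half of the columns are prescribed and \<open>J0\<close> squares to -1; invertibility of
  \<open>S\<close> then forces the other half. The transposition in \<open>phi_block\<close> is
  harmless because \<open>S\<close> is symmetric.\<close>

lemma phi_s_complex_structure:
  fixes J J0 :: "real^('n::finite+'n)^('n+'n)"
  assumes J: "J = block 0 P Q 0" and J0: "J0 ** J0 = - mat 1"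
    and cols: "\<And>k. J0 *v axis (Inr k) 1 = (\<Sum>j\<in>UNIV. phi_s J $ k $ j *\<^sub>R axis (Inl j) 1)"
    and S: "S = (1/2) *\<^sub>R (P + transpose P)" "S ** Si = mat 1"
  shows "J0 = block 0 S (- Si) 0"
proof -
  obtain X11 X12 X21 X22 where Xb: "J0 = block X11 X12 X21 X22" by (rule block_cases)
  have ps: "phi_s J = S" by (simp add: phi_s_def J phi_block S add.commute)
  have tS: "transpose S = S" by (simp add: S matrix_distribs add.commute)
  have col: "J0 $ i $ Inr k = (\<Sum>j\<in>UNIV. S $ k $ j *\<^sub>R axis (Inl j) 1) $ i" for i k
    using arg_cong[OF cols[of k], of "\<lambda>v. v $ i"] by (simp only: matrix_vector_axis ps)
  have "X22 = 0" using col[of "Inr _"] by (simp add: Xb vec_eq_iff axis_def)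
  moreover have "X12 = transpose S"
    using col[of "Inl _"] by (simp add: Xb vec_eq_iff axis_def transpose_def if_distrib cong: if_cong)
  ultimately have "X12 = S" "X22 = 0" "X21 ** S = - mat 1" "X11 ** S = 0"
    using J0 by (simp_all add: Xb tS block_algebra block_eq_iff)
  then have "X21 ** S ** Si = - Si" "X11 ** S ** Si = 0" by (simp_all add: matrix_distribs)
  then show ?thesis using \<open>X12 = S\<close> \<open>X22 = 0\<close>
    by (simp add: Xb matrix_mul_assoc[symmetric] S(2) matrix_distribs)
qed

section \<open>The Nijenhuis tensor in a chart\<close>

lemma frechet_works: "f differentiable (at x) \<Longrightarrow> (f has_derivative frechet_derivative f (at x)) (at x)"
  by (simp add: frechet_derivative_works)

lemma frechet_eqI: "(f has_derivative f') (at x) \<Longrightarrow> frechet_derivative f (at x) v = f' v"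
  by (simp add: frechet_derivative_at[symmetric])

lemma frechet_linear: "f differentiable (at x) \<Longrightarrow> linear (frechet_derivative f (at x))"
  by (rule has_derivative_linear[OF frechet_works])

lemma frechet_cong:
  assumes "open S" "x \<in> S" "\<And>y. y \<in> S \<Longrightarrow> f y = g y" "f differentiable (at x)"
  shows "frechet_derivative g (at x) = frechet_derivative f (at x)" "g differentiable (at x)"
proof -
  have "(g has_derivative frechet_derivative f (at x)) (at x)"
    by (rule has_derivative_transform_within_open[OF frechet_works[OF assms(4)] assms(1,2,3)])
  then show "frechet_derivative g (at x) = frechet_derivative f (at x)" "g differentiable (at x)"
    by (simp_all add: frechet_derivative_at[symmetric] Derivative.differentiableI)
qed

lemma has_derivative_matrix_vector:
  fixes K :: "real^'k::finite \<Rightarrow> real^'k^'k"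
  assumes "K differentiable (at x)" "X differentiable (at x)"
  shows "((\<lambda>y. K y *v X y) has_derivative
    (\<lambda>w. K x *v frechet_derivative X (at x) w + frechet_derivative K (at x) w *v X x)) (at x)"
  by (intro matvec.FDERIV frechet_works assms)

lemma frechet_matrix_vector:
  fixes K :: "real^'k::finite \<Rightarrow> real^'k^'k"
  assumes "K differentiable (at x)" "X differentiable (at x)"
  shows "frechet_derivative (\<lambda>y. K y *v X y) (at x) w
      = K x *v frechet_derivative X (at x) w + frechet_derivative K (at x) w *v X x"
    "(\<lambda>y. K y *v X y) differentiable (at x)"
  using has_derivative_matrix_vector[OF assms] frechet_eqI by (auto intro: Derivative.differentiableI)

definition nijenhuis :: "(real^'k \<Rightarrow> real^'k::finite^'k) \<Rightarrow> (real^'k \<Rightarrow> real^'k) \<Rightarrow> (real^'k \<Rightarrow> real^'k) \<Rightarrow> real^'k \<Rightarrow> real^'k" where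
  "nijenhuis K X Y x = lie_bracket (\<lambda>y. K y *v X y) (\<lambda>y. K y *v Y y) x
     - K x *v lie_bracket (\<lambda>y. K y *v X y) Y x - K x *v lie_bracket X (\<lambda>y. K y *v Y y) x - lie_bracket X Y x"

definition nijenhuis_tensor :: "real^'k^'k \<Rightarrow> (real^'k \<Rightarrow> real^'k::finite^'k) \<Rightarrow> real^'k \<Rightarrow> real^'k \<Rightarrow> real^'k" where
  "nijenhuis_tensor K K' u v = K' (K *v u) *v v - K' (K *v v) *v u + K *v (K' v *v u) - K *v (K' u *v v)"

text \<open>Tensoriality: the derivatives of \<open>X\<close> and \<open>Y\<close> cancel because
  \<open>K x\<close> squares to -1, leaving the values of the fields and the derivative of
  \<open>K\<close>.\<close>

lemma nijenhuis_eq: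
  assumes K: "K differentiable (at x)" "K x ** K x = - mat 1"
    and XY: "X differentiable (at x)" "Y differentiable (at x)"
  shows "nijenhuis K X Y x = nijenhuis_tensor (K x) (frechet_derivative K (at x)) (X x) (Y x)"
proof -
  have KK: "K x *v (K x *v v) = - v" for v by (simp add: matrix_vector_mul_assoc K matvec.minus_left)
  have lin: "linear (frechet_derivative X (at x))" "linear (frechet_derivative Y (at x))"
    using XY frechet_linear by auto
  show ?thesis
    by (simp add: nijenhuis_def nijenhuis_tensor_def lie_bracket_def frechet_matrix_vector K XY
        matvec.add_right matvec.diff_right KK algebra_simps)
qed

lemma frechet_anticommute:
  fixes K :: "real^'k::finite \<Rightarrow> real^'k^'k"
  assumes S: "open S" "x \<in> S" and K: "K differentiable (at x)" "\<And>y. y \<in> S \<Longrightarrow> K y ** K y = - mat 1"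
  shows "frechet_derivative K (at x) w *v (K x *v v) = - (K x *v (frechet_derivative K (at x) w *v v))"
proof -
  have "((\<lambda>y. K y ** K y) has_derivative (\<lambda>w. K x ** frechet_derivative K (at x) w + frechet_derivative K (at x) w ** K x)) (at x)"
    by (intro matmul.FDERIV frechet_works K)
  then have "((\<lambda>y. - mat 1) has_derivative (\<lambda>w. K x ** frechet_derivative K (at x) w + frechet_derivative K (at x) w ** K x)) (at x)"
    by (rule has_derivative_transform_within_open[OF _ S]) (simp add: K)
  then have "K x ** frechet_derivative K (at x) w + frechet_derivative K (at x) w ** K x = 0"
    using frechet_eqI by fastforce
  then have "frechet_derivative K (at x) w ** K x = - (K x ** frechet_derivative K (at x) w)"
    by (simp add: eq_neg_iff_add_eq_0 add.commute)
  then show ?thesis by (simp add: matrix_vector_mul_assoc matvec.minus_left)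
qed

text \<open>\<open>Inr\<close> directions are \<open>K\<close>-images of \<open>Inl\<close> directions, along which \<open>K\<close> is constant; so the
  Nijenhuis condition on \<open>Inl\<close> directions says that the \<open>Inr\<close>-derivative of \<open>K\<close> is symmetric.\<close>

lemma nijenhuis_symmetric:
  fixes K :: "real^('n::finite+'n) \<Rightarrow> real^('n+'n)^('n+'n)"
  assumes S: "open S" "x \<in> S" and K: "K differentiable (at x)" "\<And>y. y \<in> S \<Longrightarrow> K y ** K y = - mat 1"
    and inv: "\<And>t. (\<And>i. t $ Inr i = 0) \<Longrightarrow> frechet_derivative K (at x) t = 0"
    and N: "\<And>u v. nijenhuis K (\<lambda>y. u) (\<lambda>y. v) x = 0"
    and Kx: "K x = block 0 P Q 0"
    and m: "\<And>i. m1 $ Inl i = 0" "\<And>i. m2 $ Inl i = 0"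
  shows "frechet_derivative K (at x) m1 *v m2 = frechet_derivative K (at x) m2 *v m1"
proof -
  let ?K' = "frechet_derivative K (at x)"
  have KK: "K x *v (K x *v v) = - v" for v by (simp add: matrix_vector_mul_assoc K S matvec.minus_left)
  have z: "(K x *v m) $ Inr i = 0" if "\<And>i. m $ Inl i = 0" for m i
    using that by (simp add: Kx matrix_vector_mult_def sum_UNIV_sum)
  have "nijenhuis_tensor (K x) ?K' (K x *v m1) (K x *v m2) = 0"
    using nijenhuis_eq[OF K(1) K(2)[OF S(2)], of "\<lambda>y. K x *v m1" "\<lambda>y. K x *v m2"] N by simp
  then have "?K' (- m1) *v (K x *v m2) = ?K' (- m2) *v (K x *v m1)"
    by (simp add: nijenhuis_tensor_def KK inv z m)
  then have "K x *v (?K' m1 *v m2) = K x *v (?K' m2 *v m1)"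
    by (simp add: frechet_anticommute[OF S K] linear_neg[OF frechet_linear[OF K(1)]] matvec.minus_left)
  then have "K x *v (K x *v (?K' m1 *v m2)) = K x *v (K x *v (?K' m2 *v m1))" by simp
  then show ?thesis by (simp add: KK)
qed

lemma axis_sum_Inr:
  fixes m :: "real^('n::finite+'n)"
  assumes "\<And>i. m $ Inl i = 0"
  shows "m = (\<Sum>a\<in>UNIV. m $ Inr a *\<^sub>R axis (Inr a) 1)"
  by (simp add: vec_eq_iff all_sum_iff assms axis_def if_distrib cong: if_cong)

text \<open>A converse to \<open>nijenhuis_symmetric\<close>. Brackets with a constant \<theta>
  field vanish by invariance; the bracket of two fields \<open>K t\<close> is governed by the
  derivative of \<open>K\<close> in \<mu> directions, where \<open>sym\<close> applies.\<close>

lemma commuting_frame: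
  fixes K :: "real^('n::finite+'n) \<Rightarrow> real^('n+'n)^('n+'n)"
  assumes S: "open S" "x \<in> S" and K: "K differentiable (at x)" "\<And>y. y \<in> S \<Longrightarrow> K y ** K y = - mat 1"
    and inv: "\<And>t. (\<And>i. t $ Inr i = 0) \<Longrightarrow> frechet_derivative K (at x) t = 0"
    and sym: "\<And>a b. frechet_derivative K (at x) (axis (Inr a) 1) *v axis (Inr b) 1
        = frechet_derivative K (at x) (axis (Inr b) 1) *v axis (Inr a) 1"
    and Kx: "K x = block 0 P Q 0"
    and t: "\<And>i. t1 $ Inr i = 0" "\<And>i. t2 $ Inr i = 0"
  shows "lie_bracket (\<lambda>y. t1) (\<lambda>y. t2) x = 0"
    "lie_bracket (\<lambda>y. t1) (\<lambda>y. K y *v t2) x = 0"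
    "lie_bracket (\<lambda>y. K y *v t1) (\<lambda>y. K y *v t2) x = 0"
proof -
  let ?K' = "frechet_derivative K (at x)"
  note lin = frechet_linear[OF K(1)]
  have KK: "K x *v (K x *v v) = - v" for v by (simp add: matrix_vector_mul_assoc K S matvec.minus_left)
  show "lie_bracket (\<lambda>y. t1) (\<lambda>y. t2) x = 0" by (simp add: lie_bracket_def)
  show "lie_bracket (\<lambda>y. t1) (\<lambda>y. K y *v t2) x = 0"
    by (simp add: lie_bracket_def frechet_matrix_vector K inv t)
  have symm: "?K' m1 *v m2 = ?K' m2 *v m1" if "\<And>i. m1 $ Inl i = 0" "\<And>i. m2 $ Inl i = 0" for m1 m2
  proof -
    have e: "?K' p *v q = (\<Sum>b\<in>UNIV. \<Sum>a\<in>UNIV. (q $ Inr b * p $ Inr a) *\<^sub>R (?K' (axis (Inr a) 1) *v axis (Inr b) 1))"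
      if "\<And>i. p $ Inl i = 0" "\<And>i. q $ Inl i = 0" for p q
      by (subst axis_sum_Inr[OF that(1)], subst axis_sum_Inr[OF that(2)])
        (simp add: linear_sum[OF lin] linear_scale[OF lin] matvec.sum_left matvec.sum_right matvec.scaleR_left matvec.scaleR_right scaleR_sum_right)
    show ?thesis
      unfolding e[OF that] e[OF that(2,1)]
      by (subst sum.swap) (simp add: sym mult.commute)
  qed
  have z: "(K x *v t) $ Inl i = 0" if "\<And>i. t $ Inr i = 0" for t i
    using that by (simp add: Kx matrix_vector_mult_def sum_UNIV_sum)
  \<comment> \<open>Both \<open>K x *v t1\<close> and \<open>K x *v t2\<close> are \<mu> vectors, so
    the symmetry holds for them; anticommutation of \<open>K\<close> with its derivative allows
    another factor \<open>K x\<close> to be inserted. Since \<open>K x\<close> squares to -1, this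
    is the bracket identity below.\<close>
  have "?K' (K x *v t1) *v (K x *v (K x *v t2)) = ?K' (K x *v t2) *v (K x *v (K x *v t1))"
    using symm[OF z z, of t1 t2] t by (simp add: frechet_anticommute[OF S K])
  then show "lie_bracket (\<lambda>y. K y *v t1) (\<lambda>y. K y *v t2) x = 0"
    by (simp add: lie_bracket_def frechet_matrix_vector K KK matvec.minus_right)
qed

text \<open>A condition at the single point \<open>x\<close>, free of admissible coordinates. The
  neighbourhood \<open>S\<close> is there so that the relation \<open>K y ** K y = - mat 1\<close>
  can be differentiated at \<open>x\<close>.\<close>

locale commuting_complex_frame =
  fixes K :: "real^'k::finite \<Rightarrow> real^'k^'k" and V :: "'n::finite \<Rightarrow> real^'k \<Rightarrow> real^'k" and S and x :: "real^'k"
  assumes S: "open S" "x \<in> S" and K: "K differentiable (at x)" "\<And>y. y \<in> S \<Longrightarrow> K y ** K y = - mat 1"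
    and V: "\<And>j. V j differentiable (at x)"
    and VV: "\<And>i j. lie_bracket (V i) (V j) x = 0"
    and VKV: "\<And>i j. lie_bracket (V i) (\<lambda>y. K y *v V j y) x = 0"
    and KVKV: "\<And>i j. lie_bracket (\<lambda>y. K y *v V i y) (\<lambda>y. K y *v V j y) x = 0"
    and span: "\<And>v. \<exists>a b. v = (\<Sum>j\<in>UNIV. a j *\<^sub>R V j x) + (\<Sum>j\<in>UNIV. b j *\<^sub>R (K x *v V j x))"
begin

lemma KK: "K x *v (K x *v v) = - v"
  by (simp add: matrix_vector_mul_assoc K S matvec.minus_left)

lemma linear_eq_0:
  assumes f: "linear f" and 0: "\<And>j. f (V j x) = 0" "\<And>j. f (K x *v V j x) = 0"
  shows "f v = 0"
proof -
  obtain a b where v: "v = (\<Sum>j\<in>UNIV. a j *\<^sub>R V j x) + (\<Sum>j\<in>UNIV. b j *\<^sub>R (K x *v V j x))"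
    using span by blast
  show ?thesis by (simp add: v linear_add[OF f] linear_sum[OF f] linear_scale[OF f] 0)
qed

text \<open>The tensor is skew and conjugate linear in the sense of \<open>T\<close>, so its values
  on pairs \<open>V i x\<close>, \<open>V j x\<close> determine it on the whole frame. On such pairs
  it is a combination of vanishing brackets.\<close>

lemma nijenhuis_eq_0:
  assumes XY: "X differentiable (at x)" "Y differentiable (at x)"
  shows "nijenhuis K X Y x = 0"
proof -
  let ?K' = "frechet_derivative K (at x)"
  let ?T = "nijenhuis_tensor (K x) ?K'"
  note lin = frechet_linear[OF K(1)]
  have skew: "?T u v = - ?T v u" for u v by (simp add: nijenhuis_tensor_def)
  have T: "?T (K x *v u) v = - (K x *v ?T u v)" for u v
    by (simp add: nijenhuis_tensor_def KK frechet_anticommute[OF S K] linear_neg[OF lin]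
        matvec.minus_left matvec.minus_right matvec.diff_right matvec.add_right)
  have linT: "linear (\<lambda>u. ?T u v)" for v
    by (rule linearI; simp add: nijenhuis_tensor_def matvec.add_left matvec.add_right matvec.scaleR_right matvec.scaleR_left
        linear_add[OF lin] linear_scale[OF lin] scaleR_diff_right scaleR_add_right)
  have "?T (V i x) (V j x) = 0" for i j
  proof -
    have 1: "lie_bracket (\<lambda>y. K y *v V i y) (V j) x = 0"
      using VKV[of j i] by (simp add: lie_bracket_def algebra_simps)
    show ?thesis
      unfolding nijenhuis_eq[OF K(1) K(2)[OF S(2)] V V, symmetric] nijenhuis_def VV VKV KVKV 1 by simp
  qed
  note TV = this
  have "?T u (V j x) = 0" for u j
    by (rule linear_eq_0[OF linT]) (simp_all only: T TV matvec.zero_right neg_equal_0_iff_equal)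
  then have TV': "?T (V j x) u = 0" for u j by (subst skew) simp
  have "?T u v = 0" for u v
    by (rule linear_eq_0[OF linT]) (simp_all only: T TV' matvec.zero_right neg_equal_0_iff_equal)
  then show ?thesis by (simp add: nijenhuis_eq[OF K(1) K(2)[OF S(2)] XY])
qed

text \<open>For constant \<open>K\<close> this says that \<open>V i\<close> is a holomorphic field.
  The relation \<open>VV\<close> exchanges the differentiated field with the direction, after which
  \<open>VKV\<close> is the claim on \<open>V j x\<close>; applying \<open>K x\<close> gives it on
  \<open>K x *v V j x\<close>.\<close>

lemma derivative_commutes_if_constant:
  assumes "\<And>y. y \<in> S \<Longrightarrow> K y = K x"
  shows "frechet_derivative (V i) (at x) (K x *v v) = K x *v frechet_derivative (V i) (at x) v"
proof -
  let ?D = "\<lambda>i. frechet_derivative (V i) (at x)"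
  have K': "frechet_derivative K (at x) w = 0" for w
    using frechet_cong(1)[OF S, of "\<lambda>y. K x" K] assms by simp
  note lin = frechet_linear[OF V]
  have 1: "?D j (V i x) = ?D i (V j x)" for i j
    using VV[of i j] by (simp add: lie_bracket_def)
  have 2: "K x *v ?D j (V i x) = ?D i (K x *v V j x)" for i j
    using VKV[of i j] by (simp add: lie_bracket_def frechet_matrix_vector K V K')
  have "?D i (K x *v v) - K x *v ?D i v = 0"
  proof (rule linear_eq_0[where f = "\<lambda>v. ?D i (K x *v v) - K x *v ?D i v"])
    show "linear (\<lambda>v. ?D i (K x *v v) - K x *v ?D i v)"
      by (rule linearI) (simp_all add: linear_add[OF lin] linear_scale[OF lin] matvec.add_right matvec.scaleR_right scaleR_diff_right)
    show "?D i (K x *v V j x) - K x *v ?D i (V j x) = 0" for j by (simp only: 2[symmetric] 1[of j i] diff_self)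
    then show "?D i (K x *v (K x *v V j x)) - K x *v ?D i (K x *v V j x) = 0" for j
      by (simp add: KK linear_neg[OF lin])
  qed
  then show ?thesis by simp
qed

end

section \<open>The Schouten bracket of a constant combination of commuting fields\<close>

lemma sum_skew_pairs:
  fixes A :: "'n::finite \<times> 'n \<Rightarrow> 'a::comm_ring_1"
  assumes "\<And>p. A (prod.swap p) = - A p"
  shows "(\<Sum>p\<in>UNIV. A p * f p) = - (\<Sum>p\<in>UNIV. A p * f (prod.swap p))"
proof -
  have "(\<Sum>p\<in>UNIV. A p * f p) = (\<Sum>p\<in>UNIV. A (prod.swap p) * f (prod.swap p))"
    by (rule sum.reindex_bij_witness[of _ prod.swap prod.swap]) auto
  then show ?thesis by (simp add: assms sum_negf)
qed

text \<open>Hypothesis \<open>D\<close> states that the fields \<open>Z\<close> commute,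
  \<open>E a c\<close> being the derivative of \<open>Z c\<close> along \<open>Z a\<close>. It makes
  \<open>F\<close> symmetric in its first two arguments. Each summand of the cyclic sum is a
  difference of two values of \<open>F\<close>, and these six values cancel in pairs.\<close>

lemma schouten_algebra:
  fixes A :: "'n::finite \<times> 'n \<Rightarrow> complex" and Z :: "'n \<Rightarrow> 'k::finite \<Rightarrow> complex"
    and dZ :: "'n \<Rightarrow> 'k \<Rightarrow> 'k \<Rightarrow> complex"
  assumes A: "\<And>p. A (prod.swap p) = - A p"
    and D: "\<And>a c j. (\<Sum>l\<in>UNIV. Z a l * dZ c l j) = (\<Sum>l\<in>UNIV. Z c l * dZ a l j)"
  defines "b \<equiv> \<lambda>i j. \<Sum>p\<in>UNIV. A p * (Z (fst p) i * Z (snd p) j)"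
  defines "db \<equiv> \<lambda>l i j. \<Sum>p\<in>UNIV. A p * (dZ (fst p) l i * Z (snd p) j + Z (fst p) i * dZ (snd p) l j)"
  shows "(\<Sum>l\<in>UNIV. b l i * db l j k + b l j * db l k i + b l k * db l i j) = 0"
proof -
  define E where "E a c j = (\<Sum>l\<in>UNIV. Z a l * dZ c l j)" for a c j
  define F where "F i k j = (\<Sum>p\<in>UNIV. \<Sum>q\<in>UNIV. A p * A q * (Z (snd p) i * Z (snd q) k * E (fst p) (fst q) j))" for i k j
  have F: "F i k j = F k i j" for i k j
    unfolding F_def by (subst sum.swap) (simp add: E_def D mult.commute mult.left_commute)
  have "(\<Sum>l\<in>UNIV. b l i * db l j k) = F i k j - F i j k" for i j k
  proof -
    \<comment> \<open>Skewness of \<open>A\<close> relabels the second product rule term, so that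
      the differentiated field always carries the index \<open>fst q\<close>.\<close>
    have "db l j k = (\<Sum>q\<in>UNIV. A q * (dZ (fst q) l j * Z (snd q) k)) - (\<Sum>q\<in>UNIV. A q * (Z (snd q) j * dZ (fst q) l k))" for l
      unfolding db_def distrib_left sum.distrib
      using sum_skew_pairs[where A = A, OF A, of "\<lambda>q. Z (fst q) j * dZ (snd q) l k"] by simp
    then have "b l i * db l j k = (\<Sum>p\<in>UNIV. \<Sum>q\<in>UNIV. A p * A q * (Z (snd p) i * Z (snd q) k * (Z (fst p) l * dZ (fst q) l j)))
        - (\<Sum>p\<in>UNIV. \<Sum>q\<in>UNIV. A p * A q * (Z (snd p) i * Z (snd q) j * (Z (fst p) l * dZ (fst q) l k)))" for l
      by (simp add: b_def right_diff_distrib sum_product mult_ac)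
    then have "(\<Sum>l\<in>UNIV. b l i * db l j k)
      = (\<Sum>l\<in>UNIV. \<Sum>p\<in>UNIV. \<Sum>q\<in>UNIV. A p * A q * (Z (snd p) i * Z (snd q) k * (Z (fst p) l * dZ (fst q) l j)))
        - (\<Sum>l\<in>UNIV. \<Sum>p\<in>UNIV. \<Sum>q\<in>UNIV. A p * A q * (Z (snd p) i * Z (snd q) j * (Z (fst p) l * dZ (fst q) l k)))"
      by (simp add: sum_subtractf)
    moreover have "(\<Sum>l\<in>UNIV. \<Sum>p\<in>UNIV. \<Sum>q\<in>UNIV. A p * A q * (Z (snd p) i * Z (snd q) k * (Z (fst p) l * dZ (fst q) l j))) = F i k j" for i k j
      unfolding F_def E_def sum_distrib_left
      by (subst sum.swap, rule sum.cong[OF refl], subst sum.swap, simp)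
    ultimately show ?thesis by simp
  qed
  then show ?thesis using F[of i k j] F[of j i k] F[of k j i] by (simp add: sum.distrib)
qed

text \<open>Twice the component of type (1,0) of the real field \<open>X\<close>.\<close>

definition complex_field :: "(real^'k::finite \<Rightarrow> real^'k^'k) \<Rightarrow> (real^'k \<Rightarrow> real^'k) \<Rightarrow> real^'k \<Rightarrow> 'k \<Rightarrow> complex" where
  "complex_field K X y i = complex_of_real (X y $ i) - \<i> * complex_of_real ((K y *v X y) $ i)"

lemma has_derivative_complex_field:
  assumes "X differentiable (at x)" "(\<lambda>y. K y *v X y) differentiable (at x)"
  shows "((\<lambda>y. complex_field K X y i) has_derivative
    (\<lambda>w. complex_of_real (frechet_derivative X (at x) w $ i)
      - \<i> * complex_of_real (frechet_derivative (\<lambda>y. K y *v X y) (at x) w $ i))) (at x)"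
proof -
  have c: "((\<lambda>y. complex_of_real (Y y $ i)) has_derivative
    (\<lambda>w. complex_of_real (frechet_derivative Y (at x) w $ i))) (at x)" if "Y differentiable (at x)" for Y
    by (rule bounded_linear.has_derivative[OF bounded_linear_of_real
          bounded_linear.has_derivative[OF bounded_linear_vec_nth frechet_works[OF that]]])
  show ?thesis
    unfolding complex_field_def by (intro has_derivative_diff has_derivative_mult_right c assms)
qed

lemma linear_complex_expansion:
  fixes f :: "real^'k::finite \<Rightarrow> real^'k"
  assumes "linear f"
  shows "(\<Sum>l\<in>UNIV. complex_of_real (v $ l) * complex_of_real (f (axis l 1) $ i)) = complex_of_real (f v $ i)"
proof -
  have "v = (\<Sum>l\<in>UNIV. v $ l *\<^sub>R axis l 1)"
    by (simp add: vec_eq_iff axis_def if_distrib cong: if_cong)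
  then have "f v = (\<Sum>l\<in>UNIV. v $ l *\<^sub>R f (axis l 1))"
    using linear_sum[OF assms, of "\<lambda>l. v $ l *\<^sub>R axis l 1" UNIV] linear_scale[OF assms] by simp
  then show ?thesis by simp
qed

lemma frechet_matrix_nth:
  fixes b :: "'a::real_normed_vector \<Rightarrow> 'b::real_normed_vector^'m::finite^'n::finite"
  assumes "b differentiable (at x)"
  shows "((\<lambda>y. b y $ i $ j) has_derivative (\<lambda>v. frechet_derivative b (at x) v $ i $ j)) (at x)"
  by (rule bounded_linear.has_derivative[OF bounded_linear_vec_nth
        bounded_linear.has_derivative[OF bounded_linear_vec_nth frechet_works[OF assms]]])

lemma has_derivative_bivector:
  fixes A :: "'n::finite \<times> 'n \<Rightarrow> complex"
  assumes "\<And>a i. (Z a i has_derivative Z' a i) (at x)"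
  shows "((\<lambda>y. (1/4) * (\<Sum>p\<in>UNIV. A p * (Z (fst p) i y * Z (snd p) j y))) has_derivative
    (\<lambda>v. (1/4) * (\<Sum>p\<in>UNIV. A p * (Z' (fst p) i v * Z (snd p) j x + Z (fst p) i x * Z' (snd p) j v)))) (at x)"
proof -
  have "((\<lambda>y. Z a i y * Z b j y) has_derivative (\<lambda>v. Z' a i v * Z b j x + Z a i x * Z' b j v)) (at x)" for a b
    using has_derivative_mult[OF assms assms, of a i b j] by (simp add: add.commute)
  then show ?thesis by (intro has_derivative_mult_right has_derivative_sum)
qed

context commuting_complex_frame
begin

abbreviation "Z \<equiv> \<lambda>a. complex_field K (V a)"

lemma KV: "(\<lambda>y. K y *v V a y) differentiable (at x)"
  by (rule frechet_matrix_vector(2)[OF K(1) V])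

abbreviation (input) "dZ \<equiv> \<lambda>a i w. complex_of_real (frechet_derivative (V a) (at x) w $ i)
      - \<i> * complex_of_real (frechet_derivative (\<lambda>y. K y *v V a y) (at x) w $ i)"

text \<open>The bracket of \<open>Z a\<close> and \<open>Z c\<close> has real part
  \<open>[V a, V c] - [K V a, K V c]\<close> and imaginary part
  \<open>- [V a, K V c] - [K V a, V c]\<close>, all of which vanish.\<close>

lemma Z_commute:
  "(\<Sum>l\<in>UNIV. Z a x l * dZ c j (axis l 1)) = (\<Sum>l\<in>UNIV. Z c x l * dZ a j (axis l 1))"
proof -
  let ?f = "\<lambda>a. frechet_derivative (V a) (at x)"
  let ?g = "\<lambda>a. frechet_derivative (\<lambda>y. K y *v V a y) (at x)"
  let ?W = "\<lambda>a. K x *v V a x"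
  have e: "(\<Sum>l\<in>UNIV. Z a x l * dZ c j (axis l 1)) =
    complex_of_real ((?f c (V a x) - ?g c (?W a)) $ j) - \<i> * complex_of_real ((?g c (V a x) + ?f c (?W a)) $ j)" for a c
  proof -
    have "(\<Sum>l\<in>UNIV. Z a x l * dZ c j (axis l 1)) =
      (\<Sum>l\<in>UNIV. complex_of_real (V a x $ l) * complex_of_real (?f c (axis l 1) $ j))
      - \<i> * (\<Sum>l\<in>UNIV. complex_of_real (V a x $ l) * complex_of_real (?g c (axis l 1) $ j))
      - \<i> * (\<Sum>l\<in>UNIV. complex_of_real (?W a $ l) * complex_of_real (?f c (axis l 1) $ j))
      - (\<Sum>l\<in>UNIV. complex_of_real (?W a $ l) * complex_of_real (?g c (axis l 1) $ j))"
      by (simp add: complex_field_def sum_distrib_left sum_subtractf[symmetric] algebra_simps)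
    also have "\<dots> = complex_of_real (?f c (V a x) $ j) - \<i> * complex_of_real (?g c (V a x) $ j)
       - \<i> * complex_of_real (?f c (?W a) $ j) - complex_of_real (?g c (?W a) $ j)"
      by (simp only: linear_complex_expansion[OF frechet_linear[OF V]] linear_complex_expansion[OF frechet_linear[OF KV]])
    finally show ?thesis by (simp add: algebra_simps)
  qed
  have "?f c (V a x) = ?f a (V c x)" "?g c (?W a) = ?g a (?W c)"
    using VV[of a c] KVKV[of a c] by (simp_all add: lie_bracket_def)
  moreover have "?g c (V a x) + ?f c (?W a) = ?g a (V c x) + ?f a (?W c)"
    using VKV[of a c] VKV[of c a] by (simp add: lie_bracket_def algebra_simps)
  ultimately show ?thesis unfolding e by simp
qed

text \<open>The coefficients \<open>A\<close> in \<open>eq\<close> do not depend on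
  \<open>y\<close>, so differentiating the formula only touches the fields \<open>Z\<close>, as
  \<open>schouten_algebra\<close> requires.\<close>

lemma schouten_bracket_eq_0:
  fixes b :: "real^'k \<Rightarrow> complex^'k^'k" and A :: "'n \<times> 'n \<Rightarrow> complex"
  assumes b: "b differentiable (at x)"
    and eq: "\<And>y i j. y \<in> S \<Longrightarrow> b y $ i $ j = (1/4) * (\<Sum>p\<in>UNIV. A p * (Z (fst p) y i * Z (snd p) y j))"
    and A: "\<And>p. A (prod.swap p) = - A p"
  shows "(\<Sum>l\<in>UNIV. b x $ l $ i * frechet_derivative b (at x) (axis l 1) $ j $ k
      + b x $ l $ j * frechet_derivative b (at x) (axis l 1) $ k $ i
      + b x $ l $ k * frechet_derivative b (at x) (axis l 1) $ i $ j) = 0"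
proof -
  have "((\<lambda>y. (1/4) * (\<Sum>p\<in>UNIV. A p * (Z (fst p) y i * Z (snd p) y j))) has_derivative
    (\<lambda>v. (1/4) * (\<Sum>p\<in>UNIV. A p * (dZ (fst p) i v * Z (snd p) x j + Z (fst p) x i * dZ (snd p) j v)))) (at x)" for i j
    by (rule has_derivative_bivector[of "\<lambda>a i y. Z a y i"]) (rule has_derivative_complex_field[OF V KV])
  then have "((\<lambda>y. b y $ i $ j) has_derivative
    (\<lambda>v. (1/4) * (\<Sum>p\<in>UNIV. A p * (dZ (fst p) i v * Z (snd p) x j + Z (fst p) x i * dZ (snd p) j v)))) (at x)" for i j
    by (rule has_derivative_transform_within_open[OF _ S]) (simp add: eq)
  then have db: "frechet_derivative b (at x) v $ i $ j
    = (1/4) * (\<Sum>p\<in>UNIV. A p * (dZ (fst p) i v * Z (snd p) x j + Z (fst p) x i * dZ (snd p) j v))" for v i j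
    using fun_cong[OF has_derivative_unique[OF frechet_matrix_nth[OF b]]] by blast
  have bx: "b x $ i $ j = (1/4) * (\<Sum>p\<in>UNIV. A p * (Z (fst p) x i * Z (snd p) x j))" for i j
    by (rule eq[OF S(2)])
  have q: "(\<Sum>l\<in>UNIV. (1/4) * X1 l * ((1/4) * Y1 l) + (1/4) * X2 l * ((1/4) * Y2 l) + (1/4) * X3 l * ((1/4) * Y3 l))
    = (1/16) * (\<Sum>l\<in>UNIV. X1 l * Y1 l + X2 l * Y2 l + X3 l * Y3 l)" for X1 Y1 X2 Y2 X3 Y3 :: "'k \<Rightarrow> complex"
    by (simp add: sum_distrib_left algebra_simps)
  show ?thesis
    unfolding db bx q
    using schouten_algebra[where A = A and Z = "\<lambda>a. Z a x" and dZ = "\<lambda>a l i. dZ a i (axis l 1)" and i = i and j = j and k = k,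
        OF A Z_commute] by simp
qed

end

section \<open>Holomorphic coefficients\<close>

text \<open>Existence of the derivative and the Cauchy-Riemann equations are combined under one
  quantifier, which makes closure under sums and products direct.\<close>

definition cauchy_riemann :: "(real^('n::finite+'n) \<Rightarrow> complex) \<Rightarrow> real^('n+'n) \<Rightarrow> bool" where
  "cauchy_riemann f x \<longleftrightarrow> (\<exists>f'. (f has_derivative f') (at x) \<and> (\<forall>v. f' (Jstd *v v) = \<i> * f' v))"

lemma cauchy_riemann_mult:
  assumes "cauchy_riemann f x" "cauchy_riemann g x"
  shows "cauchy_riemann (\<lambda>y. f y * g y) x"
proof -
  obtain f' g' where "(f has_derivative f') (at x)" "\<And>v. f' (Jstd *v v) = \<i> * f' v"
    "(g has_derivative g') (at x)" "\<And>v. g' (Jstd *v v) = \<i> * g' v"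
    using assms by (auto simp: cauchy_riemann_def)
  then show ?thesis
    unfolding cauchy_riemann_def
    by (intro exI[of _ "\<lambda>v. f x * g' v + f' v * g x"]) (auto intro!: has_derivative_mult simp: algebra_simps)
qed

lemma cauchy_riemann_cmult:
  assumes "cauchy_riemann f x"
  shows "cauchy_riemann (\<lambda>y. c * f y) x"
proof -
  have "cauchy_riemann (\<lambda>y. c) x"
    unfolding cauchy_riemann_def by (intro exI[of _ "\<lambda>v. 0"]) auto
  then show ?thesis using assms by (rule cauchy_riemann_mult)
qed

lemma cauchy_riemann_sum:
  assumes "\<And>i. i \<in> I \<Longrightarrow> cauchy_riemann (f i) x"
  shows "cauchy_riemann (\<lambda>y. \<Sum>i\<in>I. f i y) x"
proof -
  obtain f' where "\<And>i. i \<in> I \<Longrightarrow> (f i has_derivative f' i) (at x)" "\<And>i v. i \<in> I \<Longrightarrow> f' i (Jstd *v v) = \<i> * f' i v"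
    using assms unfolding cauchy_riemann_def by metis
  then show ?thesis
    unfolding cauchy_riemann_def
    by (intro exI[of _ "\<lambda>v. \<Sum>i\<in>I. f' i v"]) (auto intro!: has_derivative_sum simp: sum_distrib_left)
qed

lemma Jstd_nth: "(Jstd *v v) $ Inl j = - v $ Inr j" "(Jstd *v v) $ Inr j = v $ Inl j"
  by (simp_all add: Jstd_def matrix_vector_mult_def sum_UNIV_sum mat_def if_distrib if_distribR sum_negf cong: if_cong)

lemma dz_nth: "dz j $ Inl i = (if i = j then 1 else 0)" "dz j $ Inr i = (if i = j then \<i> else 0)"
  by (simp_all add: dz_def axis_def)

locale commuting_holomorphic_frame = commuting_complex_frame K V S x
  for K :: "real^('n::finite+'n) \<Rightarrow> real^('n+'n)^('n+'n)" and V :: "'n \<Rightarrow> real^('n+'n) \<Rightarrow> real^('n+'n)" and S x +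
  assumes K_std: "\<And>y. y \<in> S \<Longrightarrow> K y = Jstd"
begin

text \<open>The value of \<open>dz j\<close> on \<open>Z a\<close>. The factor 2 appears because
  \<open>dz j\<close> is of type (1,0) and so takes equal values on \<open>V a\<close> and on
  \<open>- \<i>\<close> times \<open>K\<close> applied to \<open>V a\<close>.\<close>

definition h :: "'n \<Rightarrow> 'n \<Rightarrow> real^('n+'n) \<Rightarrow> complex" where
  "h a j y = 2 * (complex_of_real (V a y $ Inl j) + \<i> * complex_of_real (V a y $ Inr j))"

lemma Z_dz: "y \<in> S \<Longrightarrow> (\<Sum>i\<in>UNIV. Z a y i * dz j $ i) = h a j y"
  by (simp add: sum_UNIV_sum complex_field_def h_def K_std Jstd_nth dz_nth if_distrib cong: if_cong)
    (simp add: algebra_simps)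

lemma h_cauchy_riemann: "cauchy_riemann (h a j) x"
proof -
  let ?D = "frechet_derivative (V a) (at x)"
  have D: "?D (Jstd *v v) = Jstd *v ?D v" for v
    using derivative_commutes_if_constant[of a v] K_std S(2) by simp
  have "((\<lambda>y. complex_of_real (V a y $ i)) has_derivative (\<lambda>w. complex_of_real (?D w $ i))) (at x)" for i
    by (rule bounded_linear.has_derivative[OF bounded_linear_of_real
          bounded_linear.has_derivative[OF bounded_linear_vec_nth frechet_works[OF V]]])
  then have "(h a j has_derivative
      (\<lambda>w. 2 * (complex_of_real (?D w $ Inl j) + \<i> * complex_of_real (?D w $ Inr j)))) (at x)"
    unfolding h_def by (intro has_derivative_mult_right has_derivative_add)
  moreover have "2 * (complex_of_real (?D (Jstd *v w) $ Inl j) + \<i> * complex_of_real (?D (Jstd *v w) $ Inr j))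
      = \<i> * (2 * (complex_of_real (?D w $ Inl j) + \<i> * complex_of_real (?D w $ Inr j)))" for w
    by (simp add: D Jstd_nth algebra_simps)
  ultimately show ?thesis
    unfolding cauchy_riemann_def by blast
qed

text \<open>Contraction with \<open>dz j\<close> and \<open>dz k\<close> turns the coefficient into
  a polynomial with constant coefficients in the holomorphic functions \<open>h\<close>. The vector
  \<open>b y *v dz j\<close> contracts the second index, so \<open>snd p\<close> is paired with
  \<open>j\<close>.\<close>

lemma bivector_coefficient_cauchy_riemann:
  fixes b :: "real^('n+'n) \<Rightarrow> complex^('n+'n)^('n+'n)" and A :: "'n \<times> 'n \<Rightarrow> complex"
  assumes eq: "\<And>y i j. y \<in> S \<Longrightarrow> b y $ i $ j = (1/4) * (\<Sum>p\<in>UNIV. A p * (Z (fst p) y i * Z (snd p) y j))"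
  shows "cauchy_riemann (\<lambda>y. \<Sum>a\<in>UNIV. (b y *v dz j) $ a * dz k $ a) x"
proof -
  have "(\<Sum>a\<in>UNIV. (b y *v dz j) $ a * dz k $ a) = (1/4) * (\<Sum>p\<in>UNIV. A p * (h (fst p) k y * h (snd p) j y))" if "y \<in> S" for y
  proof -
    have "(\<Sum>a\<in>UNIV. (b y *v dz j) $ a * dz k $ a)
      = (\<Sum>a\<in>UNIV. \<Sum>i\<in>UNIV. \<Sum>p\<in>UNIV. (1/4) * (A p * ((Z (fst p) y a * dz k $ a) * (Z (snd p) y i * dz j $ i))))"
      by (simp add: matrix_vector_mult_def eq[OF that] sum_distrib_left sum_distrib_right mult_ac)
    also have "\<dots> = (\<Sum>p\<in>UNIV. \<Sum>a\<in>UNIV. \<Sum>i\<in>UNIV. (1/4) * (A p * ((Z (fst p) y a * dz k $ a) * (Z (snd p) y i * dz j $ i))))"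
      by (subst (2) sum.swap, subst sum.swap, simp)
    also have "\<dots> = (\<Sum>p\<in>UNIV. (1/4) * (A p * ((\<Sum>a\<in>UNIV. Z (fst p) y a * dz k $ a) * (\<Sum>i\<in>UNIV. Z (snd p) y i * dz j $ i))))"
      unfolding sum_product by (simp only: sum_distrib_left)
    finally show ?thesis by (simp only: Z_dz[OF that] sum_distrib_left)
  qed
  moreover have "cauchy_riemann (\<lambda>y. (1/4) * (\<Sum>p\<in>UNIV. A p * (h (fst p) k y * h (snd p) j y))) x"
    by (intro cauchy_riemann_cmult cauchy_riemann_sum cauchy_riemann_mult h_cauchy_riemann)
  then obtain f' where f': "((\<lambda>y. (1/4) * (\<Sum>p\<in>UNIV. A p * (h (fst p) k y * h (snd p) j y))) has_derivative f') (at x)"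
    "\<forall>v. f' (Jstd *v v) = \<i> * f' v"
    unfolding cauchy_riemann_def by blast
  ultimately have "((\<lambda>y. \<Sum>a\<in>UNIV. (b y *v dz j) $ a * dz k $ a) has_derivative f') (at x)"
    by (intro has_derivative_transform_within_open[OF f'(1) S]) simp
  with f'(2) show ?thesis unfolding cauchy_riemann_def by blast
qed

end

section \<open>Charts and torus actions\<close>

locale smooth_manifold =
  fixes A :: "('m::{second_countable_topology,t2_space}, 'k::finite) chart set"
  assumes atlas: "smooth_structure A"
begin

lemma chart:
  assumes "c \<in> A"
  shows open_cdom: "open (cdom c)" and open_image: "open (crd c ` cdom c)"
    and homeo: "homeomorphism (cdom c) (crd c ` cdom c) (crd c) (pt c)"
  using atlas assms by (auto simp: smooth_structure_def is_chart_def)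

lemma pt_crd: "c \<in> A \<Longrightarrow> p \<in> cdom c \<Longrightarrow> pt c (crd c p) = p"
  by (rule homeomorphism_apply1[OF homeo])

lemma crd_pt: "c \<in> A \<Longrightarrow> x \<in> crd c ` cdom c \<Longrightarrow> crd c (pt c x) = x"
  by (rule homeomorphism_apply2[OF homeo])

lemma pt_in: "c \<in> A \<Longrightarrow> x \<in> crd c ` cdom c \<Longrightarrow> pt c x \<in> cdom c"
  by (erule imageE) (simp add: pt_crd)

lemma open_crd_image:
  assumes "c \<in> A" "open N"
  shows "open (crd c ` (cdom c \<inter> N))"
proof -
  have "openin (top_of_set (crd c ` cdom c)) (crd c ` (cdom c \<inter> N))"
    by (rule homeomorphism_imp_open_map[OF homeo[OF assms(1)]]) (simp add: assms(2) openin_open_Int)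
  then show ?thesis using open_image[OF assms(1)] openin_open_trans by blast
qed

lemma continuous_on_pt: "c \<in> A \<Longrightarrow> continuous_on (crd c ` cdom c) (pt c)"
  by (rule homeomorphism_cont2[OF homeo])

lemma continuous_on_crd: "c \<in> A \<Longrightarrow> continuous_on (cdom c) (crd c)"
  by (rule homeomorphism_cont1[OF homeo])

lemma open_pt_image:
  assumes "c \<in> A" "open N" "N \<subseteq> crd c ` cdom c"
  shows "open (pt c ` N)"
proof -
  have "pt c ` N = cdom c \<inter> crd c -` N"
  proof (intro subset_antisym subsetI)
    fix q assume "q \<in> cdom c \<inter> crd c -` N"
    then show "q \<in> pt c ` N" using pt_crd[OF assms(1)] by (intro image_eqI[of _ _ "crd c q"]) auto
  next
    fix q assume "q \<in> pt c ` N"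
    then obtain x where "x \<in> N" "q = pt c x" by blast
    then show "q \<in> cdom c \<inter> crd c -` N"
      using assms(3) pt_in[OF assms(1), of x] crd_pt[OF assms(1), of x] by auto
  qed
  then show ?thesis
    using continuous_open_preimage[OF continuous_on_crd[OF assms(1)] open_cdom[OF assms(1)] assms(2)] by simp
qed

abbreviation overlap :: "('m, 'k) chart \<Rightarrow> ('m, 'k) chart \<Rightarrow> (real^'k) set" where
  "overlap c d \<equiv> crd c ` (cdom c \<inter> cdom d)"

lemma open_overlap: "c \<in> A \<Longrightarrow> d \<in> A \<Longrightarrow> open (overlap c d)"
  by (rule open_crd_image) (auto intro: open_cdom)

lemma transition_smooth: "c \<in> A \<Longrightarrow> d \<in> A \<Longrightarrow> smooth_on (overlap c d) (\<lambda>x. crd d (pt c x))"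
  using atlas by (auto simp: smooth_structure_def smooth_transition_def)

lemma transition_derivative:
  assumes "c \<in> A" "d \<in> A" "p \<in> cdom c \<inter> cdom d"
  shows "((\<lambda>x. crd d (pt c x)) has_derivative (\<lambda>v. dmap id c d p *v v)) (at (crd c p))"
proof -
  have "(\<lambda>x. crd d (pt c x)) differentiable (at (crd c p))"
    by (rule smooth_on_differentiable[OF transition_smooth[OF assms(1,2)]]) (use assms in auto)
  then show ?thesis by (simp add: jacobian_works dmap_def)
qed

lemma transition_frechet:
  assumes "c \<in> A" "d \<in> A" "x \<in> overlap c d"
  shows "frechet_derivative (\<lambda>x. crd d (pt c x)) (at x) v = dmap id c d (pt c x) *v v"
proof -
  obtain p where p: "x = crd c p" "p \<in> cdom c \<inter> cdom d" using assms(3) by blast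
  then have "pt c x = p" by (simp add: pt_crd assms(1))
  then show ?thesis
    unfolding p(1) using frechet_eqI[OF transition_derivative[OF assms(1,2) p(2)]] p(1) by simp
qed

lemma dmap_inverse:
  assumes "c \<in> A" "d \<in> A" "p \<in> cdom c \<inter> cdom d"
  shows "dmap id d c p ** dmap id c d p = mat 1"
proof -
  have 1: "((\<lambda>x. crd c (pt d (crd d (pt c x)))) has_derivative (\<lambda>v. dmap id d c p *v (dmap id c d p *v v))) (at (crd c p))"
  proof (rule has_derivative_compose[OF transition_derivative[OF assms]])
    have "crd d (pt c (crd c p)) = crd d p" using assms pt_crd by simp
    then show "((\<lambda>x. crd c (pt d x)) has_derivative (\<lambda>v. dmap id d c p *v v)) (at (crd d (pt c (crd c p))))"
      using transition_derivative[OF assms(2,1), of p] assms(3) by (simp only: Int_commute)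
  qed
  have "((\<lambda>x. x) has_derivative (\<lambda>v. v)) (at (crd c p))" by (rule has_derivative_ident)
  then have 2: "((\<lambda>x. crd c (pt d (crd d (pt c x)))) has_derivative (\<lambda>v. v)) (at (crd c p))"
    by (rule has_derivative_transform_within_open[OF _ open_overlap[OF assms(1,2)]])
      (use assms in \<open>auto simp: pt_crd\<close>)
  have "dmap id d c p *v (dmap id c d p *v v) = v" for v
    using fun_cong[OF has_derivative_unique[OF 1 2], of v] .
  then show ?thesis by (simp add: matrix_eq matrix_vector_mul_assoc)
qed

end

section \<open>The torus action and its fundamental fields\<close>

lemma texp_0: "texp 0 = 1"
  by (simp add: texp_def vec_eq_iff)

lemma texp_add: "texp (s + t) = texp s * texp t"
  by (simp add: texp_def vec_eq_iff cis_mult)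

lemma texp_torus: "texp t \<in> torus"
  by (simp add: texp_def torus_def)

lemma continuous_on_texp: "continuous_on S texp"
  unfolding texp_def cis_conv_exp by (intro continuous_on_vec_lambda continuous_intros)

locale toric_manifold = smooth_manifold A
  for A :: "('m::{second_countable_topology,t2_space}, 'k::finite) chart set" +
  fixes act :: "complex^'n::finite \<Rightarrow> 'm \<Rightarrow> 'm"
  assumes action: "torus_action A act"
begin

lemma act_texp_0: "act (texp 0) p = p"
  using action by (simp add: torus_action_def texp_0)

lemma act_texp_add: "act (texp (s + t)) p = act (texp s) (act (texp t) p)"
  using action unfolding torus_action_def texp_add by (simp add: texp_torus)

lemma continuous_on_act: "continuous_on S (\<lambda>(t, p). act (texp t) p)"
proof -
  have "continuous_on (torus \<times> UNIV) (\<lambda>(z, p). act z p)"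
    using action by (simp add: torus_action_def)
  moreover have "continuous_on S (\<lambda>q. (texp (fst q), snd q))"
    by (rule continuous_on_Pair[OF continuous_on_compose2[OF continuous_on_texp[of UNIV] continuous_on_fst[OF continuous_on_id]]
          continuous_on_snd[OF continuous_on_id]]) simp
  ultimately have "continuous_on S (\<lambda>q. (\<lambda>(z, p). act z p) (texp (fst q), snd q))"
    by (rule continuous_on_compose2) (simp add: image_subset_iff texp_torus)
  then show ?thesis by (simp add: case_prod_unfold)
qed

text \<open>The action in one chart, as a joint function of the Lie algebra parameter and the point.
  Its domain is open, which is what derivatives at parameter 0 require.\<close>

definition "flow c = (\<lambda>(t, x). crd c (act (texp t) (pt c x)))"
definition "flow_dom c = {(t, x). x \<in> crd c ` cdom c \<and> act (texp t) (pt c x) \<in> cdom c}"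

lemma flow_smooth: "c \<in> A \<Longrightarrow> smooth_on (flow_dom c) (flow c)"
  using action by (simp add: torus_action_def flow_def flow_dom_def)

lemma open_flow_dom:
  assumes "c \<in> A"
  shows "open (flow_dom c)"
proof -
  let ?U = "UNIV \<times> crd c ` cdom c :: ((real^'n) \<times> (real^'k)) set"
  have "continuous_on ?U (\<lambda>q. (fst q, pt c (snd q)))"
    by (rule continuous_on_Pair[OF continuous_on_fst[OF continuous_on_id]
          continuous_on_compose2[OF continuous_on_pt[OF assms] continuous_on_snd[OF continuous_on_id]]]) auto
  from continuous_on_compose2[OF continuous_on_act[of UNIV] this]
  have "continuous_on ?U (\<lambda>q. act (texp (fst q)) (pt c (snd q)))"
    by (simp add: case_prod_unfold)
  then have "open (?U \<inter> (\<lambda>q. act (texp (fst q)) (pt c (snd q))) -` cdom c)"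
    by (rule continuous_open_preimage) (simp_all add: open_Times open_image[OF assms] open_cdom[OF assms])
  also have "?U \<inter> (\<lambda>q. act (texp (fst q)) (pt c (snd q))) -` cdom c = flow_dom c"
    by (simp add: set_eq_iff flow_dom_def)
  finally show ?thesis .
qed

lemma zero_in_flow_dom: "c \<in> A \<Longrightarrow> (0, x) \<in> flow_dom c \<longleftrightarrow> x \<in> crd c ` cdom c"
  by (auto simp: flow_dom_def act_texp_0 intro!: pt_in)

text \<open>The orbit curve is the flow along the line through 0 in direction \<xi>, so the chain
  rule applies. As a partial derivative of the smooth flow, the fundamental field is itself
  smooth.\<close>

lemma
  assumes "c \<in> A" "p \<in> cdom c"
  shows fund_eq: "fund act \<xi> c p = frechet_derivative (flow c) (at (0, crd c p)) (\<xi>, 0)"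
    and fund_derivative: "((\<lambda>s. crd c (act (texp (s *\<^sub>R \<xi>)) p)) has_vector_derivative fund act \<xi> c p) (at 0)"
proof -
  let ?D = "frechet_derivative (flow c) (at (0, crd c p))"
  have "flow c differentiable (at (0, crd c p))"
    by (rule smooth_on_differentiable[OF flow_smooth]) (use assms zero_in_flow_dom in auto)
  then have D: "(flow c has_derivative ?D) (at (0, crd c p))" by (rule frechet_works)
  moreover have "((\<lambda>s. (s *\<^sub>R \<xi>, crd c p)) has_derivative (\<lambda>h. (h *\<^sub>R \<xi>, 0))) (at 0)"
    by (intro has_derivative_Pair has_derivative_const has_derivative_scaleR_left has_derivative_ident)
  ultimately have "((\<lambda>s. flow c (s *\<^sub>R \<xi>, crd c p)) has_derivative (\<lambda>h. ?D (h *\<^sub>R \<xi>, 0))) (at 0)"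
    using has_derivative_compose[of "\<lambda>s. (s *\<^sub>R \<xi>, crd c p)" "\<lambda>h. (h *\<^sub>R \<xi>, 0)" 0 UNIV "flow c"] by simp
  moreover have "?D (h *\<^sub>R \<xi>, 0) = h *\<^sub>R ?D (\<xi>, 0)" for h
    using linear_scale[OF has_derivative_linear[OF D], of h "(\<xi>, 0)"] by simp
  ultimately have "((\<lambda>s. crd c (act (texp (s *\<^sub>R \<xi>)) p)) has_vector_derivative ?D (\<xi>, 0)) (at 0)"
    by (simp add: has_vector_derivative_def flow_def pt_crd assms)
  then show "fund act \<xi> c p = ?D (\<xi>, 0)"
    "((\<lambda>s. crd c (act (texp (s *\<^sub>R \<xi>)) p)) has_vector_derivative fund act \<xi> c p) (at 0)"
    by (simp_all add: fund_def vector_derivative_at)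
qed

lemma fund_smooth:
  assumes "c \<in> A"
  shows "smooth_on (crd c ` cdom c) (\<lambda>x. fund act \<xi> c (pt c x))"
proof (rule smooth_on_local)
  fix x assume x: "x \<in> crd c ` cdom c"
  have "smooth_on (crd c ` cdom c) (\<lambda>x. frechet_derivative (flow c) (at (0, x)) (\<xi>, 0))"
    using smooth_on_slice[OF open_flow_dom[OF assms] smooth_on_frechet[OF flow_smooth[OF assms]], of 0 "(\<xi>, 0)"]
    by (simp add: zero_in_flow_dom[OF assms])
  then show "\<exists>T g. x \<in> T \<and> open T \<and> T \<subseteq> crd c ` cdom c \<and> smooth_on T g \<and> (\<forall>y\<in>T. g y = fund act \<xi> c (pt c y))"
    by (intro exI[of _ "crd c ` cdom c"] exI[of _ "\<lambda>x. frechet_derivative (flow c) (at (0, x)) (\<xi>, 0)"])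
      (use x assms in \<open>auto simp: open_image fund_eq pt_crd\<close>)
qed

lemma orbit_eventually:
  assumes "open N" "p \<in> N"
  shows "\<forall>\<^sub>F s in nhds 0. act (texp (s *\<^sub>R \<xi>)) p \<in> N"
proof -
  have "continuous_on UNIV (\<lambda>s. (s *\<^sub>R \<xi>, p))"
    by (intro continuous_on_Pair continuous_on_const continuous_on_scaleR continuous_on_id)
  from continuous_on_compose2[OF continuous_on_act[of UNIV] this]
  have "continuous_on UNIV (\<lambda>s. act (texp (s *\<^sub>R \<xi>)) p)" by simp
  then have "open ((\<lambda>s. act (texp (s *\<^sub>R \<xi>)) p) -` N)"
    using assms(1) by (rule open_vimage[rotated])
  then show ?thesis
    using eventually_nhds_in_open[of "(\<lambda>s. act (texp (s *\<^sub>R \<xi>)) p) -` N" 0] assms(2) by (simp add: act_texp_0)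
qed

lemma fund_transform:
  assumes cd: "c \<in> A" "d \<in> A" and p: "p \<in> cdom c \<inter> cdom d"
  shows "fund act \<xi> d p = dmap id c d p *v fund act \<xi> c p"
proof -
  let ?\<gamma> = "\<lambda>s. act (texp (s *\<^sub>R \<xi>)) p"
  have "((\<lambda>s. crd d (pt c (crd c (?\<gamma> s)))) has_derivative (\<lambda>h. dmap id c d p *v (h *\<^sub>R fund act \<xi> c p))) (at 0)"
  proof (rule has_derivative_compose[OF fund_derivative[unfolded has_vector_derivative_def]])
    have "crd c (?\<gamma> 0) = crd c p" by (simp add: act_texp_0)
    then show "((\<lambda>x. crd d (pt c x)) has_derivative (\<lambda>v. dmap id c d p *v v)) (at (crd c (?\<gamma> 0)))"
      using transition_derivative[OF cd p] by (simp only:)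
  qed (use cd p in auto)
  then have "((\<lambda>s. crd d (?\<gamma> s)) has_derivative (\<lambda>h. dmap id c d p *v (h *\<^sub>R fund act \<xi> c p))) (at 0)"
  proof (rule has_derivative_transform_eventually)
    have "\<forall>\<^sub>F s in nhds 0. ?\<gamma> s \<in> cdom c"
      by (rule orbit_eventually) (use cd p open_cdom in auto)
    then show "\<forall>\<^sub>F s in at 0. crd d (pt c (crd c (?\<gamma> s))) = crd d (?\<gamma> s)"
      by (auto simp: eventually_at_filter pt_crd cd elim: eventually_mono)
    show "crd d (pt c (crd c (?\<gamma> 0))) = crd d (?\<gamma> 0)"
      using p cd by (simp add: act_texp_0 pt_crd)
  qed auto
  then have "((\<lambda>s. crd d (?\<gamma> s)) has_vector_derivative dmap id c d p *v fund act \<xi> c p) (at 0)"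
    by (simp add: has_vector_derivative_def matvec.scaleR_right)
  then show ?thesis using fund_derivative[of d p \<xi>] cd p vector_derivative_unique_at by blast
qed

end

section \<open>Admissible charts\<close>

lemma frechet_direction_zero:
  assumes f: "f differentiable (at x)" and "\<epsilon> > 0" and const: "\<And>s. \<bar>s\<bar> < \<epsilon> \<Longrightarrow> f (x + s *\<^sub>R v) = f x"
  shows "frechet_derivative f (at x) v = 0"
proof -
  have "((\<lambda>s. x + s *\<^sub>R v) has_derivative (\<lambda>h. h *\<^sub>R v)) (at 0)"
    by (auto intro!: derivative_eq_intros)
  moreover have "(f has_derivative frechet_derivative f (at x)) (at (x + 0 *\<^sub>R v))"
    using frechet_works[OF f] by simp
  ultimately have 1: "((\<lambda>s. f (x + s *\<^sub>R v)) has_derivative (\<lambda>h. frechet_derivative f (at x) (h *\<^sub>R v))) (at 0)"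
    by (rule has_derivative_compose)
  have "((\<lambda>s. f x) has_derivative (\<lambda>h. 0)) (at 0)" by (rule has_derivative_const)
  then have 2: "((\<lambda>s. f (x + s *\<^sub>R v)) has_derivative (\<lambda>h. 0)) (at 0)"
    by (rule has_derivative_transform_within_open[of _ _ _ _ "ball 0 \<epsilon>"]) (use assms in auto)
  show ?thesis using fun_cong[OF has_derivative_unique[OF 1 2], of 1] by simp
qed

locale toric_dgk =
  fixes A :: "('m::{second_countable_topology,t2_space}, 'n::finite+'n) chart set"
    and Om Jp J0 :: "('m, 'n+'n, real^('n+'n)^('n+'n)) field"
    and act :: "complex^'n \<Rightarrow> 'm \<Rightarrow> 'm"
    and e :: "'n \<Rightarrow> real^'n"
    and mu :: "'m \<Rightarrow> real^'n"
  assumes toric: "compact_toric A Om act e mu"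
    and Jp: "Jp \<in> DGK A Om act e mu"
    and J0: "almost_complex A (interior_part mu) J0"
    and J0_phi: "given_by_phi_s A act e mu Jp J0"
begin

sublocale toric_manifold A act
  using toric by unfold_locales (auto simp: compact_toric_def)

abbreviation "U \<equiv> interior_part mu"

text \<open>The formula for \<open>J0\<close> is granted only in some admissible chart around each
  point, so exactly those charts are singled out for the computations.\<close>

definition adapted :: "('m, 'n+'n) chart \<Rightarrow> bool" where
  "adapted d \<longleftrightarrow> admissible_chart A act e mu Jp d \<and>
    (\<forall>q \<in> cdom d. \<forall>k. J0 d q *v axis (Inr k) 1 = (\<Sum>j\<in>UNIV. phi_s (Jp d q) $ k $ j *\<^sub>R axis (Inl j) 1))"

lemma adapted_cover: "p \<in> U \<Longrightarrow> \<exists>d. adapted d \<and> p \<in> cdom d"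
  using J0_phi unfolding given_by_phi_s_def adapted_def by blast

lemma adaptedD:
  assumes "adapted d"
  shows adapted_in: "d \<in> A" and adapted_sub: "cdom d \<subseteq> U"
    and adapted_mu: "\<And>p j. p \<in> cdom d \<Longrightarrow> crd d p $ Inr j = mu p \<bullet> e j"
    and adapted_theta: "\<And>p j k. p \<in> cdom d \<Longrightarrow> fund act (e k) d p $ Inl j = (if j = k then 1 else 0)"
    and adapted_J: "\<And>p j k. p \<in> cdom d \<Longrightarrow> (Jp d p *v fund act (e k) d p) $ Inl j = 0"
  using assms by (simp_all add: adapted_def admissible_chart_def)

lemma open_U: "open U"
proof (subst open_subopen, rule ballI)
  fix p assume "p \<in> U"
  then obtain d where "adapted d" "p \<in> cdom d" using adapted_cover by blast
  then show "\<exists>T. open T \<and> p \<in> T \<and> T \<subseteq> U"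
    by (intro exI[of _ "cdom d"]) (simp add: adapted_in adapted_sub open_cdom)
qed

abbreviation "cimg c \<equiv> crd c ` (cdom c \<inter> U)"

lemma open_cimg: "c \<in> A \<Longrightarrow> open (cimg c)"
  by (rule open_crd_image[OF _ open_U])

lemma cimg_sub: "cimg c \<subseteq> crd c ` cdom c" by blast

lemma pt_cimg: "c \<in> A \<Longrightarrow> x \<in> cimg c \<Longrightarrow> pt c x \<in> cdom c \<inter> U \<and> crd c (pt c x) = x"
  by (erule imageE) (simp add: pt_crd)

lemma adapted_cimg: "adapted d \<Longrightarrow> cimg d = crd d ` cdom d"
  using adapted_sub by (simp add: Int_absorb2)

lemma GK: "Jp \<in> GK A Om act"
  using Jp by (simp add: DGK_def)

lemma Om_two_form: "two_form A UNIV Om"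
  using toric by (simp add: compact_toric_def symplectic_form_def)

lemma Om_skew: "c \<in> A \<Longrightarrow> p \<in> cdom c \<Longrightarrow> transpose (Om c p) = - Om c p"
  using Om_two_form unfolding two_form_def by blast

lemma Om_inv: "c \<in> A \<Longrightarrow> p \<in> cdom c \<Longrightarrow> invertible (Om c p)"
  using toric by (simp add: compact_toric_def symplectic_form_def)

lemma Om_transform:
  "c \<in> A \<Longrightarrow> d \<in> A \<Longrightarrow> p \<in> cdom c \<inter> cdom d \<Longrightarrow> Om c p = transpose (dmap id c d p) ** Om d p ** dmap id c d p"
  using Om_two_form unfolding two_form_def by blast

lemma Om_smooth:
  assumes "c \<in> A"
  shows "smooth_on (crd c ` cdom c) (\<lambda>x. Om c (pt c x))"
proof -
  have "smooth_field A UNIV Om" using Om_two_form unfolding two_form_def by blast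
  then show ?thesis using assms by (simp add: smooth_field_def)
qed

lemma Jp_complex: "complex_structure A UNIV Jp"
  and Jm_complex: "complex_structure A UNIV (\<lambda>c p. Jminus (Om c p) (Jp c p))"
  using GK by (simp_all add: GK_def)

lemma complex_structureD:
  assumes "complex_structure A N J"
  shows "almost_complex A N J"
    "\<And>c X Y x. c \<in> A \<Longrightarrow> smooth_on (crd c ` (cdom c \<inter> N)) X \<Longrightarrow> smooth_on (crd c ` (cdom c \<inter> N)) Y
      \<Longrightarrow> x \<in> crd c ` (cdom c \<inter> N) \<Longrightarrow> nijenhuis (\<lambda>x. J c (pt c x)) X Y x = 0"
  using assms unfolding complex_structure_def Let_def nijenhuis_def by blast+

lemma almost_complexD:
  assumes "almost_complex A N J"
  shows "\<And>c. c \<in> A \<Longrightarrow> smooth_on (crd c ` (cdom c \<inter> N)) (\<lambda>x. J c (pt c x))"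
    "\<And>c p. c \<in> A \<Longrightarrow> p \<in> cdom c \<inter> N \<Longrightarrow> J c p ** J c p = - mat 1"
    "\<And>c d p. c \<in> A \<Longrightarrow> d \<in> A \<Longrightarrow> p \<in> cdom c \<inter> cdom d \<inter> N \<Longrightarrow> J d p ** dmap id c d p = dmap id c d p ** J c p"
  using assms unfolding almost_complex_def endo_field_def smooth_field_def by blast+

lemmas Jp_ac = almost_complexD[OF complex_structureD(1)[OF Jp_complex], simplified Int_UNIV_right]
lemmas Jm_ac = almost_complexD[OF complex_structureD(1)[OF Jm_complex], simplified Int_UNIV_right]
lemmas J0_ac = almost_complexD[OF J0]

text \<open>The \<theta> components are prescribed by admissibility; the \<mu> components vanish
  because the moment map is constant on orbits.\<close>

lemma fund_adapted:
  assumes d: "adapted d" and p: "p \<in> cdom d"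
  shows "fund act (e k) d p = axis (Inl k) 1"
proof -
  have "fund act (e k) d p $ Inr j = 0" for j
  proof -
    let ?\<gamma> = "\<lambda>s. act (texp (s *\<^sub>R e k)) p"
    have "((\<lambda>s. crd d (?\<gamma> s) $ Inr j) has_derivative (\<lambda>h. (h *\<^sub>R fund act (e k) d p) $ Inr j)) (at 0)"
      by (rule bounded_linear.has_derivative[OF bounded_linear_vec_nth
            fund_derivative[OF adapted_in[OF d] p, unfolded has_vector_derivative_def]])
    moreover have "((\<lambda>s. crd d (?\<gamma> s) $ Inr j) has_derivative (\<lambda>h. 0)) (at 0)"
    proof (rule has_derivative_transform_eventually[OF has_derivative_const[of "mu p \<bullet> e j"]])
      have mu: "mu (?\<gamma> s) = mu p" for s
        using toric unfolding compact_toric_def moment_map_def by (simp add: texp_torus)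
      have "\<forall>\<^sub>F s in nhds 0. ?\<gamma> s \<in> cdom d"
        by (rule orbit_eventually) (use p adapted_in[OF d] open_cdom in auto)
      then show "\<forall>\<^sub>F s in at 0. mu p \<bullet> e j = crd d (?\<gamma> s) $ Inr j"
        by (auto simp: eventually_at_filter adapted_mu[OF d] mu elim: eventually_mono)
      show "mu p \<bullet> e j = crd d (?\<gamma> 0) $ Inr j"
        using p by (simp add: act_texp_0 adapted_mu[OF d])
    qed auto
    ultimately show ?thesis
      using fun_cong[OF has_derivative_unique, of "\<lambda>s. crd d (?\<gamma> s) $ Inr j" "\<lambda>h. (h *\<^sub>R fund act (e k) d p) $ Inr j" 0 "\<lambda>h. 0" 1]
      by simp
  qed
  then show ?thesis by (simp add: vec_eq_iff all_sum_iff adapted_theta[OF d p] axis_def)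
qed

lemma Om_adapted:
  assumes d: "adapted d" and p: "p \<in> cdom d"
  shows "Om d p *v axis (Inl j) 1 = - axis (Inr j) 1"
proof -
  have "(Om d p *v axis (Inl j) 1) \<bullet> v = (- axis (Inr j) 1) \<bullet> v" for v
  proof -
    have "((\<lambda>x. x $ Inr j) has_derivative (\<lambda>v. v $ Inr j)) (at (crd d p))"
      by (rule bounded_linear.has_derivative[OF bounded_linear_vec_nth has_derivative_ident])
    then have "((\<lambda>x. mu (pt d x) \<bullet> e j) has_derivative (\<lambda>v. v $ Inr j)) (at (crd d p))"
    proof (rule has_derivative_transform_within_open)
      show "x $ Inr j = mu (pt d x) \<bullet> e j" if "x \<in> crd d ` cdom d" for x
        using that by (auto simp: pt_crd adapted_in[OF d] adapted_mu[OF d])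
    qed (use p open_image[OF adapted_in[OF d]] in auto)
    then have "frechet_derivative (\<lambda>x. mu (pt d x) \<bullet> e j) (at (crd d p)) v = v $ Inr j"
      by (rule frechet_eqI)
    moreover have "(Om d p *v fund act (e j) d p) \<bullet> v = - frechet_derivative (\<lambda>x. mu (pt d x) \<bullet> e j) (at (crd d p)) v"
      using toric adapted_in[OF d] p unfolding compact_toric_def moment_map_def by blast
    ultimately show ?thesis by (simp add: fund_adapted[OF d p] inner_axis' inner_minus_left)
  qed
  then show ?thesis using vector_eq_ldot[of "Om d p *v axis (Inl j) 1" "- axis (Inr j) 1"]
    by (metis inner_commute)
qed

lemma adapted_normal_form:
  assumes d: "adapted d" and p: "p \<in> cdom d"
  obtains P Q S Si A' where "generalized_kahler_blocks P Q S Si A'"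
    "Om d p = block 0 (mat 1) (- mat 1) 0" "Jp d p = block 0 P Q 0" "J0 d p = block 0 S (- Si) 0"
    "Jminus (Om d p) (Jp d p) = block 0 (transpose P) (transpose Q) 0"
proof -
  have dA: "d \<in> A" using d by (rule adapted_in)
  have pU: "p \<in> U" using adapted_sub[OF d] p by blast
  have od: "orbit_distribution act e d p = span (range (\<lambda>j. axis (Inl j) 1))"
    by (simp add: orbit_distribution_def fund_adapted[OF d p])
  show thesis
  proof (rule tamed_normal_form[of "Om d p" "Jp d p"])
    show "(Jp d p *v axis (Inl k) 1) $ Inl j = 0" for j k
      using adapted_J[OF d p, of k j] by (simp add: fund_adapted[OF d p])
    show "(Om d p *v v) \<bullet> (Jp d p *v v) > 0" if "v \<noteq> 0" for v
      using GK dA p that unfolding GK_def by blast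
    show "(\<lambda>v. Jp d p *v v) ` span (range (\<lambda>j. axis (Inl j) 1))
        = (\<lambda>v. Jminus (Om d p) (Jp d p) *v v) ` span (range (\<lambda>j. axis (Inl j) 1))"
      using Jp dA p pU unfolding DGK_def od[symmetric] by blast
    show "Jp d p ** Jp d p = - mat 1" using Jp_ac(2) dA p by blast
  next
    fix P Q Si
    assume Om: "Om d p = block 0 (mat 1) (- mat 1) 0" and J: "Jp d p = block 0 P Q 0"
      and gk: "generalized_kahler_blocks P Q ((1/2) *\<^sub>R (P + transpose P)) Si ((1/2) *\<^sub>R (P - transpose P))"
    have "J0 d p = block 0 ((1/2) *\<^sub>R (P + transpose P)) (- Si) 0"
    proof (rule phi_s_complex_structure[OF J])
      show "J0 d p ** J0 d p = - mat 1" using J0_ac(2) dA p pU by blast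
      show "J0 d p *v axis (Inr k) 1 = (\<Sum>j\<in>UNIV. phi_s (Jp d p) $ k $ j *\<^sub>R axis (Inl j) 1)" for k
        using d p by (simp add: adapted_def)
    qed (use generalized_kahler_blocks.SSi[OF gk] in auto)
    moreover have "Jminus (Om d p) (Jp d p) = block 0 (transpose P) (transpose Q) 0"
      unfolding Om J by (rule generalized_kahler_blocks.Jminus_eq[OF gk])
    ultimately show thesis using that[OF gk] Om J by blast
  qed (simp_all add: Om_adapted d p Om_skew Om_inv dA)
qed

text \<open>As \<open>X_j\<close> is a coordinate field, its flow is a translation. The bound
  \<epsilon> is uniform over the neighbourhood \<open>T\<close>, because the differential of the
  action in \<open>x\<close> is taken next.\<close>

lemma flow_translation:
  assumes d: "adapted d" and x0: "x0 \<in> crd d ` cdom d"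
  obtains \<epsilon> T where "\<epsilon> > 0" "open T" "x0 \<in> T" "T \<subseteq> crd d ` cdom d"
    "\<And>s x. \<bar>s\<bar> < \<epsilon> \<Longrightarrow> x \<in> T \<Longrightarrow> act (texp (s *\<^sub>R e j)) (pt d x) \<in> cdom d"
    "\<And>s x. \<bar>s\<bar> < \<epsilon> \<Longrightarrow> x \<in> T \<Longrightarrow> crd d (act (texp (s *\<^sub>R e j)) (pt d x)) = x + s *\<^sub>R axis (Inl j) 1"
proof -
  have dA: "d \<in> A" using d by (rule adapted_in)
  have "continuous_on UNIV (\<lambda>q :: real \<times> _. (fst q *\<^sub>R e j, snd q))"
    by (intro continuous_on_Pair continuous_on_scaleR continuous_on_const continuous_on_fst continuous_on_snd continuous_on_id)
  then have "open ((\<lambda>q :: real \<times> _. (fst q *\<^sub>R e j, snd q)) -` flow_dom d)"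
    using open_flow_dom[OF dA] by (rule open_vimage[rotated])
  moreover have "(0, x0) \<in> (\<lambda>q :: real \<times> _. (fst q *\<^sub>R e j, snd q)) -` flow_dom d"
    using x0 dA by (simp add: zero_in_flow_dom)
  ultimately obtain N T where N: "open N" "(0::real) \<in> N" and T: "open T" "x0 \<in> T"
    and NT: "N \<times> T \<subseteq> (\<lambda>q. (fst q *\<^sub>R e j, snd q)) -` flow_dom d"
    by (auto elim!: open_prod_elim)
  obtain \<epsilon> where \<epsilon>: "\<epsilon> > 0" "ball 0 \<epsilon> \<subseteq> N" using N by (auto simp: open_contains_ball)
  have dom: "act (texp (s *\<^sub>R e j)) (pt d x) \<in> cdom d" "x \<in> crd d ` cdom d" if "\<bar>s\<bar> < \<epsilon>" "x \<in> T" for s x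
  proof -
    have "s \<in> N" using \<epsilon> that by (auto simp: subset_eq)
    then have "(s, x) \<in> N \<times> T" using that by simp
    then have "(s, x) \<in> (\<lambda>q. (fst q *\<^sub>R e j, snd q)) -` flow_dom d" using NT by blast
    then show "act (texp (s *\<^sub>R e j)) (pt d x) \<in> cdom d" "x \<in> crd d ` cdom d" by (auto simp: flow_dom_def)
  qed
  have "crd d (act (texp (s *\<^sub>R e j)) (pt d x)) = x + s *\<^sub>R axis (Inl j) 1" if s: "\<bar>s\<bar> < \<epsilon>" and x: "x \<in> T" for s x
  proof -
    let ?g = "\<lambda>s. crd d (act (texp (s *\<^sub>R e j)) (pt d x)) - s *\<^sub>R axis (Inl j) 1"
    have "?g s = ?g 0"
    proof (rule has_derivative_zero_unique[where s = "ball 0 \<epsilon>" and f = ?g and x = s and y = 0])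
      fix r :: real assume "r \<in> ball 0 \<epsilon>"
      then have r: "act (texp (r *\<^sub>R e j)) (pt d x) \<in> cdom d" using dom x by simp
      \<comment> \<open>The fundamental field is a derivative at parameter 0 only. The group law
        moves this to parameter \<open>r\<close>, with the point already transported by
        \<open>r\<close>.\<close>
      have "((\<lambda>s. s - r) has_derivative (\<lambda>h. h)) (at r)"
        by (auto intro!: derivative_eq_intros)
      moreover have "((\<lambda>s. crd d (act (texp (s *\<^sub>R e j)) (act (texp (r *\<^sub>R e j)) (pt d x)))) has_derivative (\<lambda>h. h *\<^sub>R axis (Inl j) 1)) (at (r - r))"
        using fund_derivative[OF dA r, of "e j"] by (simp add: has_vector_derivative_def fund_adapted[OF d r])
      ultimately have "((\<lambda>s. crd d (act (texp ((s - r) *\<^sub>R e j)) (act (texp (r *\<^sub>R e j)) (pt d x)))) has_derivative (\<lambda>h. h *\<^sub>R axis (Inl j) 1)) (at r)"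
        by (rule has_derivative_compose)
      then have "((\<lambda>s. crd d (act (texp (s *\<^sub>R e j)) (pt d x))) has_derivative (\<lambda>h. h *\<^sub>R axis (Inl j) 1)) (at r)"
        by (simp add: act_texp_add[symmetric] scaleR_add_left[symmetric])
      moreover have "((\<lambda>s. s *\<^sub>R axis (Inl j) 1) has_derivative (\<lambda>h. h *\<^sub>R (axis (Inl j) 1 :: real^('n+'n)))) (at r)"
        by (intro has_derivative_scaleR_left has_derivative_ident)
      ultimately have "(?g has_derivative (\<lambda>h. h *\<^sub>R axis (Inl j) 1 - h *\<^sub>R axis (Inl j) 1)) (at r)"
        by (rule has_derivative_diff)
      then show "(?g has_derivative (\<lambda>h. 0)) (at r within ball 0 \<epsilon>)"
        by (simp add: has_derivative_at_withinI)
    qed (use s \<epsilon> in auto)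
    moreover have "crd d (act (texp (0 *\<^sub>R e j)) (pt d x)) = x"
      using dom(2)[OF s x] by (simp add: act_texp_0 crd_pt dA)
    ultimately show ?thesis by (simp add: algebra_simps)
  qed
  moreover have "T \<subseteq> crd d ` cdom d" using dom(2)[of 0] \<epsilon> by auto
  ultimately show thesis using that[OF \<epsilon>(1) T] dom(1) by blast
qed

text \<open>A translation has the identity as its differential, so invariance of \<open>J_+\<close>
  becomes constancy of its matrix along the \<theta> directions.\<close>

lemma Jp_translation:
  assumes d: "adapted d" and x0: "x0 \<in> crd d ` cdom d"
  obtains \<epsilon> where "\<epsilon> > 0"
    "\<And>s. \<bar>s\<bar> < \<epsilon> \<Longrightarrow> x0 + s *\<^sub>R axis (Inl j) 1 \<in> crd d ` cdom d \<and> Jp d (pt d (x0 + s *\<^sub>R axis (Inl j) 1)) = Jp d (pt d x0)"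
proof -
  have dA: "d \<in> A" using d by (rule adapted_in)
  obtain \<epsilon> T where \<epsilon>: "\<epsilon> > 0" and T: "open T" "x0 \<in> T" "T \<subseteq> crd d ` cdom d"
    and dom: "\<And>s x. \<bar>s\<bar> < \<epsilon> \<Longrightarrow> x \<in> T \<Longrightarrow> act (texp (s *\<^sub>R e j)) (pt d x) \<in> cdom d"
    and tr: "\<And>s x. \<bar>s\<bar> < \<epsilon> \<Longrightarrow> x \<in> T \<Longrightarrow> crd d (act (texp (s *\<^sub>R e j)) (pt d x)) = x + s *\<^sub>R axis (Inl j) 1"
    using flow_translation[OF d x0] by metis
  have "x0 + s *\<^sub>R axis (Inl j) 1 \<in> crd d ` cdom d \<and> Jp d (pt d (x0 + s *\<^sub>R axis (Inl j) 1)) = Jp d (pt d x0)"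
    if s: "\<bar>s\<bar> < \<epsilon>" for s
  proof
    let ?z = "texp (s *\<^sub>R e j)" and ?p = "pt d x0"
    have q: "pt d (x0 + s *\<^sub>R axis (Inl j) 1) = act ?z ?p"
      using tr[OF s T(2)] dom[OF s T(2)] pt_crd[OF dA] by metis
    show "x0 + s *\<^sub>R axis (Inl j) 1 \<in> crd d ` cdom d"
      using tr[OF s T(2)] dom[OF s T(2)] by (metis imageI)
    have p: "?p \<in> cdom d" "crd d ?p = x0" using x0 pt_in[OF dA] crd_pt[OF dA] by auto
    have "((\<lambda>x. x + s *\<^sub>R axis (Inl j) 1) has_derivative (\<lambda>v. v)) (at x0)"
      by (auto intro!: derivative_eq_intros)
    then have "((\<lambda>x. crd d (act ?z (pt d x))) has_derivative (\<lambda>v. v)) (at x0)"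
      by (rule has_derivative_transform_within_open[OF _ T(1,2)]) (simp add: tr[OF s])
    from frechet_derivative_at[OF this]
    have "frechet_derivative (\<lambda>x. crd d (act ?z (pt d x))) (at x0) = id" by (simp add: id_def)
    then have "dmap (act ?z) d d ?p = mat 1"
      by (simp add: dmap_def jacobian_def p matrix_id_mat_1)
    moreover have "Jp d (act ?z ?p) ** dmap (act ?z) d d ?p = dmap (act ?z) d d ?p ** Jp d ?p"
      using GK dA p(1) dom[OF s T(2)] texp_torus unfolding GK_def invariant_endo_def by blast
    ultimately show "Jp d (pt d (x0 + s *\<^sub>R axis (Inl j) 1)) = Jp d ?p" by (simp add: q)
  qed
  then show thesis using that \<epsilon> by blast
qed

text \<open>Invariance of \<open>J0\<close> under the torus is not among the assumptions. It is
  recovered because in an adapted chart the matrix of \<open>J0\<close> is a function of that of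
  \<open>J_+\<close>.\<close>

lemma J0_determined:
  assumes d: "adapted d" and p: "p \<in> cdom d" "q \<in> cdom d" and eq: "Jp d p = Jp d q"
  shows "J0 d p = J0 d q"
proof -
  obtain P Q S Si A' where 1: "generalized_kahler_blocks P Q S Si A'"
    "Jp d p = block 0 P Q 0" "J0 d p = block 0 S (- Si) 0"
    using adapted_normal_form[OF d p(1)] by metis
  obtain P' Q' S' Si' A'' where 2: "generalized_kahler_blocks P' Q' S' Si' A''"
    "Jp d q = block 0 P' Q' 0" "J0 d q = block 0 S' (- Si') 0"
    using adapted_normal_form[OF d p(2)] by metis
  have "P = P'" using eq by (simp add: 1 2 block_eq_iff)
  then have S: "S = S'"
    using 1(1) 2(1) by (simp add: generalized_kahler_blocks_def)
  have "Si = Si'"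
    using matrix_inv_eqI[OF generalized_kahler_blocks.SSi[OF 1(1)]]
      matrix_inv_eqI[OF generalized_kahler_blocks.SSi[OF 2(1)]] by (simp add: S)
  then show ?thesis by (simp add: 1 2 S)
qed

text \<open>Covers \<open>J_+\<close>, \<open>J_-\<close> and \<open>J_0\<close> at once: each is
  determined by the matrix of \<open>J_+\<close>, which is constant along orbits.\<close>

lemma Inl_translation_derivative:
  assumes d: "adapted d" and x: "x \<in> crd d ` cdom d" and K: "K differentiable (at x)"
    and det: "\<And>y. y \<in> crd d ` cdom d \<Longrightarrow> Jp d (pt d y) = Jp d (pt d x) \<Longrightarrow> K y = K x"
    and t: "\<And>i. t $ Inr i = 0"
  shows "frechet_derivative K (at x) t = 0"
proof -
  have 0: "frechet_derivative K (at x) (axis (Inl j) 1) = 0" for j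
  proof -
    obtain \<epsilon> where "\<epsilon> > 0" "\<And>s. \<bar>s\<bar> < \<epsilon> \<Longrightarrow> x + s *\<^sub>R axis (Inl j) 1 \<in> crd d ` cdom d \<and> Jp d (pt d (x + s *\<^sub>R axis (Inl j) 1)) = Jp d (pt d x)"
      using Jp_translation[OF d x] by blast
    then show ?thesis by (intro frechet_direction_zero[OF K]) (auto intro: det)
  qed
  have "t = (\<Sum>a\<in>UNIV. t $ Inl a *\<^sub>R axis (Inl a) 1)"
    by (simp add: vec_eq_iff all_sum_iff t axis_def if_distrib cong: if_cong)
  then have "frechet_derivative K (at x) t = (\<Sum>a\<in>UNIV. t $ Inl a *\<^sub>R frechet_derivative K (at x) (axis (Inl a) 1))"
    using linear_sum[OF frechet_linear[OF K], of "\<lambda>a. t $ Inl a *\<^sub>R axis (Inl a) 1" UNIV] linear_scale[OF frechet_linear[OF K]]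
    by simp
  then show ?thesis by (simp add: 0)
qed

section \<open>Integrability in one adapted chart\<close>

context
  fixes d assumes d: "adapted d"
begin

abbreviation "Kp \<equiv> \<lambda>x. Jp d (pt d x)"
abbreviation "Km \<equiv> \<lambda>x. Jminus (Om d (pt d x)) (Jp d (pt d x))"
abbreviation "K0 \<equiv> \<lambda>x. J0 d (pt d x)"
abbreviation "W \<equiv> crd d ` cdom d"

lemma dA: "d \<in> A" using d by (rule adapted_in)
lemma open_W: "open W" by (rule open_image[OF dA])
lemma ptW: "x \<in> W \<Longrightarrow> pt d x \<in> cdom d" by (rule pt_in[OF dA])
lemma ptW_U: "x \<in> W \<Longrightarrow> pt d x \<in> cdom d \<inter> U" using ptW adapted_sub[OF d] by blast

lemma K_differentiable: "x \<in> W \<Longrightarrow> Kp differentiable (at x)" "x \<in> W \<Longrightarrow> Km differentiable (at x)"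
  "x \<in> W \<Longrightarrow> K0 differentiable (at x)"
  using smooth_on_differentiable[OF Jp_ac(1)[OF dA]] smooth_on_differentiable[OF Jm_ac(1)[OF dA]]
    smooth_on_differentiable[OF J0_ac(1)[OF dA]] adapted_cimg[OF d] by auto

lemma K_square: "x \<in> W \<Longrightarrow> Kp x ** Kp x = - mat 1" "x \<in> W \<Longrightarrow> Km x ** Km x = - mat 1"
  "x \<in> W \<Longrightarrow> K0 x ** K0 x = - mat 1"
  using Jp_ac(2)[OF dA ptW] Jm_ac(2)[OF dA ptW] J0_ac(2)[OF dA ptW_U] by auto

lemma K_nijenhuis: "x \<in> W \<Longrightarrow> nijenhuis Kp (\<lambda>y. u) (\<lambda>y. v) x = 0" "x \<in> W \<Longrightarrow> nijenhuis Km (\<lambda>y. u) (\<lambda>y. v) x = 0"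
  using complex_structureD(2)[OF Jp_complex dA] complex_structureD(2)[OF Jm_complex dA]
  by (simp_all add: smooth_on_const)

lemma K_entries:
  assumes x: "x \<in> W"
  shows "Km x $ Inl i $ Inr j = Kp x $ Inl j $ Inr i"
    "K0 x $ Inl i $ Inr j = (Kp x $ Inl i $ Inr j + Kp x $ Inl j $ Inr i) / 2" "K0 x $ Inr i $ Inr j = 0"
proof -
  obtain P Q S Si A' where 1: "generalized_kahler_blocks P Q S Si A'"
    "Jp d (pt d x) = block 0 P Q 0" "J0 d (pt d x) = block 0 S (- Si) 0"
    "Jminus (Om d (pt d x)) (Jp d (pt d x)) = block 0 (transpose P) (transpose Q) 0"
    using adapted_normal_form[OF d ptW[OF x]] by metis
  have S: "S = (1/2) *\<^sub>R (P + transpose P)" using 1(1) by (simp add: generalized_kahler_blocks_def)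
  show "Km x $ Inl i $ Inr j = Kp x $ Inl j $ Inr i"
    unfolding 1(4) unfolding 1(2) by (simp add: transpose_def)
  show "K0 x $ Inl i $ Inr j = (Kp x $ Inl i $ Inr j + Kp x $ Inl j $ Inr i) / 2" "K0 x $ Inr i $ Inr j = 0"
    by (simp_all add: 1 S transpose_def)
qed

lemma K_blocks:
  assumes x: "x \<in> W"
  obtains P Q S Si where "Kp x = block 0 P Q 0" "Km x = block 0 (transpose P) (transpose Q) 0" "K0 x = block 0 S (- Si) 0"
  using adapted_normal_form[OF d ptW[OF x]] by metis

lemma K_invariant:
  assumes x: "x \<in> W" and t: "\<And>i. t $ Inr i = 0"
  shows "frechet_derivative Kp (at x) t = 0" "frechet_derivative Km (at x) t = 0" "frechet_derivative K0 (at x) t = 0"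
proof -
  have Om: "Om d (pt d y) = block 0 (mat 1) (- mat 1) 0" if "y \<in> W" for y
    using adapted_normal_form[OF d ptW[OF that]] by metis
  show "frechet_derivative Kp (at x) t = 0"
    by (rule Inl_translation_derivative[OF d x K_differentiable(1)[OF x] _ t])
  show "frechet_derivative Km (at x) t = 0"
    by (rule Inl_translation_derivative[OF d x K_differentiable(2)[OF x] _ t]) (simp add: Om x)
  show "frechet_derivative K0 (at x) t = 0"
    by (rule Inl_translation_derivative[OF d x K_differentiable(3)[OF x] _ t])
      (rule J0_determined[OF d ptW ptW[OF x]])
qed

text \<open>The derivative of the entry \<open>P_ib\<close> with respect to
  \<open>mu_a\<close>.\<close>

abbreviation "T x a i b \<equiv> frechet_derivative Kp (at x) (axis (Inr a) 1) $ Inl i $ Inr b"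

lemma Km_derivative:
  assumes x: "x \<in> W"
  shows "frechet_derivative Km (at x) v $ Inl i $ Inr j = frechet_derivative Kp (at x) v $ Inl j $ Inr i"
proof -
  have "((\<lambda>y. Km y $ Inl i $ Inr j) has_derivative (\<lambda>v. frechet_derivative Kp (at x) v $ Inl j $ Inr i)) (at x)"
    by (rule has_derivative_transform_within_open[OF frechet_matrix_nth[OF K_differentiable(1)[OF x]] open_W x])
      (simp add: K_entries)
  from fun_cong[OF has_derivative_unique[OF this frechet_matrix_nth[OF K_differentiable(2)[OF x]]], of v]
  show ?thesis by simp
qed

lemma K0_derivative:
  assumes x: "x \<in> W"
  shows "frechet_derivative K0 (at x) v $ Inl i $ Inr j
      = (frechet_derivative Kp (at x) v $ Inl i $ Inr j + frechet_derivative Kp (at x) v $ Inl j $ Inr i) / 2"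
    "frechet_derivative K0 (at x) v $ Inr i $ Inr j = 0"
proof -
  let ?D = "frechet_derivative Kp (at x)"
  have "((\<lambda>y. (Kp y $ Inl i $ Inr j + Kp y $ Inl j $ Inr i) / 2) has_derivative (\<lambda>v. (?D v $ Inl i $ Inr j + ?D v $ Inl j $ Inr i) / 2)) (at x)"
    by (intro bounded_linear.has_derivative[OF bounded_linear_divide] has_derivative_add
        frechet_matrix_nth[OF K_differentiable(1)[OF x]])
  then have "((\<lambda>y. K0 y $ Inl i $ Inr j) has_derivative (\<lambda>v. (?D v $ Inl i $ Inr j + ?D v $ Inl j $ Inr i) / 2)) (at x)"
    by (rule has_derivative_transform_within_open[OF _ open_W x]) (simp add: K_entries)
  from fun_cong[OF has_derivative_unique[OF this frechet_matrix_nth[OF K_differentiable(3)[OF x]]], of v]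
  show "frechet_derivative K0 (at x) v $ Inl i $ Inr j = (?D v $ Inl i $ Inr j + ?D v $ Inl j $ Inr i) / 2" by simp
  have "((\<lambda>y. K0 y $ Inr i $ Inr j) has_derivative (\<lambda>v. 0)) (at x)"
    by (rule has_derivative_transform_within_open[OF has_derivative_const[of 0] open_W x]) (simp add: K_entries)
  from fun_cong[OF has_derivative_unique[OF this frechet_matrix_nth[OF K_differentiable(3)[OF x]]], of v]
  show "frechet_derivative K0 (at x) v $ Inr i $ Inr j = 0" by simp
qed

text \<open>Integrability exchanges the differentiation index with the column index. For
  \<open>J_-\<close> the block is the transpose of \<open>P\<close>, so there the column index is
  the row index of \<open>P\<close>.\<close>

lemma T_symmetric:
  assumes x: "x \<in> W"
  shows "T x a i b = T x b i a" "T x a i b = T x i a b"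
proof -
  obtain P Q S Si where b: "Kp x = block 0 P Q 0" "Km x = block 0 (transpose P) (transpose Q) 0" "K0 x = block 0 S (- Si) 0"
    by (rule K_blocks[OF x])
  have "frechet_derivative Kp (at x) (axis (Inr a) 1) *v axis (Inr b) 1
      = frechet_derivative Kp (at x) (axis (Inr b) 1) *v axis (Inr a) 1"
    by (rule nijenhuis_symmetric[OF open_W x K_differentiable(1)[OF x] K_square(1) K_invariant(1)[OF x] K_nijenhuis(1)[OF x] b(1)])
      (auto simp: axis_def)
  from arg_cong[OF this, of "\<lambda>v. v $ Inl i"] show "T x a i b = T x b i a"
    by (simp only: matrix_vector_axis)
  have "frechet_derivative Km (at x) (axis (Inr a) 1) *v axis (Inr i) 1
      = frechet_derivative Km (at x) (axis (Inr i) 1) *v axis (Inr a) 1"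
    by (rule nijenhuis_symmetric[OF open_W x K_differentiable(2)[OF x] K_square(2) K_invariant(2)[OF x] K_nijenhuis(2)[OF x] b(2)])
      (auto simp: axis_def)
  from arg_cong[OF this, of "\<lambda>v. v $ Inl b"] show "T x a i b = T x i a b"
    by (simp only: matrix_vector_axis Km_derivative[OF x])
qed

lemma T_swap: "x \<in> W \<Longrightarrow> T x a i b = T x a b i"
  using T_symmetric[of x] by metis

text \<open>A direction splits into a \<theta> part, along which \<open>J_+\<close> is constant, and
  a \<mu> part, along which \<open>T_swap\<close> makes the derivative of \<open>P\<close>
  symmetric.\<close>

lemma skew_part_derivative:
  assumes x: "x \<in> W"
  shows "((\<lambda>y. Kp y $ Inl i $ Inr j - Kp y $ Inl j $ Inr i) has_derivative (\<lambda>v. 0)) (at x)"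
proof -
  let ?D = "frechet_derivative Kp (at x)"
  note lin = frechet_linear[OF K_differentiable(1)[OF x]]
  have "?D v $ Inl i $ Inr j = ?D v $ Inl j $ Inr i" for v
  proof -
    define t m :: "real^('n+'n)" where "t = (\<chi> k. case k of Inl a \<Rightarrow> v $ Inl a | Inr a \<Rightarrow> 0)"
      and "m = (\<chi> k. case k of Inl a \<Rightarrow> 0 | Inr a \<Rightarrow> v $ Inr a)"
    have v: "v = t + m" by (simp add: vec_eq_iff all_sum_iff t_def m_def)
    have "?D t = 0" by (rule K_invariant(1)[OF x]) (simp add: t_def)
    then have "?D v = ?D m" using linear_add[OF lin, of t m] by (simp flip: v)
    also have "\<dots> = (\<Sum>a\<in>UNIV. m $ Inr a *\<^sub>R ?D (axis (Inr a) 1))"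
      by (subst axis_sum_Inr[of m]) (simp_all add: m_def linear_sum[OF lin] linear_scale[OF lin])
    finally show ?thesis by (simp add: T_swap[OF x, of _ i j])
  qed
  then have "(\<lambda>v. ?D v $ Inl i $ Inr j - ?D v $ Inl j $ Inr i) = (\<lambda>v. 0)" by simp
  then show ?thesis
    using has_derivative_diff[OF frechet_matrix_nth[OF K_differentiable(1)[OF x], of "Inl i" "Inr j"]
        frechet_matrix_nth[OF K_differentiable(1)[OF x], of "Inl j" "Inr i"]] by simp
qed

lemma adapted_commuting:
  assumes x: "x \<in> W"
  shows "lie_bracket (\<lambda>y. axis (Inl i) 1) (\<lambda>y. axis (Inl j) 1) x = 0"
    "lie_bracket (\<lambda>y. axis (Inl i) 1) (\<lambda>y. K0 y *v axis (Inl j) 1) x = 0"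
    "lie_bracket (\<lambda>y. K0 y *v axis (Inl i) 1) (\<lambda>y. K0 y *v axis (Inl j) 1) x = 0"
proof -
  obtain P Q S Si where b: "Kp x = block 0 P Q 0" "Km x = block 0 (transpose P) (transpose Q) 0" "K0 x = block 0 S (- Si) 0"
    by (rule K_blocks[OF x])
  \<comment> \<open>The derivative of \<open>S\<close> is the average of two values of
    \<open>T\<close>; exchanging \<open>a\<close> and \<open>b\<close> fixes each of them.\<close>
  have sym: "frechet_derivative K0 (at x) (axis (Inr a) 1) *v axis (Inr b) 1
      = frechet_derivative K0 (at x) (axis (Inr b) 1) *v axis (Inr a) 1" for a b
  proof -
    have "T x a i b = T x b i a" "T x a b i = T x b a i" for i
      using T_symmetric[OF x] by metis+
    then show ?thesis
      by (simp add: vec_eq_iff all_sum_iff matrix_vector_axis K0_derivative[OF x])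
  qed
  note fr = commuting_frame[OF open_W x K_differentiable(3)[OF x] K_square(3) K_invariant(3)[OF x] sym b(3),
      of "axis (Inl i) 1" "axis (Inl j) 1"]
  show "lie_bracket (\<lambda>y. axis (Inl i) 1) (\<lambda>y. axis (Inl j) 1) x = 0"
    "lie_bracket (\<lambda>y. axis (Inl i) 1) (\<lambda>y. K0 y *v axis (Inl j) 1) x = 0"
    "lie_bracket (\<lambda>y. K0 y *v axis (Inl i) 1) (\<lambda>y. K0 y *v axis (Inl j) 1) x = 0"
    by (rule fr; simp add: axis_def)+
qed

end

end

section \<open>The Poisson structure and the gauge form\<close>

lemma skew_iff:
  fixes M :: "'a::real_normed_vector^'k::finite^'k"
  shows "transpose M = - M \<longleftrightarrow> (\<forall>i j. M $ i $ j = - M $ j $ i)"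
proof
  assume skew: "transpose M = - M"
  have "M $ i $ j = - M $ j $ i" for i j
    using arg_cong[OF skew, of "\<lambda>X. X $ j $ i"] by (simp add: transpose_def)
  then show "\<forall>i j. M $ i $ j = - M $ j $ i" by blast
next
  assume a: "\<forall>i j. M $ i $ j = - M $ j $ i"
  have "transpose M $ i $ j = (- M) $ i $ j" for i j
    using a[rule_format, of j i] by (simp add: transpose_def)
  then show "transpose M = - M" by (simp only: vec_eq_iff) blast
qed

lemmas skew_nth = skew_iff[THEN iffD1, rule_format]

lemma sandwich_nth:
  fixes X Y :: "real^'n::finite^'k::finite"
  shows "(X ** A ** transpose Y) $ i $ j = (\<Sum>p\<in>UNIV. A $ fst p $ snd p * (X $ i $ fst p * Y $ j $ snd p))"
proof -
  have "(X ** A ** transpose Y) $ i $ j = (\<Sum>b\<in>UNIV. \<Sum>a\<in>UNIV. A $ a $ b * (X $ i $ a * Y $ j $ b))"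
    by (simp add: matrix_matrix_mult_def transpose_def sum_distrib_left sum_distrib_right mult_ac)
  also have "\<dots> = (\<Sum>a\<in>UNIV. \<Sum>b\<in>UNIV. A $ a $ b * (X $ i $ a * Y $ j $ b))"
    by (rule sum.swap)
  finally show ?thesis by (simp add: sum.cartesian_product case_prod_unfold UNIV_Times_UNIV)
qed

lemma cmat_conj_combination:
  fixes X Y :: "real^'k::finite^'k"
  shows "cmat D ** (\<chi> i j. k * (complex_of_real (X $ i $ j) + \<i> * complex_of_real (Y $ i $ j))) ** transpose (cmat D)
    = (\<chi> i j. k * (complex_of_real ((D ** X ** transpose D) $ i $ j) + \<i> * complex_of_real ((D ** Y ** transpose D) $ i $ j)))"
  by (simp add: vec_eq_iff matrix_matrix_mult_def transpose_def cmat_def sum_distrib_left sum_distrib_right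
      sum.distrib[symmetric] algebra_simps)

lemma cmat_mult_combination:
  fixes X Y :: "real^'k::finite^'k"
  shows "cmat D ** (\<chi> i j. k * (complex_of_real (X $ i $ j) + \<i> * complex_of_real (Y $ i $ j)))
    = (\<chi> i j. k * (complex_of_real ((D ** X) $ i $ j) + \<i> * complex_of_real ((D ** Y) $ i $ j)))"
  by (simp add: vec_eq_iff matrix_matrix_mult_def cmat_def sum_distrib_left
      sum.distrib[symmetric] algebra_simps)

context toric_dgk
begin

definition "orbit_frame c p = (\<chi> i j. fund act (e j) c p $ i)"
text \<open>Since \<open>\<Omega> X\<^sub>j = - d\<mu>\<^sub>j\<close>, the entries of \<open>dmu_J\<close> are \<open>d\<mu>\<^sub>i(J\<^sub>+ X\<^sub>j)\<close>. In an admissible chart it is the block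
  \<open>Q = - P\<^sup>-\<^sup>1\<close>, so that \<open>skew_part\<close> is a chart-independent expression for \<open>(P - P\<^sup>T)/2\<close>.\<close>

definition "dmu_J c p = - transpose (Om c p ** orbit_frame c p) ** Jp c p ** orbit_frame c p"
definition "skew_part c p = (1/2) *\<^sub>R (transpose (matrix_inv (dmu_J c p)) - matrix_inv (dmu_J c p))"
text \<open>Its columns are the 1-forms \<open>- J_+^* d mu_j\<close>, so \<open>gauge_form\<close>
  is a combination of products of these forms with locally constant coefficients.\<close>

definition "J_coframe c p = transpose (Jp c p) ** Om c p ** orbit_frame c p"
definition "gauge_form c p = - (J_coframe c p ** skew_part c p ** transpose (J_coframe c p))"

lemma orbit_frame_transform:
  "c \<in> A \<Longrightarrow> d \<in> A \<Longrightarrow> p \<in> cdom c \<inter> cdom d \<Longrightarrow> orbit_frame d p = dmap id c d p ** orbit_frame c p"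
  by (simp add: orbit_frame_def vec_eq_iff fund_transform[of c d p] matrix_matrix_mult_def matrix_vector_mult_def)

lemma orbit_frame_adapted: "adapted d \<Longrightarrow> p \<in> cdom d \<Longrightarrow> orbit_frame d p = stack (mat 1) 0"
  by (simp add: orbit_frame_def vec_eq_iff all_sum_iff fund_adapted axis_def mat_def)

lemma frame_data:
  assumes c: "c \<in> A" and d: "adapted d" and p: "p \<in> cdom c \<inter> cdom d"
  obtains P Q S Si A' where "generalized_kahler_blocks P Q S Si A'" "Jp d p = block 0 P Q 0"
    "Om c p = transpose (dmap id c d p) ** block 0 (mat 1) (- mat 1) 0 ** dmap id c d p"
    "Jp c p = dmap id d c p ** block 0 P Q 0 ** dmap id c d p"
    "J0 c p = dmap id d c p ** block 0 S (- Si) 0 ** dmap id c d p"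
    "orbit_frame c p = dmap id d c p ** stack (mat 1) 0"
proof -
  have dA: "d \<in> A" using d by (rule adapted_in)
  have pU: "p \<in> U" using p adapted_sub[OF d] by blast
  have inv: "dmap id d c p ** dmap id c d p = mat 1" by (rule dmap_inverse[OF c dA p])
  obtain P Q S Si A' where N: "generalized_kahler_blocks P Q S Si A'"
    "Om d p = block 0 (mat 1) (- mat 1) 0" "Jp d p = block 0 P Q 0" "J0 d p = block 0 S (- Si) 0"
    using p by (elim IntE) (rule adapted_normal_form[OF d])
  have "dmap id d c p ** (Jp d p ** dmap id c d p) = Jp c p"
    using Jp_ac(3)[OF c dA p] by (simp add: matrix_cancel inv)
  moreover have "dmap id d c p ** (J0 d p ** dmap id c d p) = J0 c p"
    using J0_ac(3)[OF c dA, of p] p pU by (simp add: matrix_cancel inv)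
  moreover have "orbit_frame c p = dmap id d c p ** stack (mat 1) 0"
    using orbit_frame_transform[OF dA c, of p] orbit_frame_adapted[OF d, of p] p by (simp add: Int_commute)
  moreover note Om_transform[OF c dA p]
  ultimately show thesis
    using that[OF N(1,3)] N by (simp add: matrix_mul_assoc)
qed

text \<open>Each conclusion avoids adapted coordinates, except \<open>skew_part_adapted\<close>,
  which links the two descriptions. An adapted chart around \<open>p\<close> is used inside the
  proof to read the data off the block form.\<close>

lemma
  assumes c: "c \<in> A" and p: "p \<in> cdom c \<inter> U"
  shows skew_part_skew: "transpose (skew_part c p) = - skew_part c p"
    and beta1_frame: "beta1 (Om c p) (Jp c p) = frame_bivector (orbit_frame c p) (skew_part c p) (J0 c p ** orbit_frame c p)"
    and frame_span: "\<exists>a b. v = orbit_frame c p *v a + (J0 c p ** orbit_frame c p) *v b"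
    and gcs1_frame: "(\<And>i j. Im (beta $ i $ j) = - (1/4) * beta1 (Om c p) (Jp c p) $ i $ j) \<Longrightarrow>
       gcs1 (Om c p) (Jp c p) = exp_form (- gauge_form c p) ** gcs_poisson (J0 c p) beta ** exp_form (gauge_form c p)"
    and skew_part_adapted: "\<And>d. adapted d \<Longrightarrow> p \<in> cdom d \<Longrightarrow> skew_part c p $ i $ j = (Jp d p $ Inl i $ Inr j - Jp d p $ Inl j $ Inr i) / 2"
proof -
  have main: "transpose (skew_part c p) = - skew_part c p \<and>
    beta1 (Om c p) (Jp c p) = frame_bivector (orbit_frame c p) (skew_part c p) (J0 c p ** orbit_frame c p) \<and>
    (\<exists>a b. v = orbit_frame c p *v a + (J0 c p ** orbit_frame c p) *v b) \<and>
    ((\<forall>i j. Im (beta $ i $ j) = - (1/4) * beta1 (Om c p) (Jp c p) $ i $ j) \<longrightarrow>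
       gcs1 (Om c p) (Jp c p) = exp_form (- gauge_form c p) ** gcs_poisson (J0 c p) beta ** exp_form (gauge_form c p)) \<and>
    skew_part c p $ i $ j = (Jp d p $ Inl i $ Inr j - Jp d p $ Inl j $ Inr i) / 2"
    if d: "adapted d" and pd: "p \<in> cdom d" for d beta v i j
  proof -
    let ?D = "dmap id c d p" and ?D' = "dmap id d c p"
    have pcd: "p \<in> cdom c \<inter> cdom d" using p pd by blast
    obtain P Q S Si A' where gk: "generalized_kahler_blocks P Q S Si A'" and Jd: "Jp d p = block 0 P Q 0" and
      eqs: "Om c p = transpose ?D ** block 0 (mat 1) (- mat 1) 0 ** ?D"
      "Jp c p = ?D' ** block 0 P Q 0 ** ?D" "J0 c p = ?D' ** block 0 S (- Si) 0 ** ?D" "orbit_frame c p = ?D' ** stack (mat 1) 0"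
      by (rule frame_data[OF c d pcd])
    interpret gk: generalized_kahler_blocks P Q S Si A' by (rule gk)
    have D: "?D ** ?D' = mat 1" using matrix_inverse_variants(2)[OF dmap_inverse[OF c adapted_in[OF d] pcd]] .
    note args = D eqs
    have "dmu_J c p = Q" unfolding dmu_J_def by (rule gk.Q_eq[OF args])
    then have skew_part: "skew_part c p = A'" by (simp add: skew_part_def gk.A_from_Q)
    have "\<exists>a b. v = orbit_frame c p *v a + (J0 c p ** orbit_frame c p) *v b"
    proof -
      \<comment> \<open>In the adapted chart the orbit frame is \<open>stack (mat 1) 0\<close> and
        its image under \<open>J0\<close> is \<open>stack 0 (- Si)\<close>; so \<open>a\<close> is
        the \<theta> part of the vector, and \<open>b\<close> is \<open>- S\<close> applied to its
        \<mu> part.\<close>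
      define a b :: "real^'n" where "a = (\<chi> i. (?D *v v) $ Inl i)" and "b = - (S *v (\<chi> i. (?D *v v) $ Inr i))"
      have st: "stack M N *v x = (\<chi> i. case i of Inl k \<Rightarrow> (M *v x) $ k | Inr k \<Rightarrow> (N *v x) $ k)"
        for M N :: "real^'n^'n" and x
        by (simp add: vec_eq_iff all_sum_iff matrix_vector_mul_component)
      have "?D *v v = stack (mat 1) 0 *v a + (block 0 S (- Si) 0 ** stack (mat 1) 0) *v b"
      proof -
        have "Si *v b = - (\<chi> i. (?D *v v) $ Inr i)"
          by (simp add: b_def matvec.minus_right matrix_vector_mul_assoc gk.SiS)
        then have "(- Si) *v b = (\<chi> i. (?D *v v) $ Inr i)" by (simp add: matvec.minus_left)
        then show ?thesis
          by (simp add: block_stack matrix_distribs st vec_eq_iff all_sum_iff a_def matvec.minus_left)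
      qed
      then have "?D' *v (?D *v v) = ?D' *v (stack (mat 1) 0 *v a + (block 0 S (- Si) 0 ** stack (mat 1) 0) *v b)"
        by simp
      then have "v = (?D' ** stack (mat 1) 0) *v a + (?D' ** block 0 S (- Si) 0 ** stack (mat 1) 0) *v b"
        using dmap_inverse[OF c adapted_in[OF d] pcd]
        by (simp add: matvec.add_right matrix_vector_mul_assoc matrix_mul_assoc)
      moreover have "J0 c p ** orbit_frame c p = ?D' ** block 0 S (- Si) 0 ** stack (mat 1) 0"
        unfolding eqs by (simp add: matrix_mul_assoc[symmetric] matrix_cancel D)
      ultimately show ?thesis using eqs(4) by metis
    qed
    moreover have "skew_part c p $ i $ j = (Jp d p $ Inl i $ Inr j - Jp d p $ Inl j $ Inr i) / 2"
      by (simp add: skew_part Jd gk.A_eq transpose_def)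
    moreover have "transpose (skew_part c p) = - skew_part c p" by (simp add: skew_part gk.transposes(3))
    moreover have "beta1 (Om c p) (Jp c p) = frame_bivector (orbit_frame c p) (skew_part c p) (J0 c p ** orbit_frame c p)"
      unfolding skew_part by (rule gk.beta1_bracket[OF args])
    moreover have "(\<forall>i j. Im (beta $ i $ j) = - (1/4) * beta1 (Om c p) (Jp c p) $ i $ j) \<longrightarrow>
       gcs1 (Om c p) (Jp c p) = exp_form (- gauge_form c p) ** gcs_poisson (J0 c p) beta ** exp_form (gauge_form c p)"
      unfolding gauge_form_def J_coframe_def skew_part using gk.gcs1_eq[OF args] by blast
    ultimately show ?thesis by blast
  qed
  obtain d where d: "adapted d" "p \<in> cdom d" using adapted_cover p by blast
  show "transpose (skew_part c p) = - skew_part c p" "beta1 (Om c p) (Jp c p) = frame_bivector (orbit_frame c p) (skew_part c p) (J0 c p ** orbit_frame c p)"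
    "\<exists>a b. v = orbit_frame c p *v a + (J0 c p ** orbit_frame c p) *v b"
    using main[OF d] by blast+
  show "gcs1 (Om c p) (Jp c p) = exp_form (- gauge_form c p) ** gcs_poisson (J0 c p) beta ** exp_form (gauge_form c p)"
    if "\<And>i j. Im (beta $ i $ j) = - (1/4) * beta1 (Om c p) (Jp c p) $ i $ j"
    using main[OF d, of _ beta] that by blast
  show "skew_part c p $ i $ j = (Jp d p $ Inl i $ Inr j - Jp d p $ Inl j $ Inr i) / 2" if "adapted d" "p \<in> cdom d" for d
    using main[OF that] by blast
qed

text \<open>Both sides are compared with a third, adapted chart around the point.\<close>

lemma skew_part_chart_independent:
  assumes "c \<in> A" "d \<in> A" "p \<in> cdom c \<inter> cdom d \<inter> U"
  shows "skew_part c p = skew_part d p"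
proof -
  obtain d' where d': "adapted d'" "p \<in> cdom d'" using adapted_cover assms by blast
  have "skew_part c p $ i $ j = skew_part d p $ i $ j" for i j
    using skew_part_adapted[OF assms(1) _ d', of i j] skew_part_adapted[OF assms(2) _ d', of i j] assms(3) by simp
  then show ?thesis by (simp add: vec_eq_iff)
qed

text \<open>On a coordinate ball, which is convex, a vanishing derivative gives constancy. One
  neighbourhood and one matrix work for all charts, since \<open>skew_part_adapted\<close> refers
  every chart to the same adapted one.\<close>

lemma skew_part_locally_constant:
  assumes p: "p \<in> U"
  obtains N A0 where "open N" "p \<in> N" "N \<subseteq> U" "transpose A0 = - A0"
    "\<And>c q. c \<in> A \<Longrightarrow> q \<in> cdom c \<inter> N \<Longrightarrow> skew_part c q = A0"
proof -
  obtain d where d: "adapted d" "p \<in> cdom d" using adapted_cover p by blast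
  have dA: "d \<in> A" using d(1) by (rule adapted_in)
  obtain r where r: "r > 0" "ball (crd d p) r \<subseteq> crd d ` cdom d"
    using open_image[OF dA] d(2) by (meson imageI open_contains_ball)
  let ?N = "pt d ` ball (crd d p) r"
  have sub: "?N \<subseteq> cdom d" using r pt_in[OF dA] by blast
  have const: "skew_part c (pt d x) = skew_part d p" if c: "c \<in> A" "pt d x \<in> cdom c" and x: "x \<in> ball (crd d p) r" for c x
  proof -
    have xd: "pt d x \<in> cdom d" using x sub by blast
    let ?f = "\<lambda>i j x. Jp d (pt d x) $ Inl i $ Inr j - Jp d (pt d x) $ Inl j $ Inr i"
    have "?f i j x = ?f i j (crd d p)" for i j
    proof (rule has_derivative_zero_unique[where s = "ball (crd d p) r" and f = "?f i j"])
      show "(?f i j has_derivative (\<lambda>h. 0)) (at y within ball (crd d p) r)" if "y \<in> ball (crd d p) r" for y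
        by (rule has_derivative_at_withinI[OF skew_part_derivative[OF d(1)]]) (use that r in blast)
    qed (use x r in auto)
    moreover have "pt d x \<in> U" "p \<in> U" using xd adapted_sub[OF d(1)] p by auto
    ultimately have "skew_part c (pt d x) $ i $ j = skew_part d p $ i $ j" for i j
      using skew_part_adapted[OF c(1) _ d(1) xd, of i j] skew_part_adapted[OF dA _ d, of i j] c(2) d(2) by (simp add: pt_crd[OF dA])
    then show ?thesis by (simp add: vec_eq_iff)
  qed
  show thesis
  proof (rule that)
    show "open ?N" by (rule open_pt_image[OF dA _ r(2)]) simp
    show "p \<in> ?N" using r pt_crd[OF dA d(2)] by (intro image_eqI[of _ _ "crd d p"]) auto
    show "?N \<subseteq> U" using sub adapted_sub[OF d(1)] by blast
    show "transpose (skew_part d p) = - skew_part d p" using skew_part_skew[OF dA] d(2) p by blast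
    show "skew_part c q = skew_part d p" if "c \<in> A" "q \<in> cdom c \<inter> ?N" for c q using const that by blast
  qed
qed

text \<open>The brackets are evaluated in an adapted chart and pulled back along the transition map:
  by naturality its differential sends each bracket to zero, and that differential is
  injective.\<close>

lemma commuting_frame_chart:
  assumes c: "c \<in> A" and S: "open S" "x \<in> S" "S \<subseteq> cimg c"
  shows "commuting_complex_frame (\<lambda>y. J0 c (pt c y)) (\<lambda>j y. fund act (e j) c (pt c y)) S x"
proof -
  let ?K = "\<lambda>y. J0 c (pt c y)" and ?V = "\<lambda>j y. fund act (e j) c (pt c y)"
  have xc: "x \<in> cimg c" using S by blast
  note px = pt_cimg[OF c xc]
  obtain d where d: "adapted d" "pt c x \<in> cdom d" using adapted_cover px by blast
  have dA: "d \<in> A" using d(1) by (rule adapted_in)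
  have xo: "x \<in> overlap c d" using px d(2) by (intro image_eqI[of _ _ "pt c x"]) auto
  let ?\<phi> = "\<lambda>y. crd d (pt c y)" and ?K' = "\<lambda>y. J0 d (pt d y)"
  have ov: "pt c y \<in> cdom c \<inter> cdom d \<inter> U" if "y \<in> overlap c d" for y
    using that adapted_sub[OF d(1)] by (auto simp: pt_crd c)
  have pd: "pt d (?\<phi> y) = pt c y" if "y \<in> overlap c d" for y
    using ov[OF that] by (simp add: pt_crd dA)
  have \<phi>x: "?\<phi> x \<in> crd d ` cdom d" using d(2) by blast
  have Kd: "?K differentiable (at x)"
    by (rule smooth_on_differentiable[OF J0_ac(1)[OF c] xc])
  have Vd: "?V j differentiable (at x)" for j
    by (rule smooth_on_differentiable[OF fund_smooth[OF c]]) (use xc in blast)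
  have KVd: "(\<lambda>y. ?K y *v ?V j y) differentiable (at x)" for j
    by (rule frechet_matrix_vector(2)[OF Kd Vd])
  have K'd: "(\<lambda>y. ?K' y *v axis (Inl j) 1) differentiable (at (?\<phi> x))" for j
    by (rule frechet_matrix_vector(2)[OF K_differentiable(3)[OF d(1) \<phi>x]]) simp
  have V': "axis (Inl j) 1 = frechet_derivative ?\<phi> (at y) (?V j y)" if "y \<in> overlap c d" for j y
    using fund_transform[OF c dA, of "pt c y" "e j"] ov[OF that] fund_adapted[OF d(1), of "pt c y" j]
    by (simp add: transition_frechet[OF c dA that])
  have KV': "?K' (?\<phi> y) *v axis (Inl j) 1 = frechet_derivative ?\<phi> (at y) (?K y *v ?V j y)" if "y \<in> overlap c d" for j y
  proof -
    have "frechet_derivative ?\<phi> (at y) (?K y *v ?V j y) = (dmap id c d (pt c y) ** J0 c (pt c y)) *v ?V j y"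
      by (simp add: transition_frechet[OF c dA that] matrix_vector_mul_assoc)
    also have "\<dots> = (J0 d (pt c y) ** dmap id c d (pt c y)) *v ?V j y"
      using J0_ac(3)[OF c dA] ov[OF that] by simp
    also have "\<dots> = J0 d (pt c y) *v axis (Inl j) 1"
      unfolding V'[OF that] by (simp add: transition_frechet[OF c dA that] matrix_vector_mul_assoc)
    finally show ?thesis by (simp add: pd that)
  qed
  have zero: "v = 0" if "frechet_derivative ?\<phi> (at x) v = 0" for v
  proof -
    have "dmap id d c (pt c x) *v (dmap id c d (pt c x) *v v) = v"
      using dmap_inverse[OF c dA, of "pt c x"] ov[OF xo] by (simp add: matrix_vector_mul_assoc)
    then show ?thesis using that by (simp add: transition_frechet[OF c dA xo])
  qed
  note push = lie_bracket_pushforward[OF open_overlap[OF c dA] xo transition_smooth[OF c dA]]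
  show ?thesis
  proof
    show "open S" "x \<in> S" by (rule S)+
    show "?K differentiable (at x)" by (rule Kd)
    show "?V j differentiable (at x)" for j by (rule Vd)
    show "?K y ** ?K y = - mat 1" if "y \<in> S" for y
      using J0_ac(2)[OF c] pt_cimg[OF c] that S(3) by blast
    show "lie_bracket (?V i) (?V j) x = 0" for i j
      by (rule zero, subst push[where X' = "\<lambda>y. axis (Inl i) 1" and Y' = "\<lambda>y. axis (Inl j) 1"])
        (simp_all add: Vd V' adapted_commuting[OF d(1) \<phi>x])
    show "lie_bracket (?V i) (\<lambda>y. ?K y *v ?V j y) x = 0" for i j
      by (rule zero, subst push[where X' = "\<lambda>y. axis (Inl i) 1" and Y' = "\<lambda>y. ?K' y *v axis (Inl j) 1"])
        (simp_all only: Vd KVd K'd differentiable_const V'[symmetric] KV' adapted_commuting[OF d(1) \<phi>x])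
    show "lie_bracket (\<lambda>y. ?K y *v ?V i y) (\<lambda>y. ?K y *v ?V j y) x = 0" for i j
      by (rule zero, subst push[where X' = "\<lambda>y. ?K' y *v axis (Inl i) 1" and Y' = "\<lambda>y. ?K' y *v axis (Inl j) 1"])
        (simp_all only: KVd K'd KV' adapted_commuting[OF d(1) \<phi>x])
    show "\<exists>a b. v = (\<Sum>j\<in>UNIV. a j *\<^sub>R ?V j x) + (\<Sum>j\<in>UNIV. b j *\<^sub>R (?K x *v ?V j x))" for v
    proof -
      obtain a b where "v = orbit_frame c (pt c x) *v a + (J0 c (pt c x) ** orbit_frame c (pt c x)) *v b"
        using frame_span[OF c] px by blast
      moreover have "orbit_frame c (pt c x) *v a = (\<Sum>j\<in>UNIV. a $ j *\<^sub>R ?V j x)" for a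
        by (simp add: vec_eq_iff orbit_frame_def matrix_vector_mult_def mult.commute)
      ultimately show ?thesis
        by (intro exI[of _ "\<lambda>j. a $ j"] exI[of _ "\<lambda>j. b $ j"])
          (simp add: matrix_vector_mul_assoc[symmetric] matvec.sum_right matvec.scaleR_right)
    qed
  qed
qed

section \<open>The bivector, the gauge form and their properties\<close>

abbreviation "bivec c p \<equiv> beta1 (Om c p) (Jp c p)"
abbreviation "\<beta> c p \<equiv> beta_of (J0 c p) (bivec c p)"
abbreviation "J0_orbit_frame c p \<equiv> J0 c p ** orbit_frame c p"

lemma J0_J0_orbit_frame: "c \<in> A \<Longrightarrow> p \<in> cdom c \<inter> U \<Longrightarrow> J0 c p ** J0_orbit_frame c p = - orbit_frame c p"
  by (rule matrix_cancel(2)[OF J0_ac(2)])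

lemma J0_bivec:
  assumes c: "c \<in> A" and p: "p \<in> cdom c \<inter> U"
  shows "J0 c p ** bivec c p = J0_orbit_frame c p ** skew_part c p ** transpose (J0_orbit_frame c p) - orbit_frame c p ** skew_part c p ** transpose (orbit_frame c p)"
proof -
  have "J0 c p ** bivec c p = J0_orbit_frame c p ** skew_part c p ** transpose (J0_orbit_frame c p) + (J0 c p ** J0_orbit_frame c p) ** skew_part c p ** transpose (orbit_frame c p)"
    unfolding beta1_frame[OF c p] frame_bivector_def by (simp only: matmul.add_right matrix_mul_assoc)
  then show ?thesis unfolding J0_J0_orbit_frame[OF c p] by (simp add: matmul.minus_left)
qed

text \<open>Write \<open>V\<close> for the orbit frame and \<open>W\<close> for its image under
  \<open>J0\<close>. Minus \<open>J0_bivec\<close>, minus \<i> times \<open>bivec\<close>, is the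
  expansion of \<open>(V - \<i> W) A (V - \<i> W)^T\<close>.\<close>

lemma beta_of_nth:
  assumes c: "c \<in> A" and x: "x \<in> cimg c"
  shows "\<beta> c (pt c x) $ i $ j = (1/4) * (\<Sum>q\<in>UNIV. complex_of_real (skew_part c (pt c x) $ fst q $ snd q) *
      (complex_field (\<lambda>y. J0 c (pt c y)) (\<lambda>y. fund act (e (fst q)) c (pt c y)) x i *
       complex_field (\<lambda>y. J0 c (pt c y)) (\<lambda>y. fund act (e (snd q)) c (pt c y)) x j))"
proof -
  let ?p = "pt c x"
  have p: "?p \<in> cdom c \<inter> U" using pt_cimg[OF c x] by blast
  have f: "complex_field (\<lambda>y. J0 c (pt c y)) (\<lambda>y. fund act (e a) c (pt c y)) x i
      = complex_of_real (orbit_frame c ?p $ i $ a) - \<i> * complex_of_real (J0_orbit_frame c ?p $ i $ a)" for a i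
    by (simp add: complex_field_def orbit_frame_def matrix_matrix_mult_def matrix_vector_mult_def)
  have "\<beta> c ?p $ i $ j = - (1/4) * (complex_of_real ((J0 c ?p ** bivec c ?p) $ i $ j) + \<i> * complex_of_real (bivec c ?p $ i $ j))"
    by (simp add: beta_of_def)
  also have "\<dots> = - (1/4) * (\<Sum>q\<in>UNIV. complex_of_real (skew_part c ?p $ fst q $ snd q) *
     (complex_of_real (J0_orbit_frame c ?p $ i $ fst q * J0_orbit_frame c ?p $ j $ snd q - orbit_frame c ?p $ i $ fst q * orbit_frame c ?p $ j $ snd q)
      + \<i> * complex_of_real (orbit_frame c ?p $ i $ fst q * J0_orbit_frame c ?p $ j $ snd q + J0_orbit_frame c ?p $ i $ fst q * orbit_frame c ?p $ j $ snd q)))"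
    unfolding J0_bivec[OF c p] unfolding beta1_frame[OF c p] frame_bivector_def
    by (simp add: sandwich_nth sum_distrib_left sum_subtractf[symmetric] sum.distrib[symmetric] algebra_simps)
  also have "\<dots> = (1/4) * (\<Sum>q\<in>UNIV. complex_of_real (skew_part c ?p $ fst q $ snd q) *
     ((complex_of_real (orbit_frame c ?p $ i $ fst q) - \<i> * complex_of_real (J0_orbit_frame c ?p $ i $ fst q)) *
      (complex_of_real (orbit_frame c ?p $ j $ snd q) - \<i> * complex_of_real (J0_orbit_frame c ?p $ j $ snd q))))"
    by (simp add: sum_distrib_left algebra_simps)
  finally show ?thesis by (simp only: f)
qed

lemma orbit_frame_smooth:
  assumes c: "c \<in> A"
  shows "smooth_on (cimg c) (\<lambda>x. orbit_frame c (pt c x))"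
proof -
  \<comment> \<open>The frame is assembled from its columns: the linear map places a vector in
    column \<open>j\<close>, and the sum over \<open>j\<close> restores the matrix.\<close>
  have h: "bounded_linear (\<lambda>v. \<chi> i k. if k = j then v $ i else 0 :: real^'n^('n+'n))" for j
    unfolding linear_conv_bounded_linear[symmetric] by (auto intro!: linearI simp: vec_eq_iff)
  have "smooth_on (cimg c) (\<lambda>x. fund act (e j) c (pt c x))" for j
    by (rule smooth_on_subset[OF fund_smooth[OF c] cimg_sub])
  then have "smooth_on (cimg c) (\<lambda>x. \<Sum>j\<in>UNIV. \<chi> i k. if k = j then fund act (e j) c (pt c x) $ i else 0 :: real^'n^('n+'n))"
    by (intro smooth_on_sum open_cimg[OF c] bounded_linear.smooth_on_comp[OF h open_cimg[OF c]])
  moreover have "(\<lambda>x. \<Sum>j\<in>UNIV. \<chi> i k. if k = j then fund act (e j) c (pt c x) $ i else 0) = (\<lambda>x. orbit_frame c (pt c x))"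
    by (simp add: fun_eq_iff vec_eq_iff orbit_frame_def)
  ultimately show ?thesis by simp
qed

lemma locally_constant_chart:
  assumes c: "c \<in> A" and x: "x \<in> cimg c"
  obtains S A0 where "open S" "x \<in> S" "S \<subseteq> cimg c" "transpose A0 = - A0" "\<forall>y\<in>S. skew_part c (pt c y) = A0"
proof -
  note px = pt_cimg[OF c x]
  obtain N A0 where N: "open N" "pt c x \<in> N" "N \<subseteq> U" "transpose A0 = - A0"
    "\<And>c q. c \<in> A \<Longrightarrow> q \<in> cdom c \<inter> N \<Longrightarrow> skew_part c q = A0"
    using skew_part_locally_constant[of "pt c x"] px by blast
  show thesis
  proof (rule that)
    show "open (crd c ` (cdom c \<inter> N))" by (rule open_crd_image[OF c N(1)])
    show "x \<in> crd c ` (cdom c \<inter> N)" using px N(2) by (intro image_eqI[of _ _ "pt c x"]) auto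
    show "crd c ` (cdom c \<inter> N) \<subseteq> cimg c" using N(3) by blast
    show "\<forall>y\<in>crd c ` (cdom c \<inter> N). skew_part c (pt c y) = A0"
      using N(5)[OF c] by (auto simp: pt_crd c)
  qed (rule N(4))
qed

text \<open>Near each point the bivector is a polynomial in the frame and \<open>J0\<close> with the
  constant matrix \<open>A0\<close>, so the inverse of the metric never enters the smoothness
  argument.\<close>

lemma beta_smooth: "smooth_field A U \<beta>"
  unfolding smooth_field_def
proof (intro ballI smooth_on_local)
  fix c x assume c: "c \<in> A" and x: "x \<in> cimg c"
  obtain S A0 where nbh: "open S" "x \<in> S" "S \<subseteq> cimg c" "transpose A0 = - A0" "\<forall>y\<in>S. skew_part c (pt c y) = A0"
    by (rule locally_constant_chart[OF c x])
  let ?V = "\<lambda>y. orbit_frame c (pt c y)" and ?K = "\<lambda>y. J0 c (pt c y)"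
  let ?b = "\<lambda>y. frame_bivector (?V y) A0 (?K y ** ?V y)"
  have V: "smooth_on S ?V" by (rule smooth_on_subset[OF orbit_frame_smooth[OF c] nbh(3)])
  have K: "smooth_on S ?K" by (rule smooth_on_subset[OF J0_ac(1)[OF c] nbh(3)])
  have b: "smooth_on S ?b"
    unfolding frame_bivector_def
    by (intro smooth_on_add nbh(1) matmul.smooth_on_prod bounded_linear.smooth_on_comp[OF bounded_linear_transpose] V K smooth_on_const)
  have h: "bounded_linear (\<lambda>X::real^('n+'n)^('n+'n). \<chi> i j. k * complex_of_real (X $ i $ j))" for k
    unfolding linear_conv_bounded_linear[symmetric]
    by (rule linearI; simp add: vec_eq_iff algebra_simps; simp add: scaleR_conv_of_real algebra_simps)
  let ?g = "\<lambda>y. (\<chi> i j. - (1/4) * complex_of_real ((?K y ** ?b y) $ i $ j)) + (\<chi> i j. - (1/4) * \<i> * complex_of_real (?b y $ i $ j))"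
  have "smooth_on S ?g"
    by (intro smooth_on_add nbh(1) bounded_linear.smooth_on_comp[OF h] matmul.smooth_on_prod b K)
  moreover have "?g y = \<beta> c (pt c y)" if "y \<in> S" for y
  proof -
    have "pt c y \<in> cdom c \<inter> U" using pt_cimg[OF c] that nbh(3) by blast
    then have "bivec c (pt c y) = ?b y" using beta1_frame[OF c] nbh(5)[rule_format, OF that] by simp
    then show ?thesis by (simp add: beta_of_def vec_eq_iff[of "_ + _"] algebra_simps)
  qed
  ultimately show "\<exists>T g. x \<in> T \<and> open T \<and> T \<subseteq> cimg c \<and> smooth_on T g \<and> (\<forall>y\<in>T. g y = \<beta> c (pt c y))"
    using nbh(1-3) by blast
qed

text \<open>Smoothness uses the constant local value of \<open>skew_part\<close>. The transformation
  law follows because \<open>J_coframe\<close> consists of 1-forms while \<open>skew_part\<close>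
  does not depend on the chart.\<close>

lemma gauge_form_two_form: "two_form A U gauge_form"
  unfolding two_form_def smooth_field_def
proof (intro conjI ballI)
  fix c assume c: "c \<in> A"
  show "smooth_on (cimg c) (\<lambda>x. gauge_form c (pt c x))"
  proof (rule smooth_on_local)
    fix x assume x: "x \<in> cimg c"
    obtain S A0 where nbh: "open S" "x \<in> S" "S \<subseteq> cimg c" "transpose A0 = - A0" "\<forall>y\<in>S. skew_part c (pt c y) = A0"
      by (rule locally_constant_chart[OF c x])
    have Sc: "S \<subseteq> crd c ` cdom c" using nbh(3) by blast
    let ?a = "\<lambda>y. transpose (Jp c (pt c y)) ** Om c (pt c y) ** orbit_frame c (pt c y)"
    have a: "smooth_on S ?a"
      by (intro nbh(1) matmul.smooth_on_prod bounded_linear.smooth_on_comp[OF bounded_linear_transpose]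
          smooth_on_subset[OF orbit_frame_smooth[OF c] nbh(3)] smooth_on_subset[OF Om_smooth[OF c] Sc] smooth_on_subset[OF Jp_ac(1)[OF c] Sc])
    have "smooth_on S (\<lambda>y. - (?a y ** A0 ** transpose (?a y)))"
      by (intro bounded_linear.smooth_on_comp[OF bounded_linear_minus[OF bounded_linear_ident]] nbh(1) matmul.smooth_on_prod
          bounded_linear.smooth_on_comp[OF bounded_linear_transpose] a smooth_on_const)
    moreover have "- (?a y ** A0 ** transpose (?a y)) = gauge_form c (pt c y)" if "y \<in> S" for y
      by (simp add: gauge_form_def J_coframe_def nbh(5)[rule_format, OF that])
    ultimately show "\<exists>T g. x \<in> T \<and> open T \<and> T \<subseteq> cimg c \<and> smooth_on T g \<and> (\<forall>y\<in>T. g y = gauge_form c (pt c y))"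
      using nbh(1-3) by (intro exI[of _ S] exI[of _ "\<lambda>y. - (?a y ** A0 ** transpose (?a y))"]) simp
  qed
  show "transpose (gauge_form c p) = - gauge_form c p" if "p \<in> cdom c \<inter> U" for p
    by (simp add: gauge_form_def matrix_distribs skew_part_skew[OF c that] matrix_mul_assoc)
  show "gauge_form c p = transpose (dmap id c d p) ** gauge_form d p ** dmap id c d p"
    if d: "d \<in> A" and p: "p \<in> cdom c \<inter> cdom d \<inter> U" for d p
  proof -
    let ?D = "dmap id c d p"
    have pcd: "p \<in> cdom c \<inter> cdom d" using p by blast
    have J: "transpose (Jp c p) ** transpose ?D = transpose ?D ** transpose (Jp d p)"
      using arg_cong[OF Jp_ac(3)[OF c d pcd], of transpose] by (simp add: matrix_transpose_mul)
    have "J_coframe c p = (transpose (Jp c p) ** transpose ?D) ** Om d p ** (?D ** orbit_frame c p)"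
      unfolding J_coframe_def Om_transform[OF c d pcd] by (simp only: matrix_mul_assoc)
    also have "\<dots> = transpose ?D ** J_coframe d p"
      unfolding J J_coframe_def orbit_frame_transform[OF c d pcd] by (simp only: matrix_mul_assoc)
    finally have "J_coframe c p = transpose ?D ** J_coframe d p" .
    moreover have "skew_part c p = skew_part d p" by (rule skew_part_chart_independent[OF c d p])
    ultimately show ?thesis
      by (simp add: gauge_form_def matrix_distribs matrix_mul_assoc)
  qed
qed

lemma beta_transform:
  assumes c: "c \<in> A" and d: "d \<in> A" and p: "p \<in> cdom c \<inter> cdom d \<inter> U"
  shows "\<beta> d p = cmat (dmap id c d p) ** \<beta> c p ** transpose (cmat (dmap id c d p))"
proof -
  let ?D = "dmap id c d p"
  have pcd: "p \<in> cdom c \<inter> cdom d" and pc: "p \<in> cdom c \<inter> U" and pd: "p \<in> cdom d \<inter> U" using p by blast+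
  have J: "J0 d p ** ?D = ?D ** J0 c p" by (rule J0_ac(3)[OF c d p])
  have "J0_orbit_frame d p = ?D ** J0_orbit_frame c p"
    unfolding orbit_frame_transform[OF c d pcd] by (simp add: matrix_mul_assoc J)
  then have b: "bivec d p = ?D ** bivec c p ** transpose ?D"
    unfolding beta1_frame[OF c pc] beta1_frame[OF d pd] frame_bivector_def skew_part_chart_independent[OF c d p]
      orbit_frame_transform[OF c d pcd]
    by (simp add: matrix_distribs matrix_mul_assoc)
  moreover have "J0 d p ** bivec d p = ?D ** (J0 c p ** bivec c p) ** transpose ?D"
    unfolding b by (simp add: matrix_mul_assoc J)
  ultimately show ?thesis
    unfolding beta_of_def cmat_conj_combination by simp
qed

lemma beta_bivector: "complex_bivector A U \<beta>"
  unfolding complex_bivector_def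
proof (intro conjI ballI beta_smooth beta_transform)
  fix c p assume c: "c \<in> A" and p: "p \<in> cdom c \<inter> U"
  have "transpose (bivec c p) = - bivec c p" "transpose (J0 c p ** bivec c p) = - (J0 c p ** bivec c p)"
    unfolding J0_bivec[OF c p] unfolding beta1_frame[OF c p] frame_bivector_def
    by (simp_all add: linear_transpose_simps matrix_transpose_mul skew_part_skew[OF c p])
      (simp_all add: matrix_distribs matrix_mul_assoc)
  note skew = this[THEN skew_nth]
  have "\<beta> c p $ j $ i = - \<beta> c p $ i $ j" for i j
    using skew(1)[of j i] skew(2)[of j i] by (simp add: beta_of_def field_simps)
  then show "transpose (\<beta> c p) = - \<beta> c p" unfolding skew_iff by blast
qed

text \<open>Multiplying \<open>J0 b + \<i> b\<close> by \<open>J0\<close> gives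
  \<open>- b + \<i> J0 b\<close>, which is \<i> times the original.\<close>

lemma beta_holomorphic_type:
  assumes c: "c \<in> A" and p: "p \<in> cdom c \<inter> U"
  shows "cmat (J0 c p) ** \<beta> c p = (\<chi> i j. \<i> * \<beta> c p $ i $ j)"
  unfolding beta_of_def cmat_mult_combination
  using matrix_cancel(2)[OF J0_ac(2)[OF c p], of "bivec c p"]
  by (simp add: vec_eq_iff algebra_simps)

lemma J0_complex_structure: "complex_structure A U J0"
  unfolding complex_structure_def Let_def
proof (intro conjI ballI allI impI J0)
  fix c x and X Y :: "real^('n+'n) \<Rightarrow> real^('n+'n)"
  assume c: "c \<in> A" and XY: "smooth_on (cimg c) X \<and> smooth_on (cimg c) Y" and x: "x \<in> cimg c"
  interpret commuting_complex_frame "\<lambda>y. J0 c (pt c y)" "\<lambda>j y. fund act (e j) c (pt c y)" "cimg c" x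
    by (rule commuting_frame_chart[OF c open_cimg[OF c] x subset_refl])
  show "lie_bracket (\<lambda>y. J0 c (pt c y) *v X y) (\<lambda>y. J0 c (pt c y) *v Y y) x -
       J0 c (pt c x) *v lie_bracket (\<lambda>y. J0 c (pt c y) *v X y) Y x -
       J0 c (pt c x) *v lie_bracket X (\<lambda>y. J0 c (pt c y) *v Y y) x - lie_bracket X Y x = 0"
    using nijenhuis_eq_0[of X Y, unfolded nijenhuis_def] XY smooth_on_differentiable[OF _ x] by blast
qed

text \<open>In a holomorphic chart \<open>J0\<close> is the constant \<open>Jstd\<close>, so the
  frame fields are holomorphic there; the coefficients \<open>A0\<close> are constant near the point
  considered.\<close>

lemma beta_holomorphic_coefficients:
  assumes c: "holomorphic_chart A U J0 c"
  shows "holomorphic_fun (crd c ` cdom c) (\<lambda>x. \<Sum>a\<in>UNIV. (\<beta> c (pt c x) *v dz j) $ a * dz k $ a)"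
  unfolding holomorphic_fun_def
proof
  fix x assume "x \<in> crd c ` cdom c"
  have cA: "c \<in> A" and std: "\<And>p. p \<in> cdom c \<Longrightarrow> J0 c p = Jstd" and sub: "cdom c \<subseteq> U"
    using c by (auto simp: holomorphic_chart_def)
  have x: "x \<in> cimg c" using \<open>x \<in> crd c ` cdom c\<close> sub by blast
  obtain S A0 where nbh: "open S" "x \<in> S" "S \<subseteq> cimg c" "transpose A0 = - A0" "\<forall>y\<in>S. skew_part c (pt c y) = A0"
    by (rule locally_constant_chart[OF cA x])
  interpret commuting_complex_frame "\<lambda>y. J0 c (pt c y)" "\<lambda>j y. fund act (e j) c (pt c y)" S x
    by (rule commuting_frame_chart[OF cA nbh(1-3)])
  interpret commuting_holomorphic_frame "\<lambda>y. J0 c (pt c y)" "\<lambda>j y. fund act (e j) c (pt c y)" S x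
    by unfold_locales (use std nbh(3) pt_cimg[OF cA] in blast)
  let ?f = "\<lambda>x. \<Sum>a\<in>UNIV. (\<beta> c (pt c x) *v dz j) $ a * dz k $ a"
  have "cauchy_riemann ?f x"
  proof (rule bivector_coefficient_cauchy_riemann)
    show "\<beta> c (pt c y) $ i $ j = (1/4) * (\<Sum>q\<in>UNIV. complex_of_real (A0 $ fst q $ snd q) * (Z (fst q) y i * Z (snd q) y j))"
      if "y \<in> S" for y i j
      using beta_of_nth[OF cA, of y i j] nbh(3,5) that by auto
  qed
  then obtain f' where f': "(?f has_derivative f') (at x)" "\<forall>v. f' (Jstd *v v) = \<i> * f' v"
    by (auto simp: cauchy_riemann_def)
  show "?f differentiable (at x) \<and>
      (\<forall>v. frechet_derivative ?f (at x) (Jstd *v v) = \<i> * frechet_derivative ?f (at x) v)"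
    using f'(2) Derivative.differentiableI[OF f'(1)] unfolding frechet_derivative_at[OF f'(1)] by (intro conjI)
qed

lemma beta_schouten:
  assumes c: "c \<in> A" and p: "p \<in> cdom c \<inter> U"
  shows "(\<Sum>l\<in>UNIV. \<beta> c p $ l $ i * pd \<beta> c l p $ j $ k + \<beta> c p $ l $ j * pd \<beta> c l p $ k $ i
      + \<beta> c p $ l $ k * pd \<beta> c l p $ i $ j) = 0"
proof -
  let ?x = "crd c p"
  have x: "?x \<in> cimg c" and px: "pt c ?x = p" using p by (auto simp: pt_crd c)
  obtain S A0 where nbh: "open S" "?x \<in> S" "S \<subseteq> cimg c" "transpose A0 = - A0" "\<forall>y\<in>S. skew_part c (pt c y) = A0"
    by (rule locally_constant_chart[OF c x])
  interpret commuting_complex_frame "\<lambda>y. J0 c (pt c y)" "\<lambda>j y. fund act (e j) c (pt c y)" S ?x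
    by (rule commuting_frame_chart[OF c nbh(1-3)])
  have "(\<lambda>y. \<beta> c (pt c y)) differentiable (at ?x)"
    using beta_smooth c x unfolding smooth_field_def by (blast intro: smooth_on_differentiable)
  moreover have "\<beta> c (pt c y) $ i $ j = (1/4) * (\<Sum>q\<in>UNIV. complex_of_real (A0 $ fst q $ snd q) * (Z (fst q) y i * Z (snd q) y j))"
    if "y \<in> S" for y i j
    using beta_of_nth[OF c, of y i j] nbh(3,5) that by auto
  moreover have "complex_of_real (A0 $ fst (prod.swap q) $ snd (prod.swap q)) = - complex_of_real (A0 $ fst q $ snd q)" for q
    using skew_nth[OF nbh(4), of "snd q" "fst q"] by simp
  ultimately have "(\<Sum>l\<in>UNIV. \<beta> c (pt c ?x) $ l $ i * pd \<beta> c l p $ j $ k + \<beta> c (pt c ?x) $ l $ j * pd \<beta> c l p $ k $ i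
      + \<beta> c (pt c ?x) $ l $ k * pd \<beta> c l p $ i $ j) = 0"
    unfolding pd_def by (rule schouten_bracket_eq_0)
  then show ?thesis unfolding px .
qed

end

theorem theorem4p5:
  fixes A :: "('m::{second_countable_topology,t2_space}, 'n::finite+'n) chart set"
    and Om Jp J0 :: "('m, 'n+'n, real^('n+'n)^('n+'n)) field"
    and act :: "complex^'n \<Rightarrow> 'm \<Rightarrow> 'm"
    and e :: "'n \<Rightarrow> real^'n"
    and mu :: "'m \<Rightarrow> real^'n"
    and beta :: "('m, 'n+'n, complex^('n+'n)^('n+'n)) field"
  assumes toric: "compact_toric A Om act e mu"
    and Jp: "Jp \<in> DGK A Om act e mu"
    and J0: "almost_complex A (interior_part mu) J0"
            "given_by_phi_s A act e mu Jp J0"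
    and beta: "\<And>c p. beta c p = beta_of (J0 c p) (beta1 (Om c p) (Jp c p))"
  shows "holomorphic_poisson A (interior_part mu) J0 beta \<and>
         (\<exists>B. two_form A (interior_part mu) B \<and>
           (\<forall>c\<in>A. \<forall>p \<in> cdom c \<inter> interior_part mu.
              gcs1 (Om c p) (Jp c p)
                = exp_form (- B c p) ** gcs_poisson (J0 c p) (beta c p) ** exp_form (B c p)))"
proof -
  interpret toric_dgk A Om Jp J0 act e mu
    by unfold_locales (fact toric Jp J0)+
  have b: "beta = (\<lambda>c p. beta_of (J0 c p) (beta1 (Om c p) (Jp c p)))"
    by (simp add: fun_eq_iff beta)
  \<comment> \<open>The factor \<open>-1/4\<close> in the bivector makes the block
    \<open>-4 Im\<close> of \<open>gcs_poisson\<close> equal to \<open>beta1\<close>, the upper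
    right block of \<open>gcs1\<close>.\<close>
  have im: "Im (beta c p $ i $ j) = - (1/4) * beta1 (Om c p) (Jp c p) $ i $ j" for c p i j
    by (simp add: beta beta_of_def)
  have "holomorphic_poisson A (interior_part mu) J0 beta"
    unfolding holomorphic_poisson_def b
    using J0_complex_structure beta_bivector beta_holomorphic_type beta_holomorphic_coefficients beta_schouten
    by blast
  moreover have "gcs1 (Om c p) (Jp c p) = exp_form (- gauge_form c p) ** gcs_poisson (J0 c p) (beta c p) ** exp_form (gauge_form c p)"
    if "c \<in> A" "p \<in> cdom c \<inter> interior_part mu" for c p
    using that im by (rule gcs1_frame)
  ultimately show ?thesis using gauge_form_two_form by blast
qed

end
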